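(* Suppose $m\in\mathbb{N}$, $n\in\mathbb{N}$, $\alpha\in(0,1)$, $r\in[0,\infty)$ and $u$ is the Lévy density of an infinite activity pure jump subordinator. Suppose that $$m>\frac{1+n\alpha}{1-\alpha},$$ that $u(x)$ is $m$-times differentiable in $x>0$, and that the functions $$v_\ell(x)=(-1)^\ell e^{-rx}x^{\ell+1}u^{(\ell)}(x)\qquad(\ell=0,\ldots,m)$$ are integrable and their integral modulus of continuity satisfies $$\omega^{(1)}(\delta;v_\ell)=\mathcal{O}(\delta^{1-\alpha})\qquad(\delta\to0),\quad \ell=0,\ldots,m.$$ Let $p(x;t)$ denote the probability densities corresponding to $u$. Then, for all $x>0$, $p(x;t)$ is $n$-times differentiable in $t\ge0$; furthermore, with $U^+(x)=\int_x^\infty u(y)\,dy$, $$u_k(x)=(-1)^k\frac{d^k}{dx^k}(U^+)^{*k}(x)\qquad(k=1,\ldots,n)$$ is well defined for $x>0$ and $$\frac{\partial^k}{\partial t^k}p(x;0)=u_k(x)\qquad(k=1,\ldots,n),\ x>0.$$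
   Context: The Lévy density of an infinite activity pure jump subordinator $\{X_t\}_{t\ge0}$ (no linear drift) is a function $u:(0,\infty)\to[0,\infty)$ with $\int_0^\infty(1\wedge x)u(x)\,dx<\infty$ and $\int_0^\infty u(x)\,dx=\infty$; $E[e^{-\theta X_t}]=e^{t\kappa(\theta)}$ with $\kappa(\theta)=\int_0^\infty(e^{-\theta x}-1)u(x)\,dx$ for $\Re\theta\ge0$. For $t>0$, $p(\cdot;t)$ is the probability density of $X_t$ on $(0,\infty)$ (the version continuous in $x>0$), and by convention $p(x;0)=0$ for $x>0$. Derivatives in $t$ at $t=0$ are derivatives from the right. The convolution is $(f*g)(x)=\int_0^xf(y)g(x-y)\,dy$ and $f^{*k}$ is the $k$-fold convolution power. For an integrable function $f$ on $\mathbb{R}$ and $\delta>0$, the integral modulus of continuity is $$\omega^{(1)}(\delta;f)=\sup_{0<|h|\le\delta}\int_{-\infty}^{+\infty}|f(x+h)-f(x)|\,dx;$$ functions defined a priori only for $x>0$ are extended by $f(x)=0$ for $x\le0$. *)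

theory Defs
  imports "HOL-Probability.Probability" "HOL-Library.Landau_Symbols"
begin

text \<open>
  Derivatives are taken at a point within \<open>S\<close>. For \<open>S = {0<..}\<close> these are the ordinary
  two-sided derivatives; for \<open>S = {0..}\<close> they are two-sided at positive points and
  right derivatives at \<open>0\<close>. Values of the function outside \<open>S\<close> play no role.
\<close>

primrec nth_deriv_on :: "real set \<Rightarrow> nat \<Rightarrow> (real \<Rightarrow> real) \<Rightarrow> real \<Rightarrow> real" where
  "nth_deriv_on S 0 f = f"
| "nth_deriv_on S (Suc k) f = (\<lambda>x. vector_derivative (nth_deriv_on S k f) (at x within S))"

definition times_differentiable_on :: "real set \<Rightarrow> nat \<Rightarrow> (real \<Rightarrow> real) \<Rightarrow> bool" where
  "times_differentiable_on S n f \<longleftrightarrow> (\<forall>k<n. nth_deriv_on S k f differentiable_on S)"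

definition infinite_activity_levy_density :: "(real \<Rightarrow> real) \<Rightarrow> bool" where
  "infinite_activity_levy_density u \<longleftrightarrow>
     (\<forall>x>0. 0 \<le> u x) \<and>
     set_integrable lborel {0<..} (\<lambda>x. min 1 x * u x) \<and>
     (\<integral>\<^sup>+ x\<in>{0<..}. ennreal (u x) \<partial>lborel) = \<infinity>"

definition laplace_exponent :: "(real \<Rightarrow> real) \<Rightarrow> complex \<Rightarrow> complex" where
  "laplace_exponent u \<theta> =
     (LINT x:{0<..}|lborel. (exp (- \<theta> * complex_of_real x) - 1) * complex_of_real (u x))"

definition subordinator :: "'a measure \<Rightarrow> (real \<Rightarrow> 'a \<Rightarrow> real) \<Rightarrow> bool" where
  "subordinator M X \<longleftrightarrow>
     prob_space M \<and>
     (\<forall>t\<ge>0. X t \<in> borel_measurable M) \<and>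
     (AE \<omega> in M. X 0 \<omega> = 0) \<and>
     (AE \<omega> in M. mono_on {0..} (\<lambda>t. X t \<omega>) \<and>
        (\<forall>t\<ge>0. continuous (at_right t) (\<lambda>s. X s \<omega>))) \<and>
     (\<forall>(\<tau> :: nat \<Rightarrow> real) N. 0 \<le> \<tau> 0 \<and> mono \<tau> \<longrightarrow>
        prob_space.indep_vars M (\<lambda>_. borel)
          (\<lambda>i \<omega>. X (\<tau> (Suc i)) \<omega> - X (\<tau> i) \<omega>) {..<N}) \<and>
     (\<forall>s\<ge>0. \<forall>t\<ge>0. distr M borel (\<lambda>\<omega>. X (s + t) \<omega> - X s \<omega>) = distr M borel (X t))"

text \<open>Absence of a linear drift is expressed by the form of the Laplace exponent.\<close>

definition pure_jump_subordinator_with_levy_density ::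
    "'a measure \<Rightarrow> (real \<Rightarrow> 'a \<Rightarrow> real) \<Rightarrow> (real \<Rightarrow> real) \<Rightarrow> bool" where
  "pure_jump_subordinator_with_levy_density M X u \<longleftrightarrow>
     subordinator M X \<and>
     (\<forall>t\<ge>0. \<forall>\<theta>. 0 \<le> Re \<theta> \<longrightarrow>
        (LINT \<omega>|M. exp (- \<theta> * complex_of_real (X t \<omega>)))
          = exp (complex_of_real t * laplace_exponent u \<theta>))"

text \<open>
  Nonnegativity is stated separately because \<open>ennreal\<close> maps negative numbers to \<open>0\<close>.
  Only the values \<open>p x t\<close> with \<open>x > 0\<close> and \<open>t \<ge> 0\<close> are constrained, and they are
  determined uniquely.
\<close>

definition continuous_densities ::
    "'a measure \<Rightarrow> (real \<Rightarrow> 'a \<Rightarrow> real) \<Rightarrow> (real \<Rightarrow> real \<Rightarrow> real) \<Rightarrow> bool" where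
  "continuous_densities M X p \<longleftrightarrow>
     (\<forall>t>0. distributed M lborel (X t) (\<lambda>x. ennreal (if x > 0 then p x t else 0)) \<and>
        (\<forall>x>0. 0 \<le> p x t) \<and>
        continuous_on {0<..} (\<lambda>x. p x t)) \<and>
     (\<forall>x>0. p x 0 = 0)"

text \<open>
  Only meant for integrable \<open>f\<close>, where the supremum is over a set bounded by twice the
  \<open>L\<^sup>1\<close>-norm of \<open>f\<close>.
\<close>

definition integral_modulus :: "real \<Rightarrow> (real \<Rightarrow> real) \<Rightarrow> real" where
  "integral_modulus \<delta> f = (SUP h\<in>{h. 0 < \<bar>h\<bar> \<and> \<bar>h\<bar> \<le> \<delta>}. LINT x|lborel. \<bar>f (x + h) - f x\<bar>)"

definition v_fun :: "real \<Rightarrow> (real \<Rightarrow> real) \<Rightarrow> nat \<Rightarrow> real \<Rightarrow> real" where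
  "v_fun r u l x =
     (if x > 0 then (-1) ^ l * exp (- r * x) * x ^ (l + 1) * nth_deriv_on {0<..} l u x else 0)"

definition conv :: "(real \<Rightarrow> real) \<Rightarrow> (real \<Rightarrow> real) \<Rightarrow> real \<Rightarrow> real" where
  "conv f g x = (LINT y:{0<..<x}|lborel. f y * g (x - y))"

text \<open>The \<open>k\<close>-fold convolution power, meaningful for \<open>k \<ge> 1\<close>; thus \<open>conv_power f 1 = f\<close>.\<close>

definition conv_power :: "(real \<Rightarrow> real) \<Rightarrow> nat \<Rightarrow> real \<Rightarrow> real" where
  "conv_power f k = ((\<lambda>g. conv g f) ^^ (k - 1)) f"

text \<open>All integrals occurring in the successive convolutions converge absolutely.\<close>

definition conv_power_exists :: "(real \<Rightarrow> real) \<Rightarrow> nat \<Rightarrow> bool" where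
  "conv_power_exists f k \<longleftrightarrow>
     (\<forall>j\<in>{1..<k}. \<forall>x>0. set_integrable lborel {0<..<x} (\<lambda>y. conv_power f j y * f (x - y)))"

definition upper_tail :: "(real \<Rightarrow> real) \<Rightarrow> real \<Rightarrow> real" where
  "upper_tail u x = (LINT y:{x<..}|lborel. u y)"

definition u_fun :: "(real \<Rightarrow> real) \<Rightarrow> nat \<Rightarrow> real \<Rightarrow> real" where
  "u_fun u k x = (-1) ^ k * nth_deriv_on {0<..} k (conv_power (upper_tail u) k) x"

definition u_fun_well_defined :: "(real \<Rightarrow> real) \<Rightarrow> nat \<Rightarrow> bool" where
  "u_fun_well_defined u k \<longleftrightarrow>
     (\<forall>x>0. set_integrable lborel {x<..} u) \<and>
     conv_power_exists (upper_tail u) k \<and>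
     times_differentiable_on {0<..} k (conv_power (upper_tail u) k)"

end

theory Submission
  imports Defs "HOL-Complex_Analysis.Complex_Analysis"
begin

text \<open>
  On a vertical line \<open>Re \<theta> = c > r\<close> the moduli of continuity of the functions \<open>v\<^sub>l\<close> turn into
  decay of their Laplace transforms, and repeated integration by parts turns this into
  \<open>\<kappa>\<^sup>(\<^sup>l\<^sup>)(\<theta>) = O(\<bar>\<theta>\<bar> powr (\<alpha> - l))\<close> for \<open>l \<le> m + 1\<close>. Multiplying a density by \<open>x ^ m\<close> differentiates
  its transform \<open>m\<close> times: every derivative of \<open>exp (t * \<kappa>)\<close> gains at least a factor \<open>O(\<bar>\<theta>\<bar> powr (\<alpha> - 1))\<close>,
  whereas every \<open>t\<close>-derivative costs only a factor \<open>\<kappa> = O(\<bar>\<theta>\<bar> powr \<alpha>)\<close>. As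
  \<open>m * (1 - \<alpha>) - n * \<alpha> > 1\<close>, the inversion integral of \<open>x ^ m * p x t\<close> can be differentiated \<open>n\<close> times
  under the integral sign; at \<open>t = 0\<close> the \<open>k\<close>-th derivative has the transform \<open>\<kappa> ^ k\<close>, differentiated
  \<open>m\<close> times. The upper tail has the transform \<open>- \<kappa> \<theta> / \<theta>\<close>, so \<open>\<kappa> ^ k\<close> is also \<open>(- 1) ^ k\<close> times the transform
  of the \<open>k\<close>-th derivative of its \<open>k\<close>-fold convolution power.
\<close>

text \<open>The law at time 0 is a point mass at 0 with transform 1. Hence integrability of
  \<open>exp (t * \<kappa>)\<close> along the line cannot be counted on for small t, let alone
  uniformly. Multiplication by \<open>x ^ m\<close> removes the point mass, in agreement with the
  convention \<open>p x 0 = 0\<close>. Since \<open>Re \<kappa>\<close> is nonpositive, the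
  remaining bounds are uniform on bounded time intervals including 0, and this is what yields
  one-sided derivatives there. The abscissa \<open>r + 1\<close> leaves the weight
  \<open>exp (- x)\<close> once \<open>exp (- r * x)\<close> has been absorbed in
  \<open>v_fun r u l\<close>. Contours are never shifted: growth is controlled on one line, and
  holomorphy in the half-plane serves to differentiate. For the convolution powers, the j-th
  derivative is represented by an inversion integral divided by \<open>x ^ m\<close>.
  Differentiating this quotient once more produces a term from the denominator, which cancels
  against the extra term of the Leibniz rule for \<open>z * f z\<close>; so no boundary values of
  derivatives at 0 enter.\<close>

section \<open>Integrals depending on a parameter\<close>

text \<open>The bilinear map \<open>D\<close> covers vector derivatives (scalar multiplication) and complex
  derivatives (multiplication) at once.\<close>

lemma has_derivative_lebesgue_integral:
  fixes f f' :: "'a::real_normed_vector \<Rightarrow> 'b \<Rightarrow> 'c::{banach,second_countable_topology}"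
    and D :: "'a \<Rightarrow> 'c \<Rightarrow> 'c"
  assumes D: "bounded_bilinear D" and nD: "\<And>h v. norm (D h v) \<le> norm h * norm v"
    and S: "convex S" "x0 \<in> S"
    and int: "\<And>x. x \<in> S \<Longrightarrow> integrable M (f x)"
    and meas: "f' x0 \<in> borel_measurable M"
    and der: "\<And>x y. x \<in> S \<Longrightarrow> y \<in> space M \<Longrightarrow>
                ((\<lambda>x. f x y) has_derivative (\<lambda>h. D h (f' x y))) (at x within S)"
    and bd: "\<And>x y. x \<in> S \<Longrightarrow> y \<in> space M \<Longrightarrow> norm (f' x y) \<le> g y"
    and g: "integrable M g"
  shows "((\<lambda>x. \<integral>y. f x y \<partial>M) has_derivative (\<lambda>h. D h (\<integral>y. f' x0 y \<partial>M))) (at x0 within S)"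
proof -
  have bl: "bounded_linear (D h)" "bounded_linear (\<lambda>h. D h v)" for h v
    using D by (simp_all add: bounded_bilinear.bounded_linear_right bounded_bilinear.bounded_linear_left)
  have int': "integrable M (f' x0)"
    by (rule Bochner_Integration.integrable_bound[OF g meas])
       (use bd S in \<open>auto intro!: AE_I2 intro: order_trans[OF _ abs_ge_self]\<close>)
  \<comment> \<open>The mean value inequality on the convex set \<open>S\<close> bounds increments
    by \<open>g\<close>. Together with the linear term, also bounded by \<open>g\<close>, this gives
    the majorant \<open>2 * g\<close> of the quotients \<open>q\<close> below.\<close>
  have lip: "norm (f x y - f x0 y) \<le> g y * norm (x - x0)" if "x \<in> S" "y \<in> space M" for x y
  proof (rule differentiable_bound[OF S(1) der])
    fix z assume z: "z \<in> S"
    show "onorm (\<lambda>h. D h (f' z y)) \<le> g y"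
    proof (rule onorm_bound)
      show "0 \<le> g y" using bd[OF z that(2)] norm_ge_zero order_trans by blast
      show "norm (D h (f' z y)) \<le> g y * norm h" for h
        using nD[of h "f' z y"] mult_left_mono[OF bd[OF z that(2)], of "norm h"]
        by (simp add: mult.commute)
    qed
  qed (use that S in auto)
  show ?thesis
    unfolding has_derivative_within
  proof
    show "bounded_linear (\<lambda>h. D h (\<integral>y. f' x0 y \<partial>M))" by (rule bl)
    show "((\<lambda>x. (1 / norm (x - x0)) *\<^sub>R ((\<integral>y. f x y \<partial>M) - ((\<integral>y. f x0 y \<partial>M) + D (x - x0) (\<integral>y. f' x0 y \<partial>M))))
            \<longlongrightarrow> 0) (at x0 within S)"
      unfolding tendsto_at_iff_sequentially
    proof (intro allI impI)
      fix X assume X: "\<forall>i. X i \<in> S - {x0}" and lim: "X \<longlonglongrightarrow> x0"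
      define q where "q i y = (1 / norm (X i - x0)) *\<^sub>R (f (X i) y - (f x0 y + D (X i - x0) (f' x0 y)))" for i y
      have XS: "X i \<in> S" for i using X by auto
      have intD: "integrable M (\<lambda>y. D h (f' x0 y))" for h
        by (rule integrable_bounded_linear[OF bl(1) int'])
      have intq: "integrable M (q i)" for i
        unfolding q_def using int[OF XS] int[OF S(2)] intD by auto
      have q: "(1 / norm (X i - x0)) *\<^sub>R ((\<integral>y. f (X i) y \<partial>M) - ((\<integral>y. f x0 y \<partial>M) + D (X i - x0) (\<integral>y. f' x0 y \<partial>M)))
         = (\<integral>y. q i y \<partial>M)" for i
        unfolding q_def using int[OF XS] int[OF S(2)] intD
        by (simp add: integral_bounded_linear[OF bl(1) int'])
      have "(\<lambda>i. \<integral>y. q i y \<partial>M) \<longlonglongrightarrow> (\<integral>y. 0 \<partial>M)"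
      proof (rule integral_dominated_convergence[where w = "\<lambda>y. 2 * g y"])
        show "(\<lambda>y. 0) \<in> borel_measurable M" by simp
        show "q i \<in> borel_measurable M" for i using intq by auto
        show "integrable M (\<lambda>y. 2 * g y)" using g by auto
        show "AE y in M. (\<lambda>i. q i y) \<longlonglongrightarrow> 0"
        proof (rule AE_I2)
          fix y assume "y \<in> space M"
          from der[OF S(2) this] have
            "((\<lambda>x. (1 / norm (x - x0)) *\<^sub>R (f x y - (f x0 y + D (x - x0) (f' x0 y)))) \<longlongrightarrow> 0) (at x0 within S)"
            unfolding has_derivative_within by auto
          then show "(\<lambda>i. q i y) \<longlonglongrightarrow> 0"
            unfolding tendsto_at_iff_sequentially q_def using X lim by (auto simp: o_def)
        qed
        show "AE y in M. norm (q i y) \<le> 2 * g y" for i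
        proof (rule AE_I2)
          fix y assume y: "y \<in> space M"
          have pos: "norm (X i - x0) > 0" using X by auto
          have "norm (f (X i) y - (f x0 y + D (X i - x0) (f' x0 y)))
             \<le> norm (f (X i) y - f x0 y) + norm (D (X i - x0) (f' x0 y))"
            by (metis diff_diff_eq norm_triangle_ineq4)
          also have "\<dots> \<le> g y * norm (X i - x0) + norm (X i - x0) * g y"
            by (intro add_mono lip XS y order_trans[OF nD] mult_left_mono bd S norm_ge_zero)
          finally show "norm (q i y) \<le> 2 * g y"
            using pos by (simp add: q_def divide_simps mult_ac)
        qed
      qed
      then show "((\<lambda>x. (1 / norm (x - x0)) *\<^sub>R ((\<integral>y. f x y \<partial>M) - ((\<integral>y. f x0 y \<partial>M) + D (x - x0) (\<integral>y. f' x0 y \<partial>M)))) \<circ> X) \<longlonglongrightarrow> 0"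
        by (simp add: o_def q)
    qed
  qed
qed

lemma has_vector_derivative_lebesgue_integral:
  fixes f :: "real \<Rightarrow> 'b \<Rightarrow> 'c::{banach,second_countable_topology}"
  assumes "convex S" "x0 \<in> S"
    and "\<And>x. x \<in> S \<Longrightarrow> integrable M (f x)"
    and "f' x0 \<in> borel_measurable M"
    and "\<And>x y. x \<in> S \<Longrightarrow> y \<in> space M \<Longrightarrow>
                ((\<lambda>x. f x y) has_vector_derivative f' x y) (at x within S)"
    and "\<And>x y. x \<in> S \<Longrightarrow> y \<in> space M \<Longrightarrow> norm (f' x y) \<le> g y"
    and "integrable M g"
  shows "((\<lambda>x. \<integral>y. f x y \<partial>M) has_vector_derivative (\<integral>y. f' x0 y \<partial>M)) (at x0 within S)"
  using assms unfolding has_vector_derivative_def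
  by (intro has_derivative_lebesgue_integral[where D = "(*\<^sub>R)" and g = g])
     (auto intro: bounded_bilinear_scaleR)

lemma has_field_derivative_lebesgue_integral:
  fixes f :: "complex \<Rightarrow> 'b \<Rightarrow> complex"
  assumes "convex S" "x0 \<in> S"
    and "\<And>x. x \<in> S \<Longrightarrow> integrable M (f x)"
    and "f' x0 \<in> borel_measurable M"
    and "\<And>x y. x \<in> S \<Longrightarrow> y \<in> space M \<Longrightarrow>
                ((\<lambda>x. f x y) has_field_derivative f' x y) (at x within S)"
    and "\<And>x y. x \<in> S \<Longrightarrow> y \<in> space M \<Longrightarrow> norm (f' x y) \<le> g y"
    and "integrable M g"
  shows "((\<lambda>x. \<integral>y. f x y \<partial>M) has_field_derivative (\<integral>y. f' x0 y \<partial>M)) (at x0 within S)"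
  using assms unfolding has_field_derivative_def
  by (subst mult_commute_abs[symmetric], intro has_derivative_lebesgue_integral[where D = "(*)" and g = g])
     (auto intro: bounded_bilinear_mult simp: norm_mult mult_commute_abs)

section \<open>Improper integrals over exhausting intervals\<close>

text \<open>Dominated convergence carries the integrals over \<open>{a n..b n}\<close> to the one
  over \<open>S\<close>, and the fundamental theorem turns them into boundary values. The endpoints
  are freely chosen sequences, so they can be placed where the boundary values are known to be
  small.\<close>

lemma set_integral_FTC_seq:
  fixes F f :: "real \<Rightarrow> 'a::euclidean_space"
  assumes S: "S \<in> sets lborel" and int: "set_integrable lborel S f"
    and ab: "\<And>n. a n \<le> b n" "\<And>n. {a n..b n} \<subseteq> S"
    and ev: "\<And>x. x \<in> S \<Longrightarrow> \<forall>\<^sub>F n in sequentially. x \<in> {a n..b n}"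
    and der: "\<And>x. x \<in> S \<Longrightarrow> (F has_vector_derivative f x) (at x)"
    and A: "(\<lambda>n::nat. F (a n)) \<longlonglongrightarrow> A" and B: "(\<lambda>n. F (b n)) \<longlonglongrightarrow> B"
  shows "(LINT x:S|lborel. f x) = B - A"
proof -
  have eq: "(LINT x:{a n..b n}|lborel. f x) = F (b n) - F (a n)" for n
  proof -
    have si: "set_integrable lborel {a n..b n} f"
      by (rule set_integrable_subset[OF int]) (use ab in auto)
    have "(f has_integral (F (b n) - F (a n))) {a n..b n}"
      using ab(1)[of n] ab(2)[of n] by (intro fundamental_theorem_of_calculus
        has_vector_derivative_at_within[OF der]) auto
    then show ?thesis using set_borel_integral_eq_integral(2)[OF si] by (simp add: integral_unique)
  qed
  have "(\<lambda>n. LINT x:{a n..b n}|lborel. f x) \<longlonglongrightarrow> (LINT x:S|lborel. f x)"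
    unfolding set_lebesgue_integral_def
  proof (rule integral_dominated_convergence[where w = "\<lambda>x. norm (indicator S x *\<^sub>R f x)"])
    show "(\<lambda>x. indicat_real S x *\<^sub>R f x) \<in> borel_measurable lborel"
      using int by (auto simp: set_integrable_def)
    show "(\<lambda>x. indicat_real {a n..b n} x *\<^sub>R f x) \<in> borel_measurable lborel" for n
    proof -
      have "set_integrable lborel {a n..b n} f"
        by (rule set_integrable_subset[OF int]) (use ab in auto)
      then show ?thesis by (auto simp: set_integrable_def)
    qed
    show "integrable lborel (\<lambda>x. norm (indicat_real S x *\<^sub>R f x))"
      by (rule integrable_norm) (use int in \<open>simp add: set_integrable_def\<close>)
    show "AE x in lborel. (\<lambda>n. indicat_real {a n..b n} x *\<^sub>R f x) \<longlonglongrightarrow> indicat_real S x *\<^sub>R f x"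
    proof (rule AE_I2)
      fix x
      show "(\<lambda>n. indicat_real {a n..b n} x *\<^sub>R f x) \<longlonglongrightarrow> indicat_real S x *\<^sub>R f x"
      proof (cases "x \<in> S")
        case True
        then show ?thesis
          by (intro tendsto_eventually eventually_mono[OF ev[OF True]]) (auto simp: indicator_def)
      next
        case False
        then have "x \<notin> {a n..b n}" for n using ab(2)[of n] by blast
        then show ?thesis using False by simp
      qed
    qed
    show "AE x in lborel. norm (indicat_real {a n..b n} x *\<^sub>R f x) \<le> norm (indicat_real S x *\<^sub>R f x)" for n
      using ab(2)[of n] by (intro AE_I2) (auto simp: indicator_def)
  qed
  moreover have "(\<lambda>n. LINT x:{a n..b n}|lborel. f x) \<longlonglongrightarrow> B - A"
    unfolding eq by (intro tendsto_diff A B)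
  ultimately show ?thesis by (rule LIMSEQ_unique)
qed

text \<open>The integrals of \<open>norm (w x)\<close> over intervals that eventually avoid each
  point tend to 0 by dominated convergence, and on each interval some value is not much larger than
  the mean. The points found here serve as endpoints when integrating by parts.\<close>

lemma integrable_small_values_on_escaping_intervals:
  fixes w :: "real \<Rightarrow> 'a::{banach,second_countable_topology}"
  assumes w: "integrable lborel w" and cd: "\<And>n::nat. c n < d n"
    and ev: "\<And>x. \<forall>\<^sub>F n in sequentially. x \<notin> {c n..d n}"
  obtains X where "\<And>n. X n \<in> {c n..d n}" "(\<lambda>n. norm (w (X n)) * (d n - c n)) \<longlonglongrightarrow> 0"
proof -
  define I where "I n = (\<integral>x. norm (indicator {c n..d n} x *\<^sub>R w x) \<partial>lborel)" for n
  have wi: "integrable lborel (\<lambda>x. indicator {c n..d n} x *\<^sub>R w x)" for n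
    using w by (simp add: integrable_mult_indicator)
  have I0: "I \<longlonglongrightarrow> (\<integral>x. 0 \<partial>(lborel::real measure))"
    unfolding I_def
  proof (rule integral_dominated_convergence[where w = "\<lambda>x. norm (w x)"])
    show "AE x in lborel. (\<lambda>n. norm (indicat_real {c n..d n} x *\<^sub>R w x)) \<longlonglongrightarrow> 0"
    proof (intro AE_I2 tendsto_eventually)
      show "\<forall>\<^sub>F n in sequentially. norm (indicat_real {c n..d n} x *\<^sub>R w x) = 0" for x
        using ev[of x] by eventually_elim auto
    qed
    show "AE x in lborel. norm (norm (indicat_real {c n..d n} x *\<^sub>R w x)) \<le> norm (w x)" for n
      by (intro AE_I2) (auto simp: indicator_def)
    show "(\<lambda>x. norm (indicat_real {c n..d n} x *\<^sub>R w x)) \<in> borel_measurable lborel" for n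
      using wi by measurable
    show "(\<lambda>x. 0) \<in> borel_measurable lborel" by simp
    show "integrable lborel (\<lambda>x. norm (w x))" using w by simp
  qed
  \<comment> \<open>The slack \<open>1 / Suc n\<close> lets the contradiction follow from
    monotonicity of the integral, without a strict integral inequality.\<close>
  have "\<exists>x\<in>{c n..d n}. norm (w x) * (d n - c n) < I n + 1 / Suc n" for n
  proof (rule ccontr)
    assume "\<not> ?thesis"
    then have *: "I n + 1 / Suc n \<le> norm (w x) * (d n - c n)" if "x \<in> {c n..d n}" for x
      using that by force
    define K where "K = (I n + 1 / Suc n) / (d n - c n)"
    have K: "K \<le> norm (w x)" if "x \<in> {c n..d n}" for x
      using *[OF that] cd[of n] by (simp only: K_def pos_divide_le_eq diff_gt_0_iff_gt)
    have "I n + 1 / Suc n = K * (d n - c n)" using cd[of n] by (simp add: K_def)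
    also have "\<dots> = (\<integral>x. indicator {c n..d n} x *\<^sub>R K \<partial>lborel)"
      using cd[of n] by simp
    also have "\<dots> \<le> (\<integral>x. norm (indicator {c n..d n} x *\<^sub>R w x) \<partial>lborel)"
    proof (rule integral_mono)
      show "integrable lborel (\<lambda>x. norm (indicat_real {c n..d n} x *\<^sub>R w x))"
        by (rule integrable_norm[OF wi])
      show "integrable lborel (\<lambda>x. indicat_real {c n..d n} x *\<^sub>R K)"
        using cd[of n] by (intro integrable_scaleR_left integrable_real_indicator) auto
      show "indicat_real {c n..d n} x *\<^sub>R K \<le> norm (indicat_real {c n..d n} x *\<^sub>R w x)" for x
        using K[of x] by (cases "x \<in> {c n..d n}") simp_all
    qed
    also have "\<dots> = I n" by (simp only: I_def)
    finally show False by (simp add: field_simps)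
  qed
  then obtain X where X: "\<And>n. X n \<in> {c n..d n}" "\<And>n. norm (w (X n)) * (d n - c n) < I n + 1 / Suc n"
    by metis
  have "(\<lambda>n. I n + 1 / Suc n) \<longlonglongrightarrow> 0 + 0"
    using I0 by (intro tendsto_add LIMSEQ_Suc[OF lim_1_over_n]) auto
  then have I1: "(\<lambda>n. I n + 1 / Suc n) \<longlonglongrightarrow> 0" by simp
  have "(\<lambda>n. norm (w (X n)) * (d n - c n)) \<longlonglongrightarrow> 0"
  proof (rule real_tendsto_sandwich[OF always_eventually always_eventually tendsto_const I1]; rule allI)
    show "0 \<le> norm (w (X n)) * (d n - c n)" for n
      using cd[of n] by (intro mult_nonneg_nonneg) auto
    show "norm (w (X n)) * (d n - c n) \<le> I n + 1 / Suc n" for n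
      using X(2)[of n] by simp
  qed
  then show thesis using X(1) that by blast
qed

text \<open>Each half-line carries a copy of \<open>x powr b\<close> on \<open>{1..}\<close>, moved
  there by the substitutions \<open>1 + y\<close> and \<open>1 - y\<close>; the sum of the copies is
  a majorant.\<close>

lemma integrable_one_plus_abs_powr:
  fixes b :: real
  assumes "b < -1"
  shows "integrable lborel (\<lambda>y::real. (1 + \<bar>y\<bar>) powr b)"
proof -
  have "(\<lambda>x. x powr b) absolutely_integrable_on {1..}"
    using has_integral_powr_to_inf[OF assms, of 1]
    by (intro nonnegative_absolutely_integrable_1) (auto simp: integrable_on_def)
  then have "set_integrable lborel {1..} (\<lambda>x. x powr b)"
    by (subst (asm) integrable_completion[symmetric, where M = lborel, unfolded set_integrable_def] | simp add: set_integrable_def integrable_completion)+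
  then have 1: "integrable lborel (\<lambda>y. indicator {1..} (1 + s * y) *\<^sub>R (1 + s * y) powr b)" if "s \<noteq> 0" for s
    using lborel_integrable_real_affine[of "\<lambda>x. indicator {1..} x *\<^sub>R (x powr b)" s 1] that
    by (simp add: set_integrable_def)
  show ?thesis
  proof (rule Bochner_Integration.integrable_bound[OF Bochner_Integration.integrable_add[OF 1[of 1] 1[of "-1"]]])
    show "AE y in lborel. norm ((1 + \<bar>y\<bar>) powr b) \<le> norm (indicat_real {1..} (1 + 1 * y) *\<^sub>R (1 + 1 * y) powr b +
              indicat_real {1..} (1 + - 1 * y) *\<^sub>R (1 + - 1 * y) powr b)"
      by (intro AE_I2) (auto simp: indicator_def)
  qed auto
qed

section \<open>Laplace transforms and their inversion\<close>

definition lap :: "(real \<Rightarrow> real) \<Rightarrow> complex \<Rightarrow> complex" where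
  "lap w \<theta> = (LINT x|lborel. exp (- \<theta> * complex_of_real x) * complex_of_real (w x))"

text \<open>Convergence is demanded for every \<open>s > r\<close> but not at \<open>r\<close>
  itself: the open condition leaves room to absorb powers of x.\<close>

definition lap_ok :: "real \<Rightarrow> (real \<Rightarrow> real) \<Rightarrow> bool" where
  "lap_ok r w \<longleftrightarrow> (\<forall>x\<le>0. w x = 0) \<and> w \<in> borel_measurable borel \<and>
     (\<forall>s>r. integrable lborel (\<lambda>x. exp (- s * x) * w x))"

lemma lap_okD:
  assumes "lap_ok r w"
  shows "x \<le> 0 \<Longrightarrow> w x = 0" "w \<in> borel_measurable borel"
    "s > r \<Longrightarrow> integrable lborel (\<lambda>x. exp (- s * x) * w x)"
  using assms by (auto simp: lap_ok_def)

lemma lap_integrand_integrable: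
  assumes w: "lap_ok r w" and \<theta>: "Re \<theta> > r"
  shows "integrable lborel (\<lambda>x. exp (- \<theta> * complex_of_real x) * complex_of_real (w x))"
  by (rule Bochner_Integration.integrable_bound[OF lap_okD(3)[OF w \<theta>]])
     (use lap_okD(2)[OF w] in \<open>auto simp: norm_mult\<close>)

text \<open>Half of the gap between \<open>s\<close> and \<open>r\<close> pays for the factor x,
  since \<open>e * x \<le> exp (e * x)\<close>.\<close>

lemma lap_ok_times_x:
  assumes w: "lap_ok r w"
  shows "lap_ok r (\<lambda>x. x * w x)"
  unfolding lap_ok_def
proof (intro conjI allI impI)
  note [measurable] = lap_okD(2)[OF w]
  show "(\<lambda>x. x * w x) \<in> borel_measurable borel" by measurable
  fix s assume s: "r < s"
  define e where "e = (s - r) / 2"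
  have e: "e > 0" "s - e > r" using s by (auto simp: e_def field_simps)
  show "integrable lborel (\<lambda>x. exp (- s * x) * (x * w x))"
  proof (rule Bochner_Integration.integrable_bound[OF integrable_mult_right[OF lap_okD(3)[OF w e(2)], of "1 / e"]])
    show "AE x in lborel. norm (exp (- s * x) * (x * w x)) \<le> norm (1 / e * (exp (- (s - e) * x) * w x))"
    proof (rule AE_I2)
      fix x
      show "norm (exp (- s * x) * (x * w x)) \<le> norm (1 / e * (exp (- (s - e) * x) * w x))"
      proof (cases "x > 0")
        case True
        have "e * x \<le> exp (e * x)" using exp_ge_add_one_self[of "e * x"] by linarith
        then have "x \<le> 1 / e * exp (e * x)" using e by (simp add: field_simps)
        then have "\<bar>w x\<bar> * exp (- s * x) * x \<le> \<bar>w x\<bar> * exp (- s * x) * (1 / e * exp (e * x))"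
          by (intro mult_left_mono) auto
        also have "\<dots> = norm (1 / e * (exp (- (s - e) * x) * w x))"
          using e by (simp add: abs_mult algebra_simps flip: exp_add)
        finally show ?thesis using True by (simp add: abs_mult mult_ac)
      qed (use lap_okD(1)[OF w] in auto)
    qed
  qed auto
qed (use lap_okD(1)[OF w] in auto)

lemma lap_ok_power_times:
  assumes "lap_ok r w"
  shows "lap_ok r (\<lambda>x. x ^ k * w x)"
proof (induction k)
  case (Suc k)
  then show ?case using lap_ok_times_x[OF Suc] by (simp add: mult.assoc)
qed (use assms in simp)

lemma lap_uminus: "lap (\<lambda>x. - w x) \<theta> = - lap w \<theta>"
  by (simp add: lap_def)

text \<open>On the half-plane \<open>s < Re z\<close>, with \<open>s\<close> halfway between
  \<open>r\<close> and \<open>Re \<theta>\<close>, the derivatives of the integrand have the common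
  majorant \<open>norm (exp (- s * x) * (x * w x))\<close>.\<close>

lemma has_field_derivative_lap:
  assumes w: "lap_ok r w" and \<theta>: "Re \<theta> > r"
  shows "(lap w has_field_derivative - lap (\<lambda>x. x * w x) \<theta>) (at \<theta>)"
proof -
  define s where "s = (r + Re \<theta>) / 2"
  define S where "S = {z. s < Re z}"
  have s: "s > r" "Re \<theta> > s" using \<theta> by (auto simp: s_def field_simps)
  have [measurable]: "w \<in> borel_measurable borel" by (rule lap_okD(2)[OF w])
  have "(lap w has_field_derivative (\<integral>x. exp (- \<theta> * complex_of_real x) * complex_of_real (- (x * w x)) \<partial>lborel)) (at \<theta> within S)"
    unfolding lap_def
  proof (rule has_field_derivative_lebesgue_integral[where g = "\<lambda>x. norm (exp (- s * x) * (x * w x))"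
       and f' = "\<lambda>z x. exp (- z * complex_of_real x) * complex_of_real (- (x * w x))"])
    show "convex S" unfolding S_def by (rule convex_halfspace_Re_gt)
    show "\<theta> \<in> S" using s by (simp add: S_def)
    show "integrable lborel (\<lambda>y. exp (- x * complex_of_real y) * complex_of_real (w y))" if "x \<in> S" for x
      using that s by (intro lap_integrand_integrable[OF w]) (auto simp: S_def)
    show "integrable lborel (\<lambda>x. norm (exp (- s * x) * (x * w x)))"
      by (rule integrable_norm[OF lap_okD(3)[OF lap_ok_times_x[OF w] s(1)]])
    show "norm (exp (- x * complex_of_real y) * complex_of_real (- (y * w y))) \<le> norm (exp (- s * y) * (y * w y))"
      if "x \<in> S" for x y
    proof (cases "y > 0")
      case True
      then show ?thesis using that by (auto simp: norm_mult abs_mult S_def intro!: mult_right_mono)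
    qed (use lap_okD(1)[OF w] in auto)
  qed (auto intro!: derivative_eq_intros)
  moreover have "open S" unfolding S_def by (rule open_halfspace_Re_gt)
  moreover have "\<theta> \<in> S" using s by (simp add: S_def)
  moreover have "(\<integral>x. exp (- \<theta> * complex_of_real x) * complex_of_real (- (x * w x)) \<partial>lborel) = - lap (\<lambda>x. x * w x) \<theta>"
    unfolding lap_uminus[symmetric] by (simp only: lap_def)
  ultimately show ?thesis by (simp only: at_within_open)
qed

lemma holomorphic_on_lap:
  assumes w: "lap_ok r w"
  shows "lap w holomorphic_on {z. r < Re z}"
  unfolding holomorphic_on_def field_differentiable_def
  using has_field_derivative_lap[OF w] has_field_derivative_at_within by blast

lemma higher_deriv_lap:
  assumes w: "lap_ok r w" and \<theta>: "Re \<theta> > r"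
  shows "(deriv ^^ k) (lap w) \<theta> = (-1) ^ k * lap (\<lambda>x. x ^ k * w x) \<theta>"
  using \<theta>
proof (induction k arbitrary: \<theta>)
  case (Suc k)
  have "((deriv ^^ k) (lap w) has_field_derivative (-1) ^ k * - lap (\<lambda>x. x * (x ^ k * w x)) \<theta>) (at \<theta>)"
  proof (rule has_field_derivative_transform_within_open[where S = "{z. r < Re z}"])
    show "((\<lambda>z. (-1) ^ k * lap (\<lambda>x. x ^ k * w x) z) has_field_derivative (-1) ^ k * - lap (\<lambda>x. x * (x ^ k * w x)) \<theta>) (at \<theta>)"
      by (intro DERIV_cmult has_field_derivative_lap[OF lap_ok_power_times[OF w] Suc.prems])
  qed (use Suc open_halfspace_Re_gt in auto)
  then show ?case by (simp add: DERIV_imp_deriv mult.assoc)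
qed auto

text \<open>Nonnegativity makes \<open>exp (- c * y) * w y\<close> a multiple of a probability
  density, so Levy's inversion formula gives the mass \<open>G u\<close> of \<open>{a<..u}\<close>
  as an integral of \<open>F u t * L t\<close>. Both sides are then differentiated in
  \<open>u\<close> at \<open>x\<close>: integrability of the transform justifies this on one side,
  continuity of \<open>w\<close> on the other.\<close>

lemma lap_inversion:
  assumes w: "lap_ok r w" and pos: "\<And>x. 0 \<le> w x" and cont: "continuous_on {0<..} w"
    and c: "c > r" and int: "integrable lborel (\<lambda>y. lap w (Complex c y))" and x: "x > 0"
  shows "complex_of_real (w x) =
    1 / (2 * pi) * (LINT y|lborel. exp (Complex c y * complex_of_real x) * lap w (Complex c y))"
proof -
  define f where "f y = exp (- c * y) * w y" for y
  have [measurable]: "w \<in> borel_measurable borel" by (rule lap_okD(2)[OF w])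
  have fpos: "f y \<ge> 0" for y using pos by (simp add: f_def)
  have fint: "integrable lborel f" unfolding f_def by (rule lap_okD(3)[OF w c])
  define A where "A = (\<integral>y. f y \<partial>lborel)"
  have A0: "A \<ge> 0" unfolding A_def using fpos by simp
  \<comment> \<open>The sign of \<open>t\<close> is reversed so that \<open>L\<close> is, up to
    normalisation, a characteristic function with kernel \<open>iexp (t * y)\<close>.\<close>
  define L where "L t = lap w (Complex c (- t))" for t
  have Lint: "integrable lborel L"
    using lborel_integrable_real_affine[OF int, of "-1" 0] by (simp add: L_def[abs_def])
  have L_eq: "L t = (LINT y|lborel. f y *\<^sub>R iexp (t * y))" for t
    unfolding L_def lap_def f_def
    by (rule Bochner_Integration.integral_cong)
       (auto simp: exp_of_real[symmetric] scaleR_conv_of_real exp_add[symmetric] complex_eq_iff Re_exp Im_exp exp_diff)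
  define a where "a = x / 2"
  define G where "G u = (LINT y:{a<..u}|lborel. f y)" for u
  \<comment> \<open>The kernel of the inversion formula, completed at \<open>t = 0\<close> by its
    limit; its derivative in \<open>u\<close> is then \<open>iexp (- (t * u))\<close> for every
    \<open>t\<close>.\<close>
  define F where "F u t = (if t = 0 then complex_of_real (u - a)
     else (iexp (- (t * a)) - iexp (- (t * u))) / (\<i> * t))" for u t :: real
  have Fmeas[measurable]: "F u \<in> borel_measurable borel" for u
    unfolding F_def by measurable
  have Fbd: "norm (F u t) \<le> u - a" if "a \<le> u" for u t
  proof (cases "t = 0")
    case True
    then show ?thesis using that by (simp add: F_def del: of_real_diff)
  next
    case False
    then have "F u t = (iexp (- t * u) - iexp (- t * a)) / (\<i> * (- t))"
      by (simp add: F_def field_simps)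
    then show ?thesis using Levy_Inversion_aux2[OF that, of "- t"] False by simp
  qed
  have FLint: "integrable lborel (\<lambda>t. F u t * L t)" if "a \<le> u" for u
  proof (rule Bochner_Integration.integrable_bound[OF integrable_mult_right[OF Lint, of "of_real (u - a)"]])
    show "AE t in lborel. norm (F u t * L t) \<le> norm (complex_of_real (u - a) * L t)"
      using Fbd[OF that] that by (auto simp: norm_mult intro!: mult_right_mono simp del: of_real_diff)
    show "(\<lambda>t. F u t * L t) \<in> borel_measurable lborel"
      using borel_measurable_integrable[OF Lint] by measurable
  qed
  have key: "complex_of_real (G u) = 1 / (2 * pi) * (LINT t|lborel. F u t * L t)" if u: "a \<le> u" for u
  proof (cases "A = 0")
    \<comment> \<open>Without mass no normalisation is possible, but then \<open>f\<close> vanishes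
      almost everywhere and both sides are 0.\<close>
    case True
    then have ae: "AE y in lborel. f y = 0"
      using integral_nonneg_eq_0_iff_AE[OF fint] fpos by (simp add: A_def)
    have "L t = 0" for t
      unfolding L_eq using ae by (subst integral_cong_AE[where g = "\<lambda>_. 0"]) (auto simp: f_def)
    moreover have "G u = 0"
      unfolding G_def set_lebesgue_integral_def
      using ae by (subst integral_cong_AE[where g = "\<lambda>_. 0"]) (auto simp: f_def)
    ultimately show ?thesis by simp
  next
    case False
    then have A: "A > 0" using A0 by simp
    define M where "M = density lborel (\<lambda>y. ennreal (f y / A))"
    have [measurable]: "f \<in> borel_measurable borel" using fint by auto
    have em: "emeasure M X = ennreal (LINT y:X|lborel. f y / A)" if [measurable]: "X \<in> sets borel" for X
    proof -
      have "integrable lborel (\<lambda>y. indicator X y *\<^sub>R (f y / A))"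
        using fint by (intro integrable_mult_indicator) auto
      then show ?thesis
        unfolding M_def set_lebesgue_integral_def
      proof (subst emeasure_density)
        assume i: "integrable lborel (\<lambda>y. indicator X y *\<^sub>R (f y / A))"
        have "(\<integral>\<^sup>+ y. ennreal (f y / A) * indicator X y \<partial>lborel)
            = (\<integral>\<^sup>+ y. ennreal (indicator X y *\<^sub>R (f y / A)) \<partial>lborel)"
          by (intro nn_integral_cong) (simp split: split_indicator)
        also have "\<dots> = ennreal (\<integral>y. indicator X y *\<^sub>R (f y / A) \<partial>lborel)"
          by (rule nn_integral_eq_integral[OF i]) (use A fpos in auto)
        finally show "(\<integral>\<^sup>+ y. ennreal (f y / A) * indicator X y \<partial>lborel)
            = ennreal (\<integral>y. indicator X y *\<^sub>R (f y / A) \<partial>lborel)" .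
      qed auto
    qed
    have meas: "measure M X = G' " if "X \<in> sets borel" "(LINT y:X|lborel. f y / A) = G'" for X G'
    proof -
      have "G' \<ge> 0" unfolding that(2)[symmetric] set_lebesgue_integral_def
        using fpos A by (intro Bochner_Integration.integral_nonneg) auto
      then show ?thesis using em[OF that(1)] that(2) by (simp add: measure_def)
    qed
    interpret prob_space M
    proof (rule prob_spaceI)
      show "emeasure M (space M) = 1"
        using em[of UNIV] A by (simp add: M_def set_lebesgue_integral_def A_def)
    qed
    interpret real_distribution M
      by unfold_locales (simp_all add: M_def)
    have chr: "char M t = L t / A" for t
    proof -
      have "char M t = (LINT y|lborel. (f y / A) *\<^sub>R iexp (t * y))"
        unfolding char_def M_def using A fpos by (subst integral_density) auto
      also have "\<dots> = (LINT y|lborel. (f y *\<^sub>R iexp (t * y)) / A)"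
        by (intro Bochner_Integration.integral_cong) (auto simp: scaleR_conv_of_real)
      finally show ?thesis by (simp add: L_eq)
    qed
    \<comment> \<open>The inversion formula asks for interval endpoints that carry no mass.\<close>
    have sing: "measure M {z} = 0" for z
    proof (rule meas)
      have "(LINT y:{z}|lborel. f y / A) = (\<integral>y. 0 \<partial>(lborel::real measure))"
        unfolding set_lebesgue_integral_def
      proof (rule integral_cong_AE)
        show "AE y in lborel. indicat_real {z} y *\<^sub>R (f y / A) = 0"
          by (rule eventually_mono[OF AE_lborel_singleton[of z]]) simp
      qed simp_all
      then show "(LINT y:{z}|lborel. f y / A) = 0" by simp
    qed auto
    define J where "J T = (CLBINT t=-T..T. (iexp (-(t * a)) - iexp (-(t * u))) / (\<i> * t) * char M t)" for T :: nat
    have "J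
         \<longlonglongrightarrow> (LINT t|lborel. F u t * (L t / A))"
    proof -
      have eq: "J T
           = (LINT t|lborel. indicator {-real T..real T} t *\<^sub>R (F u t * (L t / A)))" for T :: nat
      proof -
        have "J T
           = (CLBINT t:{-real T..real T}. (iexp (-(t * a)) - iexp (-(t * u))) / (\<i> * t) * char M t)"
          using interval_integral_Icc[of "- real T" "real T"] by (simp add: J_def)
        also have "\<dots> = (LINT t|lborel. indicator {-real T..real T} t *\<^sub>R (F u t * (L t / A)))"
          unfolding set_lebesgue_integral_def
        proof (rule integral_cong_AE)
          show "AE t in lborel. indicat_real {- real T..real T} t *\<^sub>R
              ((iexp (-(t * a)) - iexp (-(t * u))) / (\<i> * t) * char M t) =
              indicat_real {- real T..real T} t *\<^sub>R (F u t * (L t / A))"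
            by (rule eventually_mono[OF AE_lborel_singleton[of 0]]) (simp add: F_def chr)
        qed (use borel_measurable_integrable[OF Lint] in \<open>simp_all add: chr\<close>)
        finally show ?thesis .
      qed
      have i: "integrable lborel (\<lambda>t. F u t * (L t / A))"
        using integrable_divide[OF FLint[OF u], of "complex_of_real A"] by simp
      show ?thesis unfolding eq
      proof (rule integral_dominated_convergence[where w = "\<lambda>t. norm (F u t * (L t / A))"])
        show "(\<lambda>t. F u t * (L t / A)) \<in> borel_measurable lborel" using i by auto
        show "(\<lambda>t. indicator {-real T..real T} t *\<^sub>R (F u t * (L t / A))) \<in> borel_measurable lborel" for T
          using i by measurable
        show "integrable lborel (\<lambda>t. norm (F u t * (L t / A)))" by (rule integrable_norm[OF i])
        show "AE t in lborel. (\<lambda>T. indicator {-real T..real T} t *\<^sub>R (F u t * (L t / A))) \<longlonglongrightarrow> F u t * (L t / A)"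
        proof (intro AE_I2 tendsto_eventually)
          fix t :: real
          obtain N :: nat where "\<bar>t\<bar> \<le> N" using real_arch_simple by blast
          then show "\<forall>\<^sub>F T in sequentially. indicator {-real T..real T} t *\<^sub>R (F u t * (L t / A)) = F u t * (L t / A)"
            by (intro eventually_sequentiallyI[of N]) (auto simp: indicator_def)
        qed
        show "AE t in lborel. norm (indicat_real {- real T..real T} t *\<^sub>R (F u t * (L t / A))) \<le> norm (F u t * (L t / A))" for T
          by (auto simp: indicator_def)
      qed
    qed
    from tendsto_mult[OF tendsto_const[of "complex_of_real (1 / (2 * pi))"] this]
    have "(\<lambda>T. 1 / (2 * pi) * J T)
         \<longlonglongrightarrow> 1 / (2 * pi) * (LINT t|lborel. F u t * (L t / A))"
      by simp
    moreover have "(\<lambda>T. 1 / (2 * pi) * J T)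
         \<longlonglongrightarrow> of_real (measure M {a<..u})"
      using Levy_Inversion[OF u sing sing] by (simp only: J_def)
    ultimately have "of_real (measure M {a<..u}) = 1 / (2 * pi) * (LINT t|lborel. F u t * (L t / A))"
      using LIMSEQ_unique by blast
    moreover have "measure M {a<..u} = G u / A"
      by (rule meas) (auto simp: G_def)
    ultimately show ?thesis using A by (simp add: field_simps)
  qed
  have xa: "x \<in> {a<..<2 * x}" using x by (simp add: a_def)
  have "((\<lambda>u. LINT t|lborel. F u t * L t) has_vector_derivative (LINT t|lborel. iexp (- (t * x)) * L t)) (at x within {a<..<2 * x})"
  proof (rule has_vector_derivative_lebesgue_integral[where g = "\<lambda>t. norm (L t)" and f' = "\<lambda>x t. iexp (- (t * x)) * L t"])
    show "integrable lborel (\<lambda>t. F u t * L t)" if "u \<in> {a<..<2 * x}" for u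
      using that by (intro FLint) auto
    show "(\<lambda>t. iexp (- (t * x)) * L t) \<in> borel_measurable lborel"
      using borel_measurable_integrable[OF Lint] by measurable
    show "integrable lborel (\<lambda>t. norm (L t))" using Lint by (rule integrable_norm)
    fix u t :: real
    assume u: "u \<in> {a<..<2 * x}"
    show "((\<lambda>u. F u t * L t) has_vector_derivative iexp (- (t * u)) * L t) (at u within {a<..<2 * x})"
    proof (cases "t = 0")
      case True
      then show ?thesis unfolding F_def by (auto intro!: derivative_eq_intros)
    next
      case False
      then show ?thesis unfolding F_def
        by (auto intro!: derivative_eq_intros has_vector_derivative_real_field simp: field_simps)
    qed
  qed (use xa in \<open>auto simp: norm_mult\<close>)
  moreover have at_x: "at x within {a<..<2 * x} = at x"
    using xa by (intro at_within_open) auto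
  ultimately have "((\<lambda>u. LINT t|lborel. F u t * L t) has_vector_derivative (LINT t|lborel. iexp (- (t * x)) * L t)) (at x)"
    by simp
  from has_vector_derivative_mult_right[OF this, of "1 / (2 * pi)"]
  have "((\<lambda>u. 1 / (2 * pi) * (LINT t|lborel. F u t * L t)) has_vector_derivative
          1 / (2 * pi) * (LINT t|lborel. iexp (- (t * x)) * L t)) (at x)" .
  then have 1: "((\<lambda>u. complex_of_real (G u)) has_vector_derivative
          1 / (2 * pi) * (LINT t|lborel. iexp (- (t * x)) * L t)) (at x)"
    by (rule has_vector_derivative_transform_within_open[where S = "{a<..<2 * x}"])
       (use xa key in auto)
  have fcont: "continuous_on {a..2 * x} f" unfolding f_def
    by (intro continuous_intros continuous_on_subset[OF cont]) (use x in \<open>auto simp: a_def\<close>)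
  have "((\<lambda>u. integral {a..u} f) has_vector_derivative f x) (at x within {a..2 * x})"
    using integral_has_vector_derivative[OF fcont, of x] xa by auto
  then have "((\<lambda>u. integral {a..u} f) has_vector_derivative f x) (at x within {a<..<2 * x})"
    by (rule has_vector_derivative_within_subset) auto
  then have "((\<lambda>u. integral {a..u} f) has_vector_derivative f x) (at x)"
    by (simp only: at_x)
  then have "(G has_vector_derivative f x) (at x)"
  proof (rule has_vector_derivative_transform_within_open[where S = "{a<..<2 * x}"])
    fix u assume u: "u \<in> {a<..<2 * x}"
    have si: "set_integrable lborel {a<..u} f"
      unfolding set_integrable_def using fint by (intro integrable_mult_indicator) auto
    have "G u = integral {a<..u} f" unfolding G_def using set_borel_integral_eq_integral(2)[OF si] .
    also have "\<dots> = integral {a..u} f"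
      by (rule integral_spike_set) (auto intro: negligible_subset[OF negligible_sing[of a]])
    finally show "integral {a..u} f = G u" by simp
  qed (use xa in auto)
  then have "((\<lambda>u. complex_of_real (G u)) has_vector_derivative complex_of_real (f x)) (at x)"
    by (rule bounded_linear.has_vector_derivative[OF bounded_linear_of_real])
  then have e: "complex_of_real (f x) = 1 / (2 * pi) * (LINT t|lborel. iexp (- (t * x)) * L t)"
    using 1 vector_derivative_unique_at by blast
  have "(LINT y|lborel. exp (Complex c y * complex_of_real x) * lap w (Complex c y))
      = (LINT t|lborel. exp (Complex c (- t) * complex_of_real x) * L t)"
    unfolding L_def by (subst lborel_integral_real_affine[where c = "-1" and t = 0]) auto
  also have "\<dots> = (LINT t|lborel. exp (c * x) * (iexp (- (t * x)) * L t))"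
    by (intro Bochner_Integration.integral_cong)
       (auto simp: exp_of_real[symmetric] exp_add[symmetric] Complex_eq algebra_simps)
  also have "\<dots> = exp (c * x) * (LINT t|lborel. iexp (- (t * x)) * L t)"
    by (rule integral_mult_right_zero)
  finally have "1 / (2 * pi) * (LINT y|lborel. exp (Complex c y * complex_of_real x) * lap w (Complex c y))
     = exp (c * x) * complex_of_real (f x)" using e by simp
  also have "\<dots> = complex_of_real (w x)"
    by (simp add: f_def exp_of_real[symmetric] exp_add[symmetric] mult.assoc[symmetric])
  finally show ?thesis by simp
qed

section \<open>Decay of Laplace transforms\<close>

text \<open>A real supremum bounds its members only if the set is bounded above; by translation
  invariance, twice the L1 norm of \<open>v\<close> is a bound.\<close>

lemma integral_translation_diff_le_modulus:
  assumes v: "integrable lborel v" and h: "0 < \<bar>h\<bar>" "\<bar>h\<bar> \<le> \<delta>"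
  shows "(LINT x|lborel. \<bar>v (x + h) - v x\<bar>) \<le> integral_modulus \<delta> v"
  unfolding integral_modulus_def
proof (rule cSUP_upper)
  have sh: "integrable lborel (\<lambda>x. v (x + h))" "(LINT x|lborel. \<bar>v (x + h)\<bar>) = (LINT x|lborel. \<bar>v x\<bar>)" for h
    using lborel_integrable_real_affine[OF v, of 1 h]
      lborel_integral_real_affine[of 1 "\<lambda>x. \<bar>v x\<bar>" h] by (simp_all add: add.commute)
  show "bdd_above ((\<lambda>h. LINT x|lborel. \<bar>v (x + h) - v x\<bar>) ` {h. 0 < \<bar>h\<bar> \<and> \<bar>h\<bar> \<le> \<delta>})"
  proof (rule bdd_aboveI2)
    fix h :: real
    have "(LINT x|lborel. \<bar>v (x + h) - v x\<bar>) \<le> (LINT x|lborel. \<bar>v (x + h)\<bar> + \<bar>v x\<bar>)"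
      using v sh[of h] by (intro integral_mono) auto
    also have "\<dots> = 2 * (LINT x|lborel. \<bar>v x\<bar>)"
      using v sh[of h] by (subst Bochner_Integration.integral_add) auto
    finally show "(LINT x|lborel. \<bar>v (x + h) - v x\<bar>) \<le> 2 * (LINT x|lborel. \<bar>v x\<bar>)" .
  qed
qed (use h in auto)

text \<open>Translating by \<open>h = \<pi> / y\<close> flips the sign of the oscillating factor, so that the
  transform is controlled by the integral of \<open>\<bar>v (x + h) - v x\<bar>\<close>.\<close>

lemma laplace_decay_of_modulus:
  assumes v: "integrable lborel v" and v0: "\<And>x. x \<le> 0 \<Longrightarrow> v x = 0" and a: "a > 0"
    and O: "(\<lambda>\<delta>. integral_modulus \<delta> v) \<in> O[at_right 0](\<lambda>\<delta>. \<delta> powr a)"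
  shows "\<exists>C. \<forall>y. cmod (LINT x|lborel. exp (- Complex 1 y * complex_of_real x) * complex_of_real (v x))
            \<le> C * (1 + \<bar>y\<bar>) powr (- a)"
proof -
  from landau_o.bigE[OF O] obtain C0 where C0: "C0 > 0"
    "\<forall>\<^sub>F \<delta> in at_right 0. norm (integral_modulus \<delta> v) \<le> C0 * norm (\<delta> powr a)" by blast
  then obtain d0 where d0: "d0 > 0" "\<And>\<delta>. 0 < \<delta> \<Longrightarrow> \<delta> < d0 \<Longrightarrow> norm (integral_modulus \<delta> v) \<le> C0 * norm (\<delta> powr a)"
    by (auto simp: eventually_at_right_field)
  \<comment> \<open>\<open>d \<le> 1\<close> keeps every shift \<open>h\<close> within 1, so the
    integrand below vanishes for \<open>x \<le> -1\<close> and \<open>exp (- x) \<le> exp 1\<close>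
    elsewhere; \<open>d < d0\<close> keeps \<open>h\<close> in the range of the modulus
    bound.\<close>
  define d where "d = min d0 1 / 2"
  have d: "0 < d" "d \<le> 1" "d < d0" using d0 by (auto simp: d_def min_def)
  define E where "E y x = exp (- Complex 1 y * complex_of_real x)" for y x
  define J where "J y = (LINT x|lborel. E y x * complex_of_real (v x))" for y
  define V where "V = (LINT x|lborel. \<bar>v x\<bar>)"
  have [measurable]: "v \<in> borel_measurable borel" using v by auto
  have nE: "norm (E y x) = exp (- x)" for x y by (simp add: E_def)
  have [measurable]: "E y \<in> borel_measurable borel" for y unfolding E_def[abs_def] by measurable
  have bound: "norm (E y x * complex_of_real (v x)) \<le> \<bar>v x\<bar>" for x y
    using v0[of x] by (cases "x > 0") (auto simp: nE norm_mult intro!: mult_left_le_one_le)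
  have Ev: "integrable lborel (\<lambda>x. E y x * complex_of_real (v x))" for y
    by (rule Bochner_Integration.integrable_bound[OF integrable_abs[OF v]]) (use bound in auto)
  have JV: "norm (J y) \<le> V" for y
    unfolding J_def V_def using bound v by (intro Bochner_Integration.integral_norm_bound_integral Ev) auto
  \<comment> \<open>\<open>\<bar>y\<bar> \<ge> Y\<close> says that the shift \<open>pi / y\<close>
    has size at most \<open>d\<close>.\<close>
  define Y where "Y = pi / d"
  have Y: "Y > 0" using d by (simp add: Y_def)
  have big: "norm (J y) \<le> exp 1 * C0 * (pi / \<bar>y\<bar>) powr a" if y: "\<bar>y\<bar> \<ge> Y" for y
  proof -
    define h where "h = pi / y"
    have y0: "y \<noteq> 0" using y Y by auto
    have h: "0 < \<bar>h\<bar>" "\<bar>h\<bar> \<le> d"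
      using y0 y d by (auto simp: h_def Y_def divide_simps mult.commute)
    have Eh: "E y (x + h) = - exp (- h) * E y x" for x
    proof -
      have "E y (x + h) = E y x * exp (- Complex 1 y * complex_of_real h)"
        by (simp add: E_def ring_distribs flip: exp_add)
      also have "- Complex 1 y * complex_of_real h = complex_of_real (- h) - \<i> * pi"
        using y0 by (simp add: complex_eq_iff h_def)
      also have "exp (complex_of_real (- h) - \<i> * pi) = - exp (- h)"
        by (simp add: exp_diff flip: exp_of_real)
      finally show ?thesis by simp
    qed
    have Evh: "integrable lborel (\<lambda>x. E y x * complex_of_real (v (x + h)))"
      using integrable_mult_right[OF lborel_integrable_real_affine[OF Ev[of y], of 1 h], of "- exp (complex_of_real h)"]
      by (simp add: add.commute Eh mult.assoc[symmetric] exp_of_real[symmetric] exp_add[symmetric])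
    have "J y = (LINT x|lborel. E y (x + h) * complex_of_real (v (x + h)))"
      unfolding J_def by (subst lborel_integral_real_affine[where c = 1 and t = h]) (auto simp: add.commute)
    also have "\<dots> = (LINT x|lborel. - exp (- h) * (E y x * complex_of_real (v (x + h))))"
      by (simp add: Eh mult.assoc)
    also have "\<dots> = - exp (- h) * (LINT x|lborel. E y x * complex_of_real (v (x + h)))"
      by (rule integral_mult_right_zero)
    finally have Jh: "(LINT x|lborel. E y x * complex_of_real (v (x + h))) = - exp h * J y"
      by (simp add: exp_minus field_simps)
    have "(1 + exp h) * J y = J y - (LINT x|lborel. E y x * complex_of_real (v (x + h)))"
      by (simp add: Jh algebra_simps)
    also have "\<dots> = (LINT x|lborel. E y x * complex_of_real (v x) - E y x * complex_of_real (v (x + h)))"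
      unfolding J_def by (rule Bochner_Integration.integral_diff[OF Ev Evh, symmetric])
    finally have eq: "(1 + exp h) * J y = \<dots>" .
    have vd: "integrable lborel (\<lambda>x. \<bar>v (x + h) - v x\<bar>)"
      using v lborel_integrable_real_affine[OF v, of 1 h] by (auto simp: add.commute)
    have "norm (J y) \<le> (1 + exp h) * norm (J y)"
      by (simp add: distrib_right)
    also have "\<dots> = norm ((1 + exp h) * J y)"
    proof -
      have "norm (1 + complex_of_real (exp h)) = 1 + exp h"
        by (metis abs_of_pos add_pos_pos exp_gt_zero norm_of_real of_real_1 of_real_add zero_less_one)
      then show ?thesis by (simp add: norm_mult)
    qed
    also have "\<dots> \<le> (LINT x|lborel. exp 1 * \<bar>v (x + h) - v x\<bar>)"
      unfolding eq
    proof (rule Bochner_Integration.integral_norm_bound_integral)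
      show "norm (E y x * complex_of_real (v x) - E y x * complex_of_real (v (x + h))) \<le> exp 1 * \<bar>v (x + h) - v x\<bar>" for x
      proof (cases "x > -1")
        case True
        have "norm (E y x * complex_of_real (v x) - E y x * complex_of_real (v (x + h))) = exp (- x) * \<bar>v x - v (x + h)\<bar>"
          by (metis nE norm_mult norm_of_real of_real_diff right_diff_distrib)
        also have "\<dots> \<le> exp 1 * \<bar>v x - v (x + h)\<bar>" using True by (intro mult_right_mono) auto
        finally show ?thesis by (simp add: abs_minus_commute)
      next
        case False
        then show ?thesis using v0[of x] v0[of "x + h"] h d by simp
      qed
    qed (use Ev Evh vd in auto)
    also have "\<dots> = exp 1 * (LINT x|lborel. \<bar>v (x + h) - v x\<bar>)" by simp
    also have "\<dots> \<le> exp 1 * integral_modulus \<bar>h\<bar> v"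
      using h by (intro mult_left_mono integral_translation_diff_le_modulus[OF v]) auto
    also have "\<dots> \<le> exp 1 * (C0 * \<bar>h\<bar> powr a)"
      using d0(2)[of "\<bar>h\<bar>"] h d by (intro mult_left_mono) auto
    finally show ?thesis by (simp add: h_def abs_divide mult.assoc)
  qed
  \<comment> \<open>The first summand compares \<open>pi / \<bar>y\<bar>\<close> with
    \<open>1 / (1 + \<bar>y\<bar>)\<close> for \<open>\<bar>y\<bar> \<ge> Y\<close>; the second
    covers the remaining \<open>y\<close> by the trivial bound \<open>V\<close>.\<close>
  define C where "C = exp 1 * C0 * (pi * (1 + 1 / Y)) powr a + V * (1 + Y) powr a"
  have V0: "V \<ge> 0" by (simp add: V_def)
  have "norm (J y) \<le> C * (1 + \<bar>y\<bar>) powr (- a)" for y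
  proof (cases "\<bar>y\<bar> \<ge> Y")
    case True
    then have y0: "\<bar>y\<bar> > 0" using Y by linarith
    have "1 + \<bar>y\<bar> \<le> (1 + 1 / Y) * \<bar>y\<bar>"
      using True Y by (simp add: field_simps)
    then have "1 \<le> (1 + 1 / Y) * \<bar>y\<bar> / (1 + \<bar>y\<bar>)"
      by (subst pos_le_divide_eq) simp_all
    then have "pi * 1 \<le> pi * ((1 + 1 / Y) * \<bar>y\<bar> / (1 + \<bar>y\<bar>))"
      by (rule mult_left_mono) simp
    then have "pi / \<bar>y\<bar> \<le> pi * (1 + 1 / Y) * inverse (1 + \<bar>y\<bar>)"
      using y0 by (subst pos_divide_le_eq) (simp_all add: divide_inverse mult_ac)
    then have "(pi / \<bar>y\<bar>) powr a \<le> (pi * (1 + 1 / Y) * inverse (1 + \<bar>y\<bar>)) powr a"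
      using a y0 by (intro powr_mono2) auto
    also have "\<dots> = (pi * (1 + 1 / Y)) powr a * (1 + \<bar>y\<bar>) powr (- a)"
      using Y by (subst powr_mult) (auto simp: powr_minus inverse_powr)
    finally have "(pi / \<bar>y\<bar>) powr a \<le> (pi * (1 + 1 / Y)) powr a * (1 + \<bar>y\<bar>) powr (- a)" .
    then have "exp 1 * C0 * (pi / \<bar>y\<bar>) powr a \<le> exp 1 * C0 * ((pi * (1 + 1 / Y)) powr a * (1 + \<bar>y\<bar>) powr (- a))"
      using C0 by (intro mult_left_mono) auto
    also have "\<dots> \<le> C * (1 + \<bar>y\<bar>) powr (- a)"
      using V0 by (simp add: C_def distrib_right mult.assoc)
    finally show ?thesis using big[OF True] by linarith
  next
    case False
    have "(1 + \<bar>y\<bar>) powr a \<le> (1 + Y) powr a" using False a by (intro powr_mono2) auto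
    then have "1 \<le> (1 + Y) powr a * (1 + \<bar>y\<bar>) powr (- a)"
      by (simp add: powr_minus field_simps)
    then have "V * 1 \<le> V * ((1 + Y) powr a * (1 + \<bar>y\<bar>) powr (- a))"
      using V0 by (rule mult_left_mono)
    also have "\<dots> \<le> C * (1 + \<bar>y\<bar>) powr (- a)"
      using C0 by (simp add: C_def distrib_right mult.assoc)
    finally show ?thesis using JV[of y] by linarith
  qed
  then show ?thesis unfolding J_def E_def by blast
qed

text \<open>The boundary terms vanish only along suitable sequences; at \<open>0\<close> such a sequence exists because
  \<open>w x / x\<close> is integrable there.\<close>

lemma lap_by_parts:
  assumes w: "lap_ok r w" and w': "lap_ok r w'" and wx: "lap_ok r (\<lambda>x. w x / x)"
    and der: "\<And>x. x > 0 \<Longrightarrow> (w has_real_derivative w' x) (at x)" and \<theta>: "Re \<theta> > r"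
  shows "\<theta> * lap w \<theta> = lap w' \<theta>"
proof -
  define F where "F x = exp (- \<theta> * complex_of_real x) * complex_of_real (w x)" for x
  define f where "f x = exp (- \<theta> * complex_of_real x) * complex_of_real (w' x) - \<theta> * F x" for x
  have i1: "integrable lborel F" unfolding F_def by (rule lap_integrand_integrable[OF w \<theta>])
  have fint: "integrable lborel f" unfolding f_def
    by (intro Bochner_Integration.integrable_diff lap_integrand_integrable[OF w' \<theta>] integrable_mult_right i1)
  have f0: "f x = 0" if "x \<le> 0" for x
    using lap_okD(1)[OF w that] lap_okD(1)[OF w' that] by (simp add: f_def F_def)
  have ia: "integrable lborel (\<lambda>x. exp (- \<theta> * complex_of_real x) * complex_of_real (w x / x))"
    by (rule lap_integrand_integrable[OF wx \<theta>])
  have eva: "\<forall>\<^sub>F n in sequentially. x \<notin> {1 / (2 * real (Suc n))..1 / real (Suc n)}" for x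
  proof (cases "x > 0")
    case True
    have "(\<lambda>n. 1 / real (Suc n)) \<longlonglongrightarrow> 0" by (rule LIMSEQ_Suc[OF lim_1_over_n])
    from order_tendstoD(2)[OF this True] show ?thesis by eventually_elim auto
  next
    case False
    moreover have "0 < 1 / (2 * real (Suc n))" for n by simp
    ultimately have "x \<notin> {1 / (2 * real (Suc n))..1 / real (Suc n)}" for n
      by (meson atLeastAtMost_iff less_le_trans)
    then show ?thesis by simp
  qed
  define q where "q x = exp (- \<theta> * complex_of_real x) * complex_of_real (w x / x)" for x
  \<comment> \<open>The length of each window is half its upper endpoint. As \<open>F x\<close> is x
    times \<open>q x\<close>, smallness of \<open>norm (q x)\<close> times the length is smallness
    of \<open>norm (F x)\<close>.\<close>
  define a0 a1 where "a0 n = 1 / (2 * real (Suc n))" and "a1 n = 1 / real (Suc n)" for n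
  have iq: "integrable lborel q" using ia by (simp add: q_def[abs_def])
  have lta: "a0 n < a1 n" for n
    unfolding a0_def a1_def by (rule divide_strict_left_mono) auto
  have eva': "\<forall>\<^sub>F n in sequentially. x \<notin> {a0 n..a1 n}" for x
    using eva[of x] by (simp only: a0_def a1_def)
  obtain a where a': "\<And>n. a n \<in> {a0 n..a1 n}" and la: "(\<lambda>n. norm (q (a n)) * (a1 n - a0 n)) \<longlonglongrightarrow> 0"
    using integrable_small_values_on_escaping_intervals[OF iq lta eva'] by metis
  have a: "a n \<in> {1 / (2 * real (Suc n))..1 / real (Suc n)}" for n
    using a'[of n] by (simp only: a0_def a1_def)
  have apos: "a n > 0" for n
  proof -
    have "0 < 1 / (2 * real (Suc n))" by simp
    then show ?thesis using a[of n] by (meson atLeastAtMost_iff less_le_trans)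
  qed
  have evb: "\<forall>\<^sub>F n in sequentially. x \<notin> {real (Suc n)..real (Suc n) + 1}" for x
  proof -
    obtain N :: nat where "x \<le> N" using real_arch_simple by blast
    then show ?thesis by (intro eventually_sequentiallyI[of N]) auto
  qed
  \<comment> \<open>Towards infinity windows of length 1 suffice, since \<open>F\<close> itself is
    integrable.\<close>
  define b0 where "b0 n = real (Suc n)" for n
  have evb': "\<forall>\<^sub>F n in sequentially. x \<notin> {b0 n..b0 n + 1}" for x
    using evb[of x] by (simp only: b0_def)
  obtain b where b': "\<And>n. b n \<in> {b0 n..b0 n + 1}" and lb: "(\<lambda>n. norm (F (b n)) * (b0 n + 1 - b0 n)) \<longlonglongrightarrow> 0"
    using integrable_small_values_on_escaping_intervals[OF i1 _ evb'] by (metis less_add_one)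
  have b: "b n \<in> {real (Suc n)..real (Suc n) + 1}" for n
    using b'[of n] by (simp only: b0_def)
  have B: "(\<lambda>n. F (b n)) \<longlonglongrightarrow> 0"
    by (rule tendsto_norm_zero_cancel) (use lb in simp)
  have A: "(\<lambda>n. F (a n)) \<longlonglongrightarrow> 0"
  proof (rule Lim_null_comparison[OF always_eventually])
    show "\<forall>n. norm (F (a n)) \<le> 2 * (norm (q (a n)) * (a1 n - a0 n))"
    proof
      fix n
      have "norm (F (a n)) = norm (q (a n)) * a n"
        using apos[of n] by (simp add: F_def q_def norm_mult norm_divide)
      also have "\<dots> \<le> norm (q (a n)) * a1 n"
        using a'[of n] by (intro mult_left_mono) auto
      also have "a1 n = 2 * (a1 n - a0 n)" by (simp add: a0_def a1_def field_simps)
      finally show "norm (F (a n)) \<le> 2 * (norm (q (a n)) * (a1 n - a0 n))" by (simp add: algebra_simps)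
    qed
    show "(\<lambda>n. 2 * (norm (q (a n)) * (a1 n - a0 n))) \<longlonglongrightarrow> 0"
      using tendsto_mult_left[OF la, of 2] by simp
  qed
  have "(LINT x:{0<..}|lborel. f x) = 0 - 0"
  proof (rule set_integral_FTC_seq[OF _ _ _ _ _ _ A B])
    show "{0::real<..} \<in> sets lborel" by simp
    show "set_integrable lborel {0<..} f"
      unfolding set_integrable_def using fint by (intro integrable_mult_indicator) auto
    show "a n \<le> b n" for n
    proof -
      have "1 / real (Suc n) \<le> 1" "1 \<le> real (Suc n)" by simp_all
      then show ?thesis using a[of n] b[of n] by (meson atLeastAtMost_iff order_trans)
    qed
    show "{a n..b n} \<subseteq> {0<..}" for n using apos[of n] by auto
    show "\<forall>\<^sub>F n in sequentially. x \<in> {a n..b n}" if "x \<in> {0<..}" for x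
    proof -
      have "(\<lambda>n. 1 / real (Suc n)) \<longlonglongrightarrow> 0" by (rule LIMSEQ_Suc[OF lim_1_over_n])
      from order_tendstoD(2)[OF this, of x] that
      have "\<forall>\<^sub>F n in sequentially. 1 / real (Suc n) < x" by simp
      moreover obtain N :: nat where "x \<le> N" using real_arch_simple by blast
      then have "\<forall>\<^sub>F n in sequentially. x \<le> real n" by (intro eventually_sequentiallyI[of N]) auto
      ultimately show ?thesis
      proof eventually_elim
        case (elim n)
        moreover have "real n \<le> real (Suc n)" by simp
        ultimately show ?case using a[of n] b[of n]
          by (meson atLeastAtMost_iff order_trans less_imp_le)
      qed
    qed
    show "(F has_vector_derivative f x) (at x)" if "x \<in> {0<..}" for x
    proof -
      have "((\<lambda>x. complex_of_real (w x)) has_vector_derivative complex_of_real (w' x)) (at x)"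
        using der[of x] that bounded_linear.has_vector_derivative[OF bounded_linear_of_real, of w "w' x"]
        by (simp add: has_real_derivative_iff_has_vector_derivative)
      from has_vector_derivative_mult[OF _ this]
      have "((\<lambda>x. exp (- \<theta> * complex_of_real x) * complex_of_real (w x)) has_vector_derivative
          exp (- \<theta> * complex_of_real x) * complex_of_real (w' x) + - \<theta> * exp (- \<theta> * complex_of_real x) * complex_of_real (w x)) (at x)"
        if "((\<lambda>x. exp (- \<theta> * complex_of_real x)) has_vector_derivative - \<theta> * exp (- \<theta> * complex_of_real x)) (at x)"
        using that by blast
      moreover have "((\<lambda>x. exp (- \<theta> * complex_of_real x)) has_vector_derivative - \<theta> * exp (- \<theta> * complex_of_real x)) (at x)"
        by (auto intro!: derivative_eq_intros has_vector_derivative_real_field)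
      ultimately show ?thesis unfolding F_def f_def
        by (simp add: algebra_simps)
    qed
  qed
  also have "(LINT x:{0<..}|lborel. f x) = (LINT x|lborel. f x)"
    unfolding set_lebesgue_integral_def
    by (intro Bochner_Integration.integral_cong) (auto simp: indicator_def f0)
  also have "\<dots> = lap w' \<theta> - \<theta> * lap w \<theta>"
    unfolding f_def lap_def
    by (subst Bochner_Integration.integral_diff[OF lap_integrand_integrable[OF w' \<theta>]])
       (use i1 in \<open>simp_all add: F_def[abs_def]\<close>)
  finally show ?thesis by simp
qed

section \<open>Symbol estimates on a vertical line\<close>

abbreviation halfplane :: "real \<Rightarrow> complex set" where
  "halfplane r \<equiv> {z. r < Re z}"

text \<open>Every derivative lowers the order \<open>b\<close> by \<open>g\<close>, but only along the line \<open>Re z = r + 1\<close>. Powers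
  of the Laplace exponent \<open>\<kappa>\<close> have \<open>g = 1\<close>, while \<open>exp (t * \<kappa>)\<close> only has \<open>g = 1 - \<alpha>\<close>.\<close>

definition symb :: "real \<Rightarrow> real \<Rightarrow> nat \<Rightarrow> real \<Rightarrow> (complex \<Rightarrow> complex) \<Rightarrow> bool" where
  "symb r g k b f \<longleftrightarrow> f holomorphic_on halfplane r \<and>
     (\<forall>i\<le>k. \<exists>C. \<forall>y. cmod ((deriv ^^ i) f (Complex (r + 1) y)) \<le> C * (1 + \<bar>y\<bar>) powr (b - real i * g))"

lemma symb_holomorphic: "symb r g k b f \<Longrightarrow> f holomorphic_on halfplane r"
  by (simp add: symb_def)

lemma symb_bound:
  assumes "symb r g k b f" "i \<le> k"
  obtains C where "C \<ge> 0" "\<And>y. cmod ((deriv ^^ i) f (Complex (r + 1) y)) \<le> C * (1 + \<bar>y\<bar>) powr (b - real i * g)"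
proof -
  from assms obtain C where C: "\<And>y. cmod ((deriv ^^ i) f (Complex (r + 1) y)) \<le> C * (1 + \<bar>y\<bar>) powr (b - real i * g)"
    by (auto simp: symb_def)
  have "0 \<le> C" using order_trans[OF norm_ge_zero C[of 0]] by simp
  then show thesis using C that by blast
qed

lemma symb_bounds:
  assumes "symb r g k b f"
  obtains C :: "nat \<Rightarrow> real" where "\<And>j. C j \<ge> 0"
    "\<And>j y. j \<le> k \<Longrightarrow> cmod ((deriv ^^ j) f (Complex (r + 1) y)) \<le> C j * (1 + \<bar>y\<bar>) powr (b - real j * g)"
proof -
  define P where "P j C \<longleftrightarrow> C \<ge> 0 \<and>
    (j \<le> k \<longrightarrow> (\<forall>y. cmod ((deriv ^^ j) f (Complex (r + 1) y)) \<le> C * (1 + \<bar>y\<bar>) powr (b - real j * g)))" for j C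
  have "\<exists>C. P j C" for j
  proof (cases "j \<le> k")
    case True
    then show ?thesis using symb_bound[OF assms True] unfolding P_def by metis
  next
    case False
    then show ?thesis by (intro exI[of _ 0]) (simp add: P_def)
  qed
  then obtain C where "\<And>j. P j (C j)" by metis
  then show thesis by (intro that[of C]) (simp_all add: P_def)
qed

lemma symb_mono:
  assumes f: "symb r g k b f" and "g' \<le> g" "b \<le> b'" "k' \<le> k"
  shows "symb r g' k' b' f"
  unfolding symb_def
proof (intro conjI allI impI)
  fix i assume i: "i \<le> k'"
  then obtain C where C: "C \<ge> 0" "\<And>y. cmod ((deriv ^^ i) f (Complex (r + 1) y)) \<le> C * (1 + \<bar>y\<bar>) powr (b - real i * g)"
    using symb_bound[OF f, of i] assms by (metis order_trans)
  have "C * (1 + \<bar>y\<bar>) powr (b - real i * g) \<le> C * (1 + \<bar>y\<bar>) powr (b' - real i * g')" for y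
    using assms C by (intro mult_left_mono powr_mono diff_mono) auto
  then show "\<exists>C. \<forall>y. cmod ((deriv ^^ i) f (Complex (r + 1) y)) \<le> C * (1 + \<bar>y\<bar>) powr (b' - real i * g')"
    using C(2) order_trans by blast
qed (use symb_holomorphic[OF f] in auto)

lemma symb_cong:
  assumes f: "symb r g k b f" and fg: "\<And>z. r < Re z \<Longrightarrow> f z = h z"
  shows "symb r g k b h"
proof -
  have hol: "h holomorphic_on halfplane r"
    using symb_holomorphic[OF f] by (rule holomorphic_transform) (use fg in auto)
  have "(deriv ^^ i) h (Complex (r + 1) y) = (deriv ^^ i) f (Complex (r + 1) y)" for i y
    by (rule higher_deriv_transform_within_open[OF hol symb_holomorphic[OF f] open_halfspace_Re_gt])
       (use fg in auto)
  then show ?thesis using f hol by (simp add: symb_def)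
qed

lemma symb_deriv:
  assumes f: "symb r g (Suc k) b f"
  shows "symb r g k (b - g) (deriv f)"
  unfolding symb_def
proof (intro conjI allI impI)
  show "deriv f holomorphic_on halfplane r"
    by (intro holomorphic_deriv symb_holomorphic[OF f] open_halfspace_Re_gt)
  fix i assume i: "i \<le> k"
  then obtain C where "C \<ge> 0" "\<And>y. cmod ((deriv ^^ Suc i) f (Complex (r + 1) y)) \<le> C * (1 + \<bar>y\<bar>) powr (b - real (Suc i) * g)"
    using symb_bound[OF f, of "Suc i"] by (metis Suc_le_mono)
  then show "\<exists>C. \<forall>y. cmod ((deriv ^^ i) (deriv f) (Complex (r + 1) y)) \<le> C * (1 + \<bar>y\<bar>) powr (b - g - real i * g)"
    by (intro exI[of _ C]) (simp add: funpow_Suc_right algebra_simps del: funpow.simps)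
qed

lemma symb_SucI:
  assumes "f holomorphic_on halfplane r"
    and bd: "\<And>y. cmod (f (Complex (r + 1) y)) \<le> C * (1 + \<bar>y\<bar>) powr b"
    and f': "symb r g k (b - g) (deriv f)"
  shows "symb r g (Suc k) b f"
  unfolding symb_def
proof (intro conjI allI impI)
  fix i assume i: "i \<le> Suc k"
  show "\<exists>C. \<forall>y. cmod ((deriv ^^ i) f (Complex (r + 1) y)) \<le> C * (1 + \<bar>y\<bar>) powr (b - real i * g)"
  proof (cases i)
    case (Suc j)
    then obtain C where "C \<ge> 0" "\<And>y. cmod ((deriv ^^ j) (deriv f) (Complex (r + 1) y)) \<le> C * (1 + \<bar>y\<bar>) powr (b - g - real j * g)"
      using symb_bound[OF f', of j] i by (metis Suc_le_mono)
    then show ?thesis unfolding Suc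
      by (intro exI[of _ C]) (simp add: funpow_Suc_right algebra_simps del: funpow.simps)
  qed (use bd in auto)
qed fact

lemma symb_0I:
  assumes "f holomorphic_on halfplane r"
    and "\<And>y. cmod (f (Complex (r + 1) y)) \<le> C * (1 + \<bar>y\<bar>) powr b"
  shows "symb r g 0 b f"
  using assms by (auto simp: symb_def)

text \<open>In every term of the Leibniz formula the orders \<open>b1 - j * g\<close> and
  \<open>b2 - (i - j) * g\<close> add up to \<open>b1 + b2 - i * g\<close>.\<close>

lemma symb_mult:
  assumes f: "symb r g k b1 f" and h: "symb r g k b2 h"
  shows "symb r g k (b1 + b2) (\<lambda>z. f z * h z)"
  unfolding symb_def
proof (intro conjI allI impI)
  note hol = symb_holomorphic[OF f] symb_holomorphic[OF h]
  show "(\<lambda>z. f z * h z) holomorphic_on halfplane r" by (intro holomorphic_on_mult hol)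
  fix i assume i: "i \<le> k"
  obtain C where C: "\<And>j. C j \<ge> 0"
     "\<And>j y. j \<le> k \<Longrightarrow> cmod ((deriv ^^ j) f (Complex (r + 1) y)) \<le> C j * (1 + \<bar>y\<bar>) powr (b1 - real j * g)"
    using symb_bounds[OF f] by metis
  obtain D where D: "\<And>j. D j \<ge> 0"
     "\<And>j y. j \<le> k \<Longrightarrow> cmod ((deriv ^^ j) h (Complex (r + 1) y)) \<le> D j * (1 + \<bar>y\<bar>) powr (b2 - real j * g)"
    using symb_bounds[OF h] by metis
  define A where "A = (\<Sum>j = 0..i. real (i choose j) * (C j * D (i - j)))"
  show "\<exists>C. \<forall>y. cmod ((deriv ^^ i) (\<lambda>z. f z * h z) (Complex (r + 1) y)) \<le> C * (1 + \<bar>y\<bar>) powr (b1 + b2 - real i * g)"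
  proof (intro exI[of _ A] allI)
    fix y
    define z where "z = Complex (r + 1) y"
    have "cmod ((deriv ^^ i) (\<lambda>z. f z * h z) z)
        = cmod (\<Sum>j = 0..i. of_nat (i choose j) * (deriv ^^ j) f z * (deriv ^^ (i - j)) h z)"
      by (subst higher_deriv_mult[OF hol open_halfspace_Re_gt]) (auto simp: z_def)
    also have "\<dots> \<le> (\<Sum>j = 0..i. real (i choose j) * (cmod ((deriv ^^ j) f z) * cmod ((deriv ^^ (i - j)) h z)))"
      by (rule order_trans[OF norm_sum]) (simp add: norm_mult mult.assoc)
    also have "\<dots> \<le> (\<Sum>j = 0..i. real (i choose j) * ((C j * (1 + \<bar>y\<bar>) powr (b1 - real j * g)) *
          (D (i - j) * (1 + \<bar>y\<bar>) powr (b2 - real (i - j) * g))))"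
      unfolding z_def using C D i
      by (intro sum_mono mult_left_mono mult_mono) (auto simp del: of_nat_diff)
    also have "\<dots> = (\<Sum>j = 0..i. real (i choose j) * (C j * D (i - j)) * (1 + \<bar>y\<bar>) powr (b1 + b2 - real i * g))"
    proof (rule sum.cong[OF refl])
      fix j assume "j \<in> {0..i}"
      then have "(b1 - real j * g) + (b2 - real (i - j) * g) = b1 + b2 - real i * g"
        by (simp add: of_nat_diff algebra_simps)
      then have "(1 + \<bar>y\<bar>) powr (b1 + b2 - real i * g) = (1 + \<bar>y\<bar>) powr (b1 - real j * g) * (1 + \<bar>y\<bar>) powr (b2 - real (i - j) * g)"
        by (simp only: powr_add[symmetric])
      then show "real (i choose j) * ((C j * (1 + \<bar>y\<bar>) powr (b1 - real j * g)) *
          (D (i - j) * (1 + \<bar>y\<bar>) powr (b2 - real (i - j) * g))) = real (i choose j) * (C j * D (i - j)) * (1 + \<bar>y\<bar>) powr (b1 + b2 - real i * g)"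
        by (simp only: mult_ac)
    qed
    also have "\<dots> = A * (1 + \<bar>y\<bar>) powr (b1 + b2 - real i * g)"
      unfolding A_def by (rule sum_distrib_right[symmetric])
    finally show "cmod ((deriv ^^ i) (\<lambda>z. f z * h z) (Complex (r + 1) y)) \<le> A * (1 + \<bar>y\<bar>) powr (b1 + b2 - real i * g)"
      by (simp add: z_def)
  qed
qed

lemma symb_const: "symb r g k 0 (\<lambda>_. a)"
proof -
  have "(deriv ^^ i) (\<lambda>_::complex. a) = (\<lambda>_. if i = 0 then a else 0)" for i
    by (induction i) (auto simp: fun_eq_iff)
  then have "cmod ((deriv ^^ i) (\<lambda>_. a) (Complex (r + 1) y)) \<le> (if i = 0 then cmod a else 0) * (1 + \<bar>y\<bar>) powr (0 - real i * g)" for i y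
    by auto
  then show ?thesis unfolding symb_def by (intro conjI allI impI holomorphic_on_const) blast
qed

lemma symb_cmult: "symb r g k b f \<Longrightarrow> symb r g k b (\<lambda>z. a * f z)"
  using symb_mult[OF symb_const, of r g k b f a] by simp

lemma symb_power:
  assumes "symb r g k b f"
  shows "symb r g k (real n * b) (\<lambda>z. f z ^ n)"
proof (induction n)
  case (Suc n)
  show ?case using symb_mult[OF assms Suc] by (simp add: algebra_simps)
qed (use symb_const[of r g k 1] in simp)

lemma symb_ident:
  assumes "r \<ge> 0"
  shows "symb r 1 k 1 (\<lambda>z. z)"
proof -
  have bd: "cmod (Complex (r + 1) y) \<le> (r + 1) * (1 + \<bar>y\<bar>) powr 1" for y
  proof -
    have "cmod (Complex (r + 1) y) \<le> (r + 1) + \<bar>y\<bar>"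
      using cmod_le[of "Complex (r + 1) y"] assms by simp
    also have "\<dots> \<le> (r + 1) * (1 + \<bar>y\<bar>)"
      using assms by (simp add: distrib_left distrib_right)
    finally show ?thesis by simp
  qed
  show ?thesis
  proof (cases k)
    case 0
    show ?thesis unfolding 0 by (rule symb_0I[OF holomorphic_on_ident bd])
  next
    case (Suc j)
    show ?thesis unfolding Suc
      by (rule symb_SucI[OF holomorphic_on_ident bd]) (use symb_const[of r 1 j 1] in simp)
  qed
qed

text \<open>Induction on the number of derivatives: \<open>- 1 * (inverse z * inverse z)\<close> has
  order -2 by \<open>symb_mult\<close> and the induction hypothesis. The pole lies outside the
  half-plane because \<open>r \<ge> 0\<close>.\<close>

lemma symb_inverse:
  assumes "r \<ge> 0"
  shows "symb r 1 k (-1) (\<lambda>z. inverse z)"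
proof (induction k)
  have hol: "(\<lambda>z. inverse z) holomorphic_on halfplane r"
    by (intro holomorphic_intros) (use assms in auto)
  have bd: "cmod (inverse (Complex (r + 1) y)) \<le> 2 * (1 + \<bar>y\<bar>) powr (-1)" for y
  proof -
    have "1 + \<bar>y\<bar> \<le> 2 * cmod (Complex (r + 1) y)"
      using abs_Re_le_cmod[of "Complex (r + 1) y"] abs_Im_le_cmod[of "Complex (r + 1) y"] assms by simp
    moreover have "cmod (Complex (r + 1) y) > 0" using assms by (simp add: complex_eq_iff)
    ultimately have "inverse (cmod (Complex (r + 1) y)) \<le> 2 * inverse (1 + \<bar>y\<bar>)"
      by (simp add: field_simps add_pos_nonneg del: complex_norm)
    then show ?thesis by (simp add: norm_inverse powr_minus)
  qed
  { case 0 show ?case by (rule symb_0I[OF hol bd]) }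
  { case (Suc k)
    have s: "symb r 1 k (-1 - 1) (\<lambda>z. - 1 * (inverse z * inverse z))"
      using symb_cmult[OF symb_mult[OF Suc Suc], of "-1"] by simp
    have "symb r 1 k (-1 - 1) (deriv (\<lambda>z. inverse z))"
    proof (rule symb_cong[OF s])
      fix z assume "r < Re z"
      then have "z \<noteq> 0" using assms by auto
      then have "(inverse has_field_derivative - 1 * (inverse z * inverse z)) (at z)"
        using DERIV_inverse[of z UNIV] by (simp add: power2_eq_square)
      then show "- 1 * (inverse z * inverse z) = deriv (\<lambda>z. inverse z) z"
        by (rule DERIV_imp_deriv[symmetric])
    qed
    then show ?case by (rule symb_SucI[OF hol bd]) }
qed

text \<open>The constant has to be independent of \<open>t\<close>, hence no formulation with
  \<open>symb\<close>. One differentiation replaces \<open>f\<close> by \<open>deriv f\<close> plus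
  \<open>t\<close> times \<open>deriv K * f\<close>, both of order \<open>b - g\<close>; the
  induction therefore generalises over \<open>f\<close> and \<open>b\<close>. The exponential stays
  bounded by 1 and each factor \<open>t\<close> by \<open>T\<close>.\<close>

lemma symb_exp_bound:
  assumes K: "symb r g k (- g) (deriv K)" and Khol: "K holomorphic_on halfplane r"
    and re: "\<And>t y. 0 \<le> t \<Longrightarrow> cmod (exp (complex_of_real t * K (Complex (r + 1) y))) \<le> 1"
    and f: "symb r g k b f"
  shows "\<exists>C. \<forall>t\<in>{0..T}. \<forall>y. cmod ((deriv ^^ k) (\<lambda>z. f z * exp (complex_of_real t * K z)) (Complex (r + 1) y))
            \<le> C * (1 + \<bar>y\<bar>) powr (b - real k * g)"
  using K f
proof (induction k arbitrary: b f)
  case 0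
  obtain C where C: "C \<ge> 0" "\<And>y. cmod (f (Complex (r + 1) y)) \<le> C * (1 + \<bar>y\<bar>) powr b"
    using symb_bound[OF 0(2), of 0] by auto
  have "cmod (f (Complex (r + 1) y) * exp (complex_of_real t * K (Complex (r + 1) y))) \<le> C * (1 + \<bar>y\<bar>) powr b"
    if "t \<in> {0..T}" for t y
  proof -
    have "cmod (f (Complex (r + 1) y) * exp (complex_of_real t * K (Complex (r + 1) y))) \<le> C * (1 + \<bar>y\<bar>) powr b * 1"
      unfolding norm_mult using that C by (intro mult_mono re) auto
    then show ?thesis by simp
  qed
  then show ?case by (intro exI[of _ C]) auto
next
  case (Suc k)
  note fhol = symb_holomorphic[OF Suc.prems(2)]
  have K: "symb r g k (- g) (deriv K)" by (rule symb_mono[OF Suc.prems(1)]) auto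
  note K'hol = symb_holomorphic[OF K]
  have s1: "symb r g k (b - g) (deriv f)" by (rule symb_deriv[OF Suc.prems(2)])
  have "symb r g k b f" by (rule symb_mono[OF Suc.prems(2)]) auto
  then have s2: "symb r g k (b - g) (\<lambda>z. deriv K z * f z)"
    using symb_mult[OF K] by fastforce
  note f'hol = symb_holomorphic[OF s1]
  obtain C1 where C1: "\<And>t y. t \<in> {0..T} \<Longrightarrow> cmod ((deriv ^^ k) (\<lambda>z. deriv f z * exp (complex_of_real t * K z)) (Complex (r + 1) y))
            \<le> C1 * (1 + \<bar>y\<bar>) powr (b - g - real k * g)"
    using Suc.IH[OF K s1] by blast
  obtain C2 where C2: "\<And>t y. t \<in> {0..T} \<Longrightarrow> cmod ((deriv ^^ k) (\<lambda>z. deriv K z * f z * exp (complex_of_real t * K z)) (Complex (r + 1) y))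
            \<le> C2 * (1 + \<bar>y\<bar>) powr (b - g - real k * g)"
    using Suc.IH[OF K s2] by blast
  show ?case
  proof (intro exI[of _ "C1 + T * C2"] ballI allI)
    fix t y assume t: "t \<in> {0..T}"
    define z where "z = Complex (r + 1) y"
    have zH: "z \<in> halfplane r" by (simp add: z_def)
    have ehol: "(\<lambda>z. exp (complex_of_real t * K z)) holomorphic_on halfplane r"
      by (intro holomorphic_intros Khol)
    have "(deriv ^^ Suc k) (\<lambda>z. f z * exp (complex_of_real t * K z)) z
       = (deriv ^^ k) (deriv (\<lambda>z. f z * exp (complex_of_real t * K z))) z"
      by (simp add: funpow_Suc_right del: funpow.simps)
    also have "\<dots> = (deriv ^^ k) (\<lambda>z. deriv f z * exp (complex_of_real t * K z) +
        complex_of_real t * (deriv K z * f z * exp (complex_of_real t * K z))) z"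
    proof (rule higher_deriv_transform_within_open[OF _ _ open_halfspace_Re_gt zH])
      fix w assume w: "w \<in> halfplane r"
      have "(f has_field_derivative deriv f w) (at w)" "(K has_field_derivative deriv K w) (at w)"
        using holomorphic_derivI[OF fhol open_halfspace_Re_gt w] holomorphic_derivI[OF Khol open_halfspace_Re_gt w] by auto
      then show "deriv (\<lambda>z. f z * exp (complex_of_real t * K z)) w = deriv f w * exp (complex_of_real t * K w) +
        complex_of_real t * (deriv K w * f w * exp (complex_of_real t * K w))"
        by (intro DERIV_imp_deriv) (auto intro!: derivative_eq_intros)
    qed (intro holomorphic_deriv holomorphic_on_mult holomorphic_on_add holomorphic_on_const ehol fhol f'hol K'hol open_halfspace_Re_gt)+
    also have "\<dots> = (deriv ^^ k) (\<lambda>z. deriv f z * exp (complex_of_real t * K z)) z +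
        (deriv ^^ k) (\<lambda>z. complex_of_real t * (deriv K z * f z * exp (complex_of_real t * K z))) z"
      by (rule higher_deriv_add[OF _ _ open_halfspace_Re_gt zH])
         (intro holomorphic_on_mult holomorphic_on_const ehol fhol f'hol K'hol)+
    also have "(deriv ^^ k) (\<lambda>z. complex_of_real t * (deriv K z * f z * exp (complex_of_real t * K z))) z
        = complex_of_real t * (deriv ^^ k) (\<lambda>z. deriv K z * f z * exp (complex_of_real t * K z)) z"
      by (rule higher_deriv_cmult[OF _ zH open_halfspace_Re_gt])
         (intro holomorphic_on_mult ehol fhol K'hol)+
    finally have "cmod ((deriv ^^ Suc k) (\<lambda>z. f z * exp (complex_of_real t * K z)) z)
        \<le> cmod ((deriv ^^ k) (\<lambda>z. deriv f z * exp (complex_of_real t * K z)) z) +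
          t * cmod ((deriv ^^ k) (\<lambda>z. deriv K z * f z * exp (complex_of_real t * K z)) z)"
      using t by (metis (no_types, lifting) abs_of_nonneg atLeastAtMost_iff norm_mult norm_of_real norm_triangle_ineq)
    also have "\<dots> \<le> C1 * (1 + \<bar>y\<bar>) powr (b - g - real k * g) + T * (C2 * (1 + \<bar>y\<bar>) powr (b - g - real k * g))"
      unfolding z_def using t by (intro add_mono mult_mono C1 C2) auto
    finally show "cmod ((deriv ^^ Suc k) (\<lambda>z. f z * exp (complex_of_real t * K z)) (Complex (r + 1) y))
       \<le> (C1 + T * C2) * (1 + \<bar>y\<bar>) powr (b - real (Suc k) * g)"
      by (simp add: z_def algebra_simps)
  qed
qed

text \<open>The difference quotients in \<open>t\<close> converge uniformly for \<open>z\<close>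
  near \<theta>. For holomorphic functions uniform convergence passes to derivatives of any order,
  so differentiation in \<open>t\<close> and in \<open>z\<close> commute.\<close>

lemma has_vector_derivative_higher_deriv_exp:
  fixes K F :: "complex \<Rightarrow> complex"
  assumes K: "K holomorphic_on S" and F: "F holomorphic_on S" and S: "open S" "\<theta> \<in> S"
  shows "((\<lambda>t. (deriv ^^ m) (\<lambda>z. F z * exp (complex_of_real t * K z)) \<theta>) has_vector_derivative
           (deriv ^^ m) (\<lambda>z. F z * K z * exp (complex_of_real t * K z)) \<theta>) (at t)"
proof -
  obtain e where e: "e > 0" "cball \<theta> e \<subseteq> S" using S by (meson open_contains_cball)
  define A where "A = ball \<theta> e"
  have A: "open A" "\<theta> \<in> A" "A \<subseteq> S" using e by (auto simp: A_def)
  define G where "G z = F z * exp (complex_of_real t * K z)" for z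
  have KA: "K holomorphic_on A" and FA: "F holomorphic_on A"
    using K F A(3) holomorphic_on_subset by blast+
  have GA: "G holomorphic_on A" unfolding G_def by (intro holomorphic_intros KA FA)
  have comp: "compact (cball \<theta> e)" by simp
  have "continuous_on (cball \<theta> e) K"
    using K e(2) holomorphic_on_imp_continuous_on holomorphic_on_subset by blast
  then obtain B where B: "\<And>z. z \<in> A \<Longrightarrow> cmod (K z) \<le> B"
    using compact_imp_bounded[OF compact_continuous_image[OF _ comp], of K]
    unfolding bounded_iff A_def by (meson ball_subset_cball image_eqI subsetD)
  have "continuous_on (cball \<theta> e) G"
    unfolding G_def using K F e(2)
    by (intro continuous_intros holomorphic_on_imp_continuous_on) (auto intro: holomorphic_on_subset)
  then obtain D where D: "\<And>z. z \<in> A \<Longrightarrow> cmod (G z) \<le> D"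
    using compact_imp_bounded[OF compact_continuous_image[OF _ comp], of G]
    unfolding bounded_iff A_def by (meson ball_subset_cball image_eqI subsetD)
  have BD: "B \<ge> 0" "D \<ge> 0" using order_trans[OF norm_ge_zero B[OF A(2)]] order_trans[OF norm_ge_zero D[OF A(2)]] by auto
  define q where "q h z = G z * ((exp (complex_of_real h * K z) - 1) / complex_of_real h)" for h :: real and z
  \<comment> \<open>Taylor remainder of \<open>exp\<close> after the linear term at
    \<open>w = h * K z\<close>; the bounds \<open>B\<close> for \<open>K\<close> and
    \<open>D\<close> for \<open>G\<close> on the ball make it uniform in \<open>z\<close>.\<close>
  have q_bd: "dist (q h z) (G z * K z) \<le> D * (exp B * B ^ 2) * \<bar>h\<bar>" if "z \<in> A" "h \<noteq> 0" "\<bar>h\<bar> < 1" for h z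
  proof -
    define w where "w = complex_of_real h * K z"
    have w: "cmod w = \<bar>h\<bar> * cmod (K z)" by (simp add: w_def norm_mult)
    have wB: "cmod w \<le> \<bar>h\<bar> * B" using B[OF that(1)] by (auto simp: w intro: mult_left_mono)
    have "\<bar>h\<bar> * B \<le> 1 * B" using that BD by (intro mult_right_mono) auto
    then have wB': "\<bar>Re w\<bar> \<le> B" using wB abs_Re_le_cmod[of w] by linarith
    have "cmod (exp w - 1 - w) \<le> exp \<bar>Re w\<bar> * cmod w ^ 2"
      using Taylor_exp[of w 1] by (simp add: numeral_2_eq_2 diff_diff_eq)
    also have "\<dots> \<le> exp B * (\<bar>h\<bar> * B) ^ 2"
      using wB wB' by (intro mult_mono power_mono) auto
    finally have 1: "cmod (exp w - 1 - w) \<le> exp B * (\<bar>h\<bar> * B) ^ 2" .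
    have "q h z - G z * K z = G z * ((exp w - 1 - w) / complex_of_real h)"
      using that by (simp add: q_def w_def field_simps)
    then have "dist (q h z) (G z * K z) = cmod (G z) * (cmod (exp w - 1 - w) / \<bar>h\<bar>)"
      by (simp add: dist_norm norm_mult norm_divide)
    also have "\<dots> \<le> D * (exp B * (\<bar>h\<bar> * B) ^ 2 / \<bar>h\<bar>)"
      using D[OF that(1)] 1 BD by (intro mult_mono divide_right_mono) auto
    also have "\<dots> = D * (exp B * B ^ 2) * \<bar>h\<bar>" using that by (simp add: power2_eq_square)
    finally show ?thesis .
  qed
  have ul: "uniform_limit A q (\<lambda>z. G z * K z) (at 0)"
    unfolding uniform_limit_iff
  proof (intro allI impI)
    fix \<epsilon> :: real assume eps: "\<epsilon> > 0"
    have "((\<lambda>h::real. D * (exp B * B ^ 2) * \<bar>h\<bar>) \<longlongrightarrow> D * (exp B * B ^ 2) * \<bar>0\<bar>) (at 0)"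
      by (intro tendsto_intros)
    then have "\<forall>\<^sub>F h in at (0::real). D * (exp B * B ^ 2) * \<bar>h\<bar> < \<epsilon>"
      by (rule order_tendstoD) (use eps in simp)
    moreover have "\<forall>\<^sub>F h in at (0::real). \<bar>h\<bar> < 1" by (auto simp: eventually_at dist_norm intro!: exI[of _ 1])
    moreover have "\<forall>\<^sub>F h in at (0::real). h \<noteq> 0" by (simp add: eventually_at_filter)
    ultimately show "\<forall>\<^sub>F h in at 0. \<forall>z\<in>A. dist (q h z) (G z * K z) < \<epsilon>"
      by eventually_elim (use q_bd order_le_less_trans in blast)
  qed
  have qhol: "q h holomorphic_on A" if "h \<noteq> 0" for h
    unfolding q_def using that by (intro holomorphic_intros GA KA) auto
  have lim: "((\<lambda>h. (deriv ^^ m) (q h) \<theta>) \<longlongrightarrow> (deriv ^^ m) (\<lambda>z. G z * K z) \<theta>) (at 0)"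
    by (rule higher_deriv_complex_uniform_limit[OF ul _ _ A(1,2)])
       (auto simp: eventually_at_filter qhol)
  define P where "P s = (deriv ^^ m) (\<lambda>z. F z * exp (complex_of_real s * K z)) \<theta>" for s
  have P: "P (t + h) - P t = complex_of_real h * (deriv ^^ m) (q h) \<theta>" if h: "h \<noteq> 0" for h
  proof -
    have "P (t + h) - P t = (deriv ^^ m) (\<lambda>z. F z * exp (complex_of_real (t + h) * K z) - F z * exp (complex_of_real t * K z)) \<theta>"
      unfolding P_def
      by (rule higher_deriv_diff[symmetric, OF _ _ A(1,2)]) (intro holomorphic_intros KA FA)+
    also have "(\<lambda>z. F z * exp (complex_of_real (t + h) * K z) - F z * exp (complex_of_real t * K z)) = (\<lambda>z. complex_of_real h * q h z)"
    proof
      fix z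
      have "complex_of_real h * q h z = G z * (exp (complex_of_real h * K z) - 1)"
        using h by (simp add: q_def)
      then show "F z * exp (complex_of_real (t + h) * K z) - F z * exp (complex_of_real t * K z) = complex_of_real h * q h z"
        by (simp add: G_def ring_distribs exp_add)
    qed
    also have "(deriv ^^ m) (\<lambda>z. complex_of_real h * q h z) \<theta> = complex_of_real h * (deriv ^^ m) (q h) \<theta>"
      by (rule higher_deriv_cmult[OF qhol[OF h] A(2,1)])
    finally show ?thesis .
  qed
  define L where "L = (deriv ^^ m) (\<lambda>z. G z * K z) \<theta>"
  have "(P has_vector_derivative L) (at t)"
    unfolding has_vector_derivative_def has_derivative_at
  proof
    show "bounded_linear (\<lambda>x. x *\<^sub>R L)" by (rule bounded_linear_scaleR_left)
    have "((\<lambda>h. norm ((deriv ^^ m) (q h) \<theta> - L)) \<longlongrightarrow> 0) (at 0)"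
      using lim by (intro tendsto_norm_zero) (simp add: L_def LIM_zero)
    then show "(\<lambda>h. norm (P (t + h) - P t - h *\<^sub>R L) / norm h) \<midarrow>0\<rightarrow> 0"
    proof (rule Lim_transform_eventually)
      show "\<forall>\<^sub>F h in at 0. norm ((deriv ^^ m) (q h) \<theta> - L) = norm (P (t + h) - P t - h *\<^sub>R L) / norm h"
        unfolding eventually_at_filter
      proof (intro always_eventually allI impI)
        fix h :: real assume h: "h \<noteq> 0"
        have "P (t + h) - P t - h *\<^sub>R L = complex_of_real h * ((deriv ^^ m) (q h) \<theta> - L)"
          unfolding P[OF h] by (simp add: scaleR_conv_of_real right_diff_distrib)
        then show "norm ((deriv ^^ m) (q h) \<theta> - L) = norm (P (t + h) - P t - h *\<^sub>R L) / norm h"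
          using h by (simp add: norm_mult)
      qed
    qed
  qed
  moreover have "(\<lambda>z. G z * K z) = (\<lambda>z. F z * K z * exp (complex_of_real t * K z))"
    by (simp add: G_def mult_ac)
  ultimately show ?thesis unfolding L_def P_def[abs_def] by simp
qed

section \<open>The Laplace exponent\<close>

locale regular_levy_density =
  fixes m :: nat and \<alpha> r :: real and u :: "real \<Rightarrow> real"
  assumes \<alpha>: "0 < \<alpha>" "\<alpha> < 1" and r: "0 \<le> r"
    and levy: "infinite_activity_levy_density u"
    and diff: "times_differentiable_on {0<..} m u"
    and v_int: "\<And>l. l \<le> m \<Longrightarrow> integrable lborel (v_fun r u l)"
    and v_mod: "\<And>l. l \<le> m \<Longrightarrow>
      (\<lambda>\<delta>. integral_modulus \<delta> (v_fun r u l)) \<in> O[at_right 0](\<lambda>\<delta>. \<delta> powr (1 - \<alpha>))"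
begin

section \<open>Transforms of weighted derivatives of the density\<close>

text \<open>Power and derivative order carry separate indices because integration by parts changes
  one at a time. On the diagonal, \<open>W j j\<close> is \<open>v_fun r u j\<close> up to sign and
  the factor \<open>exp (r * x)\<close>.\<close>

definition W :: "nat \<Rightarrow> nat \<Rightarrow> real \<Rightarrow> real" where
  "W l j x = (if x > 0 then x ^ Suc l * nth_deriv_on {0<..} j u x else 0)"

lemma has_real_derivative_nth_deriv:
  assumes "j < m" "x > 0"
  shows "(nth_deriv_on {0<..} j u has_real_derivative nth_deriv_on {0<..} (Suc j) u x) (at x)"
proof -
  have "nth_deriv_on {0<..} j u differentiable (at x within {0<..})"
    using diff assms by (auto simp: times_differentiable_on_def differentiable_on_def)
  then have "(nth_deriv_on {0<..} j u has_vector_derivative nth_deriv_on {0<..} (Suc j) u x) (at x within {0<..})"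
    by (simp add: vector_derivative_works)
  moreover have "at x within {0<..} = at x" using assms by (intro at_within_open) auto
  ultimately show ?thesis by (simp add: has_real_derivative_iff_has_vector_derivative)
qed

lemma W_diag: "W j j x = (-1) ^ j * (exp (r * x) * v_fun r u j x)"
  by (simp add: W_def v_fun_def exp_minus field_simps flip: power_mult_distrib)

lemma lap_ok_W_diag:
  assumes "j \<le> m"
  shows "lap_ok r (W j j)"
  unfolding lap_ok_def
proof (intro conjI allI impI)
  note v = v_int[OF assms]
  have [measurable]: "v_fun r u j \<in> borel_measurable borel" using v by auto
  have W: "W j j = (\<lambda>x. (-1) ^ j * (exp (r * x) * v_fun r u j x))" by (rule ext) (rule W_diag)
  show meas: "W j j \<in> borel_measurable borel" unfolding W by measurable
  fix s assume s: "s > r"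
  show "integrable lborel (\<lambda>x. exp (- s * x) * W j j x)"
  proof (rule Bochner_Integration.integrable_bound[OF v])
    show "AE x in lborel. norm (exp (- s * x) * W j j x) \<le> norm (v_fun r u j x)"
    proof (rule AE_I2)
      fix x
      show "norm (exp (- s * x) * W j j x) \<le> norm (v_fun r u j x)"
      proof (cases "x > 0")
        case True
        have "norm (exp (- s * x) * W j j x) = exp (- ((s - r) * x)) * \<bar>v_fun r u j x\<bar>"
          by (simp add: W_diag abs_mult algebra_simps flip: exp_add)
        also have "\<dots> \<le> 1 * \<bar>v_fun r u j x\<bar>" using True s by (intro mult_right_mono) auto
        finally show ?thesis by simp
      qed (simp add: W_def)
    qed
  qed (use meas in measurable)
qed (auto simp: W_def)

lemma lap_ok_W:
  assumes "j \<le> m" "j \<le> l"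
  shows "lap_ok r (W l j)"
proof -
  have "W l j = (\<lambda>x. x ^ (l - j) * W j j x)"
  proof
    fix x :: real
    have "x ^ Suc l = x ^ (l - j) * x ^ Suc j" using assms by (simp only: power_add[symmetric]) simp
    then show "W l j x = x ^ (l - j) * W j j x" by (auto simp: W_def)
  qed
  then show ?thesis using lap_ok_power_times[OF lap_ok_W_diag[OF assms(1)], of "l - j"] by simp
qed

text \<open>At abscissa \<open>r + 1\<close> the factor \<open>exp (r * x)\<close> is absorbed. What
  remains is the transform of \<open>v_fun r u j\<close> at \<open>Complex 1 y\<close>, to which
  \<open>laplace_decay_of_modulus\<close> applies with exponent \<open>1 - \<alpha>\<close>.\<close>

lemma lap_W_diag_decay:
  assumes "j \<le> m"
  shows "\<exists>C. \<forall>y. cmod (lap (W j j) (Complex (r + 1) y)) \<le> C * (1 + \<bar>y\<bar>) powr (\<alpha> - 1)"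
proof -
  have "v_fun r u j x = 0" if "x \<le> 0" for x using that by (simp add: v_fun_def)
  from laplace_decay_of_modulus[OF v_int[OF assms] this _ v_mod[OF assms]] \<alpha>
  obtain C where C: "\<And>y. cmod (LINT x|lborel. exp (- Complex 1 y * complex_of_real x) * complex_of_real (v_fun r u j x))
            \<le> C * (1 + \<bar>y\<bar>) powr (\<alpha> - 1)" by auto
  have "lap (W j j) (Complex (r + 1) y) =
      (LINT x|lborel. (-1) ^ j * (exp (- Complex 1 y * complex_of_real x) * complex_of_real (v_fun r u j x)))" for y
    unfolding lap_def
  proof (rule Bochner_Integration.integral_cong[OF refl])
    fix x
    have "exp (- Complex (r + 1) y * complex_of_real x) * exp (complex_of_real (r * x)) = exp (- Complex 1 y * complex_of_real x)"
      unfolding exp_add[symmetric] by (rule arg_cong[where f = exp]) (simp add: complex_eq_iff algebra_simps)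
    then show "exp (- Complex (r + 1) y * complex_of_real x) * complex_of_real (W j j x)
      = (-1) ^ j * (exp (- Complex 1 y * complex_of_real x) * complex_of_real (v_fun r u j x))"
      by (simp add: W_diag exp_of_real[symmetric])
  qed
  then have "cmod (lap (W j j) (Complex (r + 1) y))
      = cmod (LINT x|lborel. exp (- Complex 1 y * complex_of_real x) * complex_of_real (v_fun r u j x))" for y
    by (simp only: integral_mult_right_zero norm_mult norm_power) simp
  then show ?thesis using C by auto
qed

text \<open>Dividing \<open>W (Suc l) j\<close> by x gives \<open>W l j\<close>, so
  \<open>j \<le> l\<close> secures the condition at 0 in \<open>lap_by_parts\<close>. The two terms
  on the right come from the product rule.\<close>

lemma W_by_parts:
  assumes j: "j < m" "j \<le> l" and \<theta>: "Re \<theta> > r"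
  shows "\<theta> * lap (W (Suc l) j) \<theta> = of_nat (Suc (Suc l)) * lap (W l j) \<theta> + lap (W (Suc l) (Suc j)) \<theta>"
proof -
  have ok: "lap_ok r (W (Suc l) j)" "lap_ok r (W l j)" "lap_ok r (W (Suc l) (Suc j))"
    using j by (auto intro: lap_ok_W)
  define w' where "w' x = real (Suc (Suc l)) * W l j x + W (Suc l) (Suc j) x" for x
  have ok': "lap_ok r w'"
    using ok(2,3) unfolding lap_ok_def w'_def
    by (auto simp: distrib_left mult.left_commute[of "exp _"])
  have "\<theta> * lap (W (Suc l) j) \<theta> = lap w' \<theta>"
  proof (rule lap_by_parts[OF ok(1) ok' _ _ \<theta>])
    have "(\<lambda>x. W (Suc l) j x / x) = W l j" by (auto simp: W_def fun_eq_iff)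
    then show "lap_ok r (\<lambda>x. W (Suc l) j x / x)" using ok(2) by simp
    fix x :: real assume x: "x > 0"
    have "((\<lambda>x. x ^ Suc (Suc l) * nth_deriv_on {0<..} j u x) has_real_derivative w' x) (at x)"
      using DERIV_mult[OF DERIV_pow[of "Suc (Suc l)" x] has_real_derivative_nth_deriv[OF j(1) x]] x
      by (simp add: w'_def W_def mult.commute mult.left_commute del: nth_deriv_on.simps)
    then show "(W (Suc l) j has_real_derivative w' x) (at x)"
      by (rule has_field_derivative_transform_within_open[where S = "{0<..}"]) (use x in \<open>auto simp: W_def\<close>)
  qed
  also have "lap w' \<theta> = (LINT x|lborel. of_nat (Suc (Suc l)) * (exp (- \<theta> * complex_of_real x) * complex_of_real (W l j x))
      + exp (- \<theta> * complex_of_real x) * complex_of_real (W (Suc l) (Suc j) x))"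
    unfolding lap_def w'_def by (intro Bochner_Integration.integral_cong) (auto simp: algebra_simps)
  also have "\<dots> = of_nat (Suc (Suc l)) * lap (W l j) \<theta> + lap (W (Suc l) (Suc j)) \<theta>"
    unfolding lap_def integral_mult_right_zero[symmetric]
    by (intro Bochner_Integration.integral_add integrable_mult_right
          lap_integrand_integrable[OF ok(2) \<theta>] lap_integrand_integrable[OF ok(3) \<theta>])
  finally show ?thesis .
qed

lemma one_plus_abs_le_norm: "1 + \<bar>y\<bar> \<le> 2 * cmod (Complex (r + 1) y)"
  using abs_Re_le_cmod[of "Complex (r + 1) y"] abs_Im_le_cmod[of "Complex (r + 1) y"] r by simp

text \<open>Induction on the distance \<open>d\<close> from the diagonal: both transforms on the
  right of \<open>W_by_parts\<close> are one step closer to it, and dividing by \<theta> gains one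
  order of decay.\<close>

lemma lap_W_decay:
  assumes "j + d \<le> m"
  shows "\<exists>C. \<forall>y. cmod (lap (W (j + d) j) (Complex (r + 1) y)) \<le> C * (1 + \<bar>y\<bar>) powr (\<alpha> - 1 - real d)"
  using assms
proof (induction d arbitrary: j)
  case 0
  then show ?case using lap_W_diag_decay[of j] by simp
next
  case (Suc d)
  obtain C1 where C1: "\<And>y. cmod (lap (W (j + d) j) (Complex (r + 1) y)) \<le> C1 * (1 + \<bar>y\<bar>) powr (\<alpha> - 1 - real d)"
    using Suc.IH[of j] Suc.prems by auto
  obtain C2 where C2: "\<And>y. cmod (lap (W (Suc (j + d)) (Suc j)) (Complex (r + 1) y)) \<le> C2 * (1 + \<bar>y\<bar>) powr (\<alpha> - 1 - real d)"
    using Suc.IH[of "Suc j"] Suc.prems by auto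
  define C where "C = 2 * (real (Suc (Suc (j + d))) * C1 + C2)"
  show ?case
  proof (intro exI[of _ C] allI)
    fix y
    define z where "z = Complex (r + 1) y"
    have "cmod z * cmod (lap (W (Suc (j + d)) j) z)
       = cmod (of_nat (Suc (Suc (j + d))) * lap (W (j + d) j) z + lap (W (Suc (j + d)) (Suc j)) z)"
      unfolding norm_mult[symmetric]
      by (subst W_by_parts) (use Suc.prems in \<open>auto simp: z_def\<close>)
    also have "\<dots> \<le> real (Suc (Suc (j + d))) * cmod (lap (W (j + d) j) z) + cmod (lap (W (Suc (j + d)) (Suc j)) z)"
      by (rule order_trans[OF norm_triangle_ineq]) (simp only: norm_mult norm_of_nat order_refl)
    also have "\<dots> \<le> real (Suc (Suc (j + d))) * (C1 * (1 + \<bar>y\<bar>) powr (\<alpha> - 1 - real d)) + C2 * (1 + \<bar>y\<bar>) powr (\<alpha> - 1 - real d)"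
      unfolding z_def by (intro add_mono mult_left_mono C1 C2) auto
    also have "\<dots> = C / 2 * (1 + \<bar>y\<bar>) powr (\<alpha> - 1 - real d)"
      by (simp add: C_def algebra_simps)
    finally have "2 * (cmod z * cmod (lap (W (Suc (j + d)) j) z)) \<le> C * (1 + \<bar>y\<bar>) powr (\<alpha> - 1 - real d)"
      by simp
    moreover have "(1 + \<bar>y\<bar>) * cmod (lap (W (Suc (j + d)) j) z) \<le> (2 * cmod z) * cmod (lap (W (Suc (j + d)) j) z)"
      using one_plus_abs_le_norm[of y] by (intro mult_right_mono) (auto simp: z_def)
    ultimately have "(1 + \<bar>y\<bar>) * cmod (lap (W (Suc (j + d)) j) z) \<le> C * (1 + \<bar>y\<bar>) powr (\<alpha> - 1 - real d)"
      by simp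
    moreover have "(1 + \<bar>y\<bar>) powr (\<alpha> - 1 - real d) = (1 + \<bar>y\<bar>) powr (\<alpha> - 1 - real (Suc d)) * (1 + \<bar>y\<bar>)"
      using powr_mult_base[of "1 + \<bar>y\<bar>" "\<alpha> - 1 - real (Suc d)"] by (simp add: mult.commute algebra_simps)
    ultimately have "cmod (lap (W (Suc (j + d)) j) z) * (1 + \<bar>y\<bar>) \<le> C * (1 + \<bar>y\<bar>) powr (\<alpha> - 1 - real (Suc d)) * (1 + \<bar>y\<bar>)"
      by (simp only: mult_ac)
    then have "cmod (lap (W (Suc (j + d)) j) z) \<le> C * (1 + \<bar>y\<bar>) powr (\<alpha> - 1 - real (Suc d))"
      by (rule mult_right_le_imp_le) simp
    then show "cmod (lap (W (j + Suc d) j) (Complex (r + 1) y)) \<le> C * (1 + \<bar>y\<bar>) powr (\<alpha> - 1 - real (Suc d))"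
      by (simp add: z_def)
  qed
qed

section \<open>The exponent itself: convergence, holomorphy, order\<close>

abbreviation \<kappa> :: "complex \<Rightarrow> complex" where "\<kappa> \<equiv> laplace_exponent u"

lemma u_nonneg: "x > 0 \<Longrightarrow> 0 \<le> u x"
  using levy by (simp add: infinite_activity_levy_density_def)

lemma min_u_integrable: "integrable lborel (\<lambda>x. indicator {0<..} x * (min 1 x * u x))"
  using levy by (simp add: infinite_activity_levy_density_def set_integrable_def)

text \<open>The Levy condition gives measurability of the product \<open>min 1 x * u x\<close>;
  dividing by the positive factor recovers \<open>u\<close>.\<close>

lemma u_measurable: "(\<lambda>x. indicator {0<..} x * u x) \<in> borel_measurable borel"
proof -
  have [measurable]: "(\<lambda>x. indicator {0<..} x * (min 1 x * u x)) \<in> borel_measurable borel"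
    using min_u_integrable by auto
  have "(\<lambda>x. indicator {0<..} x * u x) = (\<lambda>x. (indicator {0<..} x * (min 1 x * u x)) * inverse (min 1 x))"
    by (auto simp: fun_eq_iff indicator_def min_def)
  then show ?thesis by simp
qed

text \<open>For \<open>x \<le> 1\<close> this is the mean value inequality for \<open>exp\<close> on
  the left half-plane, otherwise the triangle inequality.\<close>

lemma norm_exp_minus_one_le:
  assumes "Re \<theta> \<ge> 0" "x > 0"
  shows "cmod (exp (- \<theta> * complex_of_real x) - 1) \<le> (2 + cmod \<theta>) * min 1 x"
proof (cases "x \<le> 1")
  case True
  have "norm (exp (- \<theta> * complex_of_real x) - exp 0) \<le> 1 * norm (- \<theta> * complex_of_real x - 0)"
  proof (rule field_differentiable_bound[where S = "{z. Re z \<le> 0}" and f' = exp])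
    show "norm (exp z) \<le> 1" if "z \<in> {z. Re z \<le> 0}" for z :: complex using that by simp
  qed (use assms in \<open>auto intro!: convex_halfspace_Re_le DERIV_subset[OF DERIV_exp] mult_nonneg_nonneg\<close>)
  also have "\<dots> = cmod \<theta> * x" using assms by (simp add: norm_mult)
  also have "\<dots> \<le> (2 + cmod \<theta>) * min 1 x" using True assms by (simp add: min_def mult_right_mono)
  finally show ?thesis by simp
next
  case False
  have "cmod (exp (- \<theta> * complex_of_real x) - 1) \<le> cmod (exp (- \<theta> * complex_of_real x)) + 1"
    using norm_triangle_ineq4[of "exp (- \<theta> * complex_of_real x)" 1] by simp
  also have "\<dots> \<le> 1 + 1" using assms by (intro add_mono) auto
  also have "\<dots> \<le> (2 + cmod \<theta>) * min 1 x" using False by simp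
  finally show ?thesis .
qed

lemma laplace_exponent_integrable:
  assumes "Re \<theta> \<ge> 0"
  shows "integrable lborel (\<lambda>x. indicator {0<..} x *\<^sub>R ((exp (- \<theta> * complex_of_real x) - 1) * complex_of_real (u x)))"
proof (rule Bochner_Integration.integrable_bound[OF integrable_mult_right[OF min_u_integrable, of "2 + cmod \<theta>"]])
  note [measurable] = u_measurable
  have "(\<lambda>x. indicator {0<..} x *\<^sub>R ((exp (- \<theta> * complex_of_real x) - 1) * complex_of_real (u x)))
      = (\<lambda>x. (exp (- \<theta> * complex_of_real x) - 1) * complex_of_real (indicator {0<..} x * u x))"
    by (auto simp: fun_eq_iff indicator_def)
  also have "\<dots> \<in> borel_measurable lborel" by measurable
  finally show "(\<lambda>x. indicator {0<..} x *\<^sub>R ((exp (- \<theta> * complex_of_real x) - 1) * complex_of_real (u x))) \<in> borel_measurable lborel" .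
  show "AE x in lborel. norm (indicator {0<..} x *\<^sub>R ((exp (- \<theta> * complex_of_real x) - 1) * complex_of_real (u x)))
      \<le> norm ((2 + cmod \<theta>) * (indicator {0<..} x * (min 1 x * u x)))"
  proof (rule AE_I2)
    fix x :: real
    show "norm (indicator {0<..} x *\<^sub>R ((exp (- \<theta> * complex_of_real x) - 1) * complex_of_real (u x)))
      \<le> norm ((2 + cmod \<theta>) * (indicator {0<..} x * (min 1 x * u x)))"
    proof (cases "x > 0")
      case True
      have "cmod (exp (- \<theta> * complex_of_real x) - 1) * u x \<le> ((2 + cmod \<theta>) * min 1 x) * u x"
        using u_nonneg[OF True] norm_exp_minus_one_le[OF assms True] by (intro mult_right_mono)
      then show ?thesis using True u_nonneg[OF True] by (simp add: norm_mult abs_mult mult_ac)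
    qed simp
  qed
qed

text \<open>\<kappa> is not the \<open>lap\<close> of \<open>u\<close>, which is not integrable at
  0. Differentiation brings down a factor x, and x times \<open>u\<close> is \<open>W 0 0\<close>,
  which has a transform.\<close>

lemma has_field_derivative_laplace_exponent:
  assumes \<theta>: "Re \<theta> > r"
  shows "(\<kappa> has_field_derivative - lap (W 0 0) \<theta>) (at \<theta>)"
proof -
  define s where "s = (r + Re \<theta>) / 2"
  define S where "S = {z. s < Re z}"
  have s: "s > r" "Re \<theta> > s" using \<theta> by (auto simp: s_def field_simps)
  have ok: "lap_ok r (W 0 0)" by (rule lap_ok_W) auto
  have [measurable]: "W 0 0 \<in> borel_measurable borel" by (rule lap_okD(2)[OF ok])
  have "(\<kappa> has_field_derivative (\<integral>x. exp (- \<theta> * complex_of_real x) * complex_of_real (- W 0 0 x) \<partial>lborel)) (at \<theta> within S)"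
    unfolding laplace_exponent_def set_lebesgue_integral_def
  proof (rule has_field_derivative_lebesgue_integral[where g = "\<lambda>x. norm (exp (- s * x) * W 0 0 x)"
       and f' = "\<lambda>z x. exp (- z * complex_of_real x) * complex_of_real (- W 0 0 x)"])
    show "convex S" unfolding S_def by (rule convex_halfspace_Re_gt)
    show "\<theta> \<in> S" using s by (simp add: S_def)
    show "integrable lborel (\<lambda>x. indicator {0<..} x *\<^sub>R ((exp (- z * complex_of_real x) - 1) * complex_of_real (u x)))" if "z \<in> S" for z
      using that s r by (intro laplace_exponent_integrable) (auto simp: S_def)
    show "integrable lborel (\<lambda>x. norm (exp (- s * x) * W 0 0 x))"
      by (rule integrable_norm[OF lap_okD(3)[OF ok s(1)]])
    show "norm (exp (- x * complex_of_real y) * complex_of_real (- W 0 0 y)) \<le> norm (exp (- s * y) * W 0 0 y)"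
      if "x \<in> S" for x y
    proof (cases "y > 0")
      case True
      then show ?thesis using that by (auto simp: norm_mult abs_mult S_def intro!: mult_right_mono)
    qed (simp add: W_def)
    show "((\<lambda>z. indicator {0<..} x *\<^sub>R ((exp (- z * complex_of_real x) - 1) * complex_of_real (u x))) has_field_derivative
            exp (- z * complex_of_real x) * complex_of_real (- W 0 0 x)) (at z within S)" for z x
    proof (cases "x > 0")
      case True
      then show ?thesis by (auto intro!: derivative_eq_intros simp: W_def)
    qed (simp add: W_def)
  qed simp
  moreover have "open S" unfolding S_def by (rule open_halfspace_Re_gt)
  moreover have "\<theta> \<in> S" using s by (simp add: S_def)
  moreover have "(\<integral>x. exp (- \<theta> * complex_of_real x) * complex_of_real (- W 0 0 x) \<partial>lborel) = - lap (W 0 0) \<theta>"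
    unfolding lap_uminus[symmetric] by (simp only: lap_def)
  ultimately show ?thesis by (simp only: at_within_open)
qed

lemma holomorphic_on_laplace_exponent: "\<kappa> holomorphic_on halfplane r"
  unfolding holomorphic_on_def field_differentiable_def
  using has_field_derivative_laplace_exponent has_field_derivative_at_within by blast

text \<open>Up to sign the i-th derivative of \<open>lap (W 0 0)\<close> is
  \<open>lap (W i 0)\<close>, and \<open>W i 0\<close> is at distance i from the diagonal.\<close>

lemma symb_deriv_laplace_exponent: "symb r 1 m (\<alpha> - 1) (deriv \<kappa>)"
proof -
  have ok: "lap_ok r (W 0 0)" by (rule lap_ok_W) auto
  have "symb r 1 m (\<alpha> - 1) (lap (W 0 0))"
    unfolding symb_def
  proof (intro conjI allI impI holomorphic_on_lap ok)
    fix i assume "i \<le> m"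
    then obtain C where "\<And>y. cmod (lap (W i 0) (Complex (r + 1) y)) \<le> C * (1 + \<bar>y\<bar>) powr (\<alpha> - 1 - real i)"
      using lap_W_decay[of 0 i] by auto
    moreover have "(\<lambda>x. x ^ i * W 0 0 x) = W i 0" by (auto simp: W_def fun_eq_iff)
    then have "(deriv ^^ i) (lap (W 0 0)) (Complex (r + 1) y) = (-1) ^ i * lap (W i 0) (Complex (r + 1) y)" for y
      using higher_deriv_lap[OF ok, of "Complex (r + 1) y" i] by simp
    ultimately show "\<exists>C. \<forall>y. cmod ((deriv ^^ i) (lap (W 0 0)) (Complex (r + 1) y)) \<le> C * (1 + \<bar>y\<bar>) powr (\<alpha> - 1 - real i * 1)"
      by (auto simp: norm_mult norm_power)
  qed
  from symb_cmult[OF this, of "-1"] show ?thesis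
    by (rule symb_cong) (simp add: DERIV_imp_deriv[OF has_field_derivative_laplace_exponent])
qed

text \<open>The modulus hypotheses reach \<kappa> only through its derivative. The bound for
  \<kappa> comes from integrating the one for \<open>deriv \<kappa>\<close> along the line from its
  real point; as \<alpha> > 0, the result has order \<alpha>.\<close>

lemma symb_laplace_exponent: "symb r 1 (Suc m) \<alpha> \<kappa>"
proof -
  obtain C where C: "C \<ge> 0" "\<And>y. cmod (deriv \<kappa> (Complex (r + 1) y)) \<le> C * (1 + \<bar>y\<bar>) powr (\<alpha> - 1)"
    using symb_bound[OF symb_deriv_laplace_exponent, of 0] by auto
  define B where "B = cmod (\<kappa> (Complex (r + 1) 0)) + C / \<alpha>"
  have "cmod (\<kappa> (Complex (r + 1) y)) \<le> B * (1 + \<bar>y\<bar>) powr \<alpha>" for y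
  proof -
    \<comment> \<open>\<open>sgn y\<close> treats both directions along the line at once, and
      \<open>\<phi>\<close> is a primitive of the bound for the derivative.\<close>
    define g where "g s = \<kappa> (Complex (r + 1) (sgn y * s))" for s
    define \<phi> where "\<phi> s = C / \<alpha> * (1 + s) powr \<alpha>" for s
    have dg: "(g has_vector_derivative \<i> * sgn y * deriv \<kappa> (Complex (r + 1) (sgn y * s))) (at s)" for s
    proof -
      have "(\<kappa> has_field_derivative deriv \<kappa> (Complex (r + 1) (sgn y * s))) (at (Complex (r + 1) (sgn y * s)))"
        by (rule holomorphic_derivI[OF holomorphic_on_laplace_exponent open_halfspace_Re_gt]) simp
      moreover have "((\<lambda>s. Complex (r + 1) (sgn y * s)) has_vector_derivative \<i> * sgn y) (at s)"
        unfolding Complex_eq by (auto intro!: derivative_eq_intros has_vector_derivative_of_real)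
      ultimately have "(\<kappa> \<circ> (\<lambda>s. Complex (r + 1) (sgn y * s)) has_vector_derivative
          (\<i> * sgn y) * deriv \<kappa> (Complex (r + 1) (sgn y * s))) (at s)"
        using field_vector_diff_chain_at by blast
      then show ?thesis by (simp add: g_def[abs_def] o_def)
    qed
    have "norm (g \<bar>y\<bar> - g 0) \<le> \<phi> \<bar>y\<bar> - \<phi> 0"
    proof (cases "y = 0")
      case False
      then show ?thesis
      proof (intro differentiable_bound_general)
        show "continuous_on {0..\<bar>y\<bar>} g"
          using dg by (intro continuous_at_imp_continuous_on ballI has_vector_derivative_continuous) blast
        show "continuous_on {0..\<bar>y\<bar>} \<phi>" unfolding \<phi>_def by (intro continuous_intros) auto
        show "(g has_vector_derivative \<i> * sgn y * deriv \<kappa> (Complex (r + 1) (sgn y * s))) (at s)" for s by (rule dg)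
        show "(\<phi> has_vector_derivative C * (1 + s) powr (\<alpha> - 1)) (at s)" if "0 < s" for s
          unfolding \<phi>_def has_real_derivative_iff_has_vector_derivative[symmetric]
          using that \<alpha> by (auto intro!: derivative_eq_intros)
        show "norm (\<i> * complex_of_real (sgn y) * deriv \<kappa> (Complex (r + 1) (sgn y * s))) \<le> C * (1 + s) powr (\<alpha> - 1)" if "0 < s" for s
          using C(2)[of "sgn y * s"] that False by (simp add: norm_mult abs_mult)
      qed simp
    qed simp
    moreover have "g \<bar>y\<bar> = \<kappa> (Complex (r + 1) y)" "g 0 = \<kappa> (Complex (r + 1) 0)" "\<phi> 0 \<ge> 0"
      using C \<alpha> by (simp_all add: g_def \<phi>_def mult_sgn_abs)
    ultimately have "cmod (\<kappa> (Complex (r + 1) y)) \<le> cmod (\<kappa> (Complex (r + 1) 0)) * 1 + C / \<alpha> * (1 + \<bar>y\<bar>) powr \<alpha>"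
      using norm_triangle_ineq2[of "\<kappa> (Complex (r + 1) y)" "\<kappa> (Complex (r + 1) 0)"] by (simp add: \<phi>_def)
    also have "\<dots> \<le> cmod (\<kappa> (Complex (r + 1) 0)) * (1 + \<bar>y\<bar>) powr \<alpha> + C / \<alpha> * (1 + \<bar>y\<bar>) powr \<alpha>"
      using \<alpha> by (intro add_right_mono mult_left_mono ge_one_powr_ge_zero) auto
    finally show ?thesis by (simp add: B_def distrib_right)
  qed
  then show ?thesis
    by (intro symb_SucI[OF holomorphic_on_laplace_exponent, of B] symb_deriv_laplace_exponent)
qed

end

section \<open>Convolution powers\<close>

lemma lborel_Fubini:
  fixes \<Phi> :: "real \<Rightarrow> real \<Rightarrow> complex"
  assumes meas: "(\<lambda>(y, x). \<Phi> y x) \<in> borel_measurable (borel \<Otimes>\<^sub>M borel)"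
    and int: "\<And>y. integrable lborel (\<Phi> y)"
    and int2: "integrable lborel (\<lambda>y. \<integral>x. norm (\<Phi> y x) \<partial>lborel)"
  shows "integrable lborel (\<lambda>x. \<integral>y. \<Phi> y x \<partial>lborel)"
    and "(\<integral>x. (\<integral>y. \<Phi> y x \<partial>lborel) \<partial>lborel) = (\<integral>y. (\<integral>x. \<Phi> y x \<partial>lborel) \<partial>lborel)"
proof -
  have m: "(\<lambda>(y, x). \<Phi> y x) \<in> borel_measurable (lborel \<Otimes>\<^sub>M lborel)"
    using meas by (simp cong: sets_pair_measure_cong measurable_cong_sets)
  have "integrable (lborel \<Otimes>\<^sub>M lborel) (\<lambda>(y, x). \<Phi> y x)"
    by (rule lborel_pair.Fubini_integrable[OF m]) (use int int2 in auto)
  then show "integrable lborel (\<lambda>x. \<integral>y. \<Phi> y x \<partial>lborel)"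
    and "(\<integral>x. (\<integral>y. \<Phi> y x \<partial>lborel) \<partial>lborel) = (\<integral>y. (\<integral>x. \<Phi> y x \<partial>lborel) \<partial>lborel)"
    by (rule lborel_pair.integrable_snd, rule lborel_pair.Fubini_integral)
qed

text \<open>Tails, convolutions and densities matter on positive arguments only, whereas
  \<open>lap\<close> integrates over the whole line.\<close>

definition zext :: "(real \<Rightarrow> real) \<Rightarrow> real \<Rightarrow> real" where
  "zext f x = (if x > 0 then f x else 0)"

lemma zext_measurable:
  assumes "continuous_on {0<..} f"
  shows "zext f \<in> borel_measurable borel"
proof -
  have "(\<lambda>x. indicator {0<..} x *\<^sub>R f x) \<in> borel_measurable borel"
    by (intro borel_measurable_continuous_on_indicator assms) simp
  also have "(\<lambda>x. indicator {0<..} x *\<^sub>R f x) = zext f"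
    by (auto simp: zext_def fun_eq_iff)
  finally show ?thesis .
qed

lemma lap_okI_of_nonneg:
  assumes "continuous_on {0<..} f"
    and "\<And>s. s > r \<Longrightarrow> integrable lborel (\<lambda>x. exp (- complex_of_real s * complex_of_real x) * complex_of_real (zext f x))"
  shows "lap_ok r (zext f)"
  unfolding lap_ok_def
proof (intro conjI allI impI zext_measurable assms(1))
  fix s assume "s > r"
  from integrable_Re[OF assms(2)[OF this]]
  show "integrable lborel (\<lambda>x. exp (- s * x) * zext f x)" by (simp add: Re_exp)
qed (simp add: zext_def)

lemma lap_ok_local_integrable:
  assumes "lap_ok r F"
  shows "integrable lborel (\<lambda>y. indicator {..b} y * F y)"
proof -
  define s where "s = \<bar>r\<bar> + 1"
  have s: "s > r" "s > 0" by (auto simp: s_def)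
  have [measurable]: "F \<in> borel_measurable borel" by (rule lap_okD(2)[OF assms])
  show ?thesis
  proof (rule Bochner_Integration.integrable_bound[OF integrable_mult_right[OF lap_okD(3)[OF assms s(1)], of "exp (s * b)"]])
    show "AE y in lborel. norm (indicator {..b} y * F y) \<le> norm (exp (s * b) * (exp (- s * y) * F y))"
    proof (rule AE_I2)
      fix y :: real
      show "norm (indicator {..b} y * F y) \<le> norm (exp (s * b) * (exp (- s * y) * F y))"
      proof (cases "y \<le> b")
        case True
        have "1 * \<bar>F y\<bar> \<le> exp (s * (b - y)) * \<bar>F y\<bar>" using True s by (intro mult_right_mono) auto
        also have "\<dots> = norm (exp (s * b) * (exp (- s * y) * F y))"
          by (simp add: abs_mult right_diff_distrib flip: exp_add mult.assoc)
        finally show ?thesis using True by simp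
      qed simp
    qed
  qed measurable
qed

text \<open>Cutting the convolution at \<open>x / 2\<close> keeps the argument of \<open>G\<close> away from the singularity at \<open>0\<close>, so that
  a multiple of \<open>F\<close> dominates the integrand locally uniformly in \<open>x\<close>.\<close>

lemma half_conv:
  fixes F G :: "real \<Rightarrow> real"
  assumes F0: "\<And>y. y \<le> 0 \<Longrightarrow> F y = 0" and Fi: "\<And>b. integrable lborel (\<lambda>y. indicator {..b::real} y * F y)"
    and Fm[measurable]: "F \<in> borel_measurable borel" and Gm[measurable]: "G \<in> borel_measurable borel"
    and G: "continuous_on {0<..} G"
  shows "x > 0 \<Longrightarrow> integrable lborel (\<lambda>y. indicator {..x / 2} y * (F y * G (x - y)))"
    and "continuous_on {0<..} (\<lambda>x. \<integral>y. indicator {..x / 2} y * (F y * G (x - y)) \<partial>lborel)"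
proof -
  have bound: "\<exists>M. \<forall>x\<in>{a<..<b}. \<forall>y. norm (indicator {..x / 2} y * (F y * G (x - y))) \<le> norm (M * (indicator {..b} y * F y))"
    if ab: "0 < a" for a b :: real
  proof -
    have "continuous_on {a / 2..b} G" by (rule continuous_on_subset[OF G]) (use ab in auto)
    then have "bounded (G ` {a / 2..b})"
      by (intro compact_imp_bounded compact_continuous_image) auto
    then obtain M where M: "\<And>z. z \<in> {a / 2..b} \<Longrightarrow> \<bar>G z\<bar> \<le> M"
      by (metis bounded_iff imageI real_norm_def)
    show ?thesis
    proof (intro exI[of _ M] ballI allI)
      fix x y assume x: "x \<in> {a<..<b}"
      show "norm (indicator {..x / 2} y * (F y * G (x - y))) \<le> norm (M * (indicator {..b} y * F y))"
      proof (cases "0 < y \<and> y \<le> x / 2")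
        case True
        then have "x - y \<in> {a / 2..b}" "y \<le> b" using x ab by auto
        moreover from this have "\<bar>G (x - y)\<bar> \<le> \<bar>M\<bar>" using M[of "x - y"] by linarith
        ultimately show ?thesis using True mult_left_mono[of "\<bar>G (x - y)\<bar>" "\<bar>M\<bar>" "\<bar>F y\<bar>"]
          by (simp add: abs_mult mult.commute)
      next
        case False
        then show ?thesis using F0[of y] by (cases "y \<le> 0") auto
      qed
    qed
  qed
  show int: "integrable lborel (\<lambda>y. indicator {..x / 2} y * (F y * G (x - y)))" if x: "x > 0" for x
  proof -
    obtain M where M: "\<And>z y. z \<in> {x / 2<..<2 * x} \<Longrightarrow> norm (indicator {..z / 2} y * (F y * G (z - y))) \<le> norm (M * (indicator {..2 * x} y * F y))"
      using bound[of "x / 2" "2 * x"] x by (meson half_gt_zero)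
    show ?thesis
      by (rule Bochner_Integration.integrable_bound[OF integrable_mult_right[OF Fi[of "2 * x"], of M]])
         (use M[of x] x in auto)
  qed
  show "continuous_on {0<..} (\<lambda>x. \<integral>y. indicator {..x / 2} y * (F y * G (x - y)) \<partial>lborel)"
  proof (intro continuous_at_imp_continuous_on ballI)
    fix x0 :: real assume x0: "x0 \<in> {0<..}"
    define S where "S = {x0 / 2<..<2 * x0}"
    have S: "open S" "x0 \<in> S" "S \<subseteq> {0<..}" using x0 by (auto simp: S_def)
    obtain M where M: "\<And>z y. z \<in> S \<Longrightarrow> norm (indicator {..z / 2} y * (F y * G (z - y))) \<le> norm (M * (indicator {..2 * x0} y * F y))"
      using bound[of "x0 / 2" "2 * x0"] x0 unfolding S_def by (meson greaterThan_iff half_gt_zero)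
    have "continuous_on S (\<lambda>x. \<integral>y. indicator {..x / 2} y * (F y * G (x - y)) \<partial>lborel)"
      unfolding continuous_on_sequentially
    proof (intro allI ballI impI, elim conjE)
      fix X :: "nat \<Rightarrow> real" and x assume x: "x \<in> S" and X: "\<forall>n. X n \<in> S" and lim: "X \<longlonglongrightarrow> x"
      have "(\<lambda>n. \<integral>y. indicator {..X n / 2} y * (F y * G (X n - y)) \<partial>lborel) \<longlonglongrightarrow>
          (\<integral>y. indicator {..x / 2} y * (F y * G (x - y)) \<partial>lborel)"
      proof (rule integral_dominated_convergence[where w = "\<lambda>y. norm (M * (indicator {..2 * x0} y * F y))"])
        show "integrable lborel (\<lambda>y. norm (M * (indicator {..2 * x0} y * F y)))"
          by (intro integrable_norm integrable_mult_right Fi)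
        show "AE y in lborel. norm (indicator {..X n / 2} y * (F y * G (X n - y))) \<le> norm (M * (indicator {..2 * x0} y * F y))" for n
          using M X by blast
        show "AE y in lborel. (\<lambda>n. indicator {..X n / 2} y * (F y * G (X n - y))) \<longlonglongrightarrow> indicator {..x / 2} y * (F y * G (x - y))"
        \<comment> \<open>The moving cut-off can fail to converge only at \<open>y = x / 2\<close>,
          a null set.\<close>
        proof (rule eventually_mono[OF AE_lborel_singleton[of "x / 2"]])
          fix y assume y: "y \<noteq> x / 2"
          have lim2: "(\<lambda>n. X n / 2) \<longlonglongrightarrow> x / 2" by (intro tendsto_intros lim) auto
          show "(\<lambda>n. indicator {..X n / 2} y * (F y * G (X n - y))) \<longlonglongrightarrow> indicator {..x / 2} y * (F y * G (x - y))"
          proof (cases "y < x / 2")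
            case True
            then have ev: "\<forall>\<^sub>F n in sequentially. y < X n / 2" using order_tendstoD(1)[OF lim2] by blast
            have "x - y \<in> {0<..}" using True x S by auto
            then have "isCont G (x - y)" using G continuous_on_eq_continuous_at[of "{0<..}" G] by auto
            then have "(\<lambda>n. G (X n - y)) \<longlonglongrightarrow> G (x - y)"
              by (rule isCont_tendsto_compose) (intro tendsto_intros lim)
            then have "(\<lambda>n. F y * G (X n - y)) \<longlonglongrightarrow> indicator {..x / 2} y * (F y * G (x - y))"
              using True by (auto intro: tendsto_intros)
            then show ?thesis
              by (rule Lim_transform_eventually) (use ev in eventually_elim, simp)
          next
            case False
            then have "\<forall>\<^sub>F n in sequentially. X n / 2 < y" using order_tendstoD(2)[OF lim2, of y] y by auto
            then have "\<forall>\<^sub>F n in sequentially. indicator {..X n / 2} y * (F y * G (X n - y)) = indicator {..x / 2} y * (F y * G (x - y))"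
              by eventually_elim (use False y in auto)
            then show ?thesis by (rule tendsto_eventually)
          qed
        qed
      qed measurable
      then show "((\<lambda>x. \<integral>y. indicator {..x / 2} y * (F y * G (x - y)) \<partial>lborel) \<circ> X) \<longlonglongrightarrow>
          (\<integral>y. indicator {..x / 2} y * (F y * G (x - y)) \<partial>lborel)" by (simp add: o_def)
    qed
    then show "isCont (\<lambda>x. \<integral>y. indicator {..x / 2} y * (F y * G (x - y)) \<partial>lborel) x0"
      using continuous_on_eq_continuous_at[OF S(1)] S(2) by blast
  qed
qed

text \<open>What \<open>lap_inversion\<close> asks of the function itself, in a form that
  \<open>conv\<close> preserves.\<close>

definition causal :: "real \<Rightarrow> (real \<Rightarrow> real) \<Rightarrow> bool" where
  "causal r f \<longleftrightarrow> continuous_on {0<..} f \<and> (\<forall>x>0. 0 \<le> f x) \<and> lap_ok r (zext f)"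

text \<open>Both factors may be singular at 0, so the convolution is split at \<open>x / 2\<close>
  and the upper half is reflected; in each half one factor is locally integrable and the other is
  evaluated away from 0. The product formula is Fubini, justified by absolute convergence of both
  transforms.\<close>

lemma causal_conv:
  assumes f: "causal r f" and g: "causal r g"
  shows "x > 0 \<Longrightarrow> set_integrable lborel {0<..<x} (\<lambda>y. f y * g (x - y))"
    and "causal r (conv f g)"
    and "Re \<theta> > r \<Longrightarrow> lap (zext (conv f g)) \<theta> = lap (zext f) \<theta> * lap (zext g) \<theta>"
proof -
  define F G where "F = zext f" and "G = zext g"
  have F0: "F y = 0" "G y = 0" if "y \<le> 0" for y using that by (simp_all add: F_def G_def zext_def)
  have nn: "F y \<ge> 0" "G y \<ge> 0" for y using f g by (auto simp: F_def G_def zext_def causal_def)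
  have ok: "lap_ok r F" "lap_ok r G" using f g by (simp_all add: F_def G_def causal_def)
  note [measurable] = lap_okD(2)[OF ok(1)] lap_okD(2)[OF ok(2)]
  have "continuous_on {0<..} f" "continuous_on {0<..} g" using f g by (simp_all add: causal_def)
  then have cont: "continuous_on {0<..} F" "continuous_on {0<..} G"
    unfolding F_def G_def zext_def by (simp_all cong: continuous_on_cong_simp)
  note prems = cont lap_okD(2)[OF ok(1)] lap_okD(2)[OF ok(2)]
    lap_ok_local_integrable[OF ok(1)] lap_ok_local_integrable[OF ok(2)]
  have FG1: "integrable lborel (\<lambda>y. indicator {..x / 2} y * (F y * G (x - y)))" if "x > 0" for x
    by (rule half_conv(1); (rule that prems | erule F0))
  have GF1: "integrable lborel (\<lambda>y. indicator {..x / 2} y * (G y * F (x - y)))" if "x > 0" for x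
    by (rule half_conv(1); (rule that prems | erule F0))
  have FG2: "continuous_on {0<..} (\<lambda>x. \<integral>y. indicator {..x / 2} y * (F y * G (x - y)) \<partial>lborel)"
    by (rule half_conv(2); (rule prems | erule F0))
  have GF2: "continuous_on {0<..} (\<lambda>x. \<integral>y. indicator {..x / 2} y * (G y * F (x - y)) \<partial>lborel)"
    by (rule half_conv(2); (rule prems | erule F0))
  have GF': "integrable lborel (\<lambda>y. indicator {..<x / 2} y * (G y * F (x - y)))" if "x > 0" for x
    using GF1[OF that]
    by (rule Bochner_Integration.integrable_bound) (auto simp: abs_mult indicator_def)
  \<comment> \<open>Replacing y by \<open>x - y\<close> swaps the factors. The strict cut-off
    matches the complement of \<open>{..x / 2}\<close> and differs from the closed one in a single
    point.\<close>
  have refl: "indicator {..<x / 2} (x + - 1 * y) * (G (x + - 1 * y) * F (x - (x + - 1 * y)))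
      = indicator {x / 2<..} y * (F y * G (x - y))" for x y :: real
    by (simp add: indicator_def mult.commute) 
  have i2: "integrable lborel (\<lambda>y. indicator {x / 2<..} y * (F y * G (x - y)))" if "x > 0" for x
    using lborel_integrable_real_affine[OF GF'[OF that], of "-1" x] unfolding refl by simp
  have split: "F y * G (x - y) = indicator {..x / 2} y * (F y * G (x - y)) + indicator {x / 2<..} y * (F y * G (x - y))" for x y
    by (simp add: indicator_def)
  have FGint: "integrable lborel (\<lambda>y. F y * G (x - y))" if "x > 0" for x
    by (subst split) (use FG1[OF that] i2[OF that] in auto)
  have ind: "indicator {0<..<x} y *\<^sub>R (f y * g (x - y)) = F y * G (x - y)" for x y
    by (simp add: F_def G_def zext_def indicator_def)
  show "set_integrable lborel {0<..<x} (\<lambda>y. f y * g (x - y))" if "x > 0" for x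
    unfolding set_integrable_def ind by (rule FGint[OF that])
  have conv: "conv f g x = (\<integral>y. F y * G (x - y) \<partial>lborel)" for x
    unfolding conv_def set_lebesgue_integral_def ind ..
  have conv_split: "conv f g x = (\<integral>y. indicator {..x / 2} y * (F y * G (x - y)) \<partial>lborel)
       + (\<integral>y. indicator {..x / 2} y * (G y * F (x - y)) \<partial>lborel)" if "x > 0" for x
  proof -
    have "conv f g x = (\<integral>y. indicator {..x / 2} y * (F y * G (x - y)) + indicator {x / 2<..} y * (F y * G (x - y)) \<partial>lborel)"
      unfolding conv using split by (intro Bochner_Integration.integral_cong) auto
    also have "\<dots> = (\<integral>y. indicator {..x / 2} y * (F y * G (x - y)) \<partial>lborel) + (\<integral>y. indicator {x / 2<..} y * (F y * G (x - y)) \<partial>lborel)"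
      by (rule Bochner_Integration.integral_add) (use FG1[OF that] i2[OF that] in auto)
    also have "(\<integral>y. indicator {x / 2<..} y * (F y * G (x - y)) \<partial>lborel) = (\<integral>y. indicator {..<x / 2} y * (G y * F (x - y)) \<partial>lborel)"
      using lborel_integral_real_affine[of "-1" "\<lambda>y. indicator {..<x / 2} y * (G y * F (x - y))" x] unfolding refl by simp
    also have "\<dots> = (\<integral>y. indicator {..x / 2} y * (G y * F (x - y)) \<partial>lborel)"
    proof (rule integral_cong_AE)
      show "AE y in lborel. indicator {..<x / 2} y * (G y * F (x - y)) = indicator {..x / 2} y * (G y * F (x - y))"
        by (rule eventually_mono[OF AE_lborel_singleton[of "x / 2"]]) (auto simp: indicator_def)
    qed measurable
    finally show ?thesis .
  qed
  have ccont: "continuous_on {0<..} (conv f g)"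
    using continuous_on_add[OF FG2 GF2] by (simp add: conv_split cong: continuous_on_cong_simp)
  have cz: "zext (conv f g) x = (\<integral>y. F y * G (x - y) \<partial>lborel)" for x
  proof (cases "x > 0")
    case False
    have "F y * G (x - y) = 0" for y using F0(1)[of y] F0(2)[of "x - y"] False by (cases "y \<le> 0") auto
    then have "(\<lambda>y. F y * G (x - y)) = (\<lambda>_. 0)" by (rule ext)
    then show ?thesis using False by (simp add: zext_def)
  qed (simp add: zext_def conv)
  have lapl: "integrable lborel (\<lambda>x. exp (- \<theta> * complex_of_real x) * complex_of_real (zext (conv f g) x))
     \<and> lap (zext (conv f g)) \<theta> = lap F \<theta> * lap G \<theta>" if \<theta>: "Re \<theta> > r" for \<theta>
  proof -
    define \<Phi> where "\<Phi> y x = exp (- \<theta> * complex_of_real x) * complex_of_real (F y * G (x - y))" for y x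
    define g0 where "g0 x = exp (- \<theta> * complex_of_real x) * complex_of_real (G x)" for x
    have g0: "integrable lborel g0" unfolding g0_def by (rule lap_integrand_integrable[OF ok(2) \<theta>])
    \<comment> \<open>Writing x as y plus \<open>x - y\<close> in the exponential separates the two
      factors up to a translation.\<close>
    have \<Phi>: "\<Phi> y x = exp (- \<theta> * complex_of_real y) * complex_of_real (F y) * g0 (- y + 1 * x)" for y x
    proof -
      have e: "exp (- \<theta> * complex_of_real x) = exp (- \<theta> * complex_of_real y) * exp (- \<theta> * complex_of_real (- y + 1 * x))"
        unfolding exp_add[symmetric] by (rule arg_cong[where f = exp]) (simp add: algebra_simps)
      have x: "x - y = - y + 1 * x" by simp
      show ?thesis unfolding \<Phi>_def g0_def e x of_real_mult by (simp only: mult_ac)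
    qed
    have sh: "integrable lborel (\<lambda>x. g0 (- y + 1 * x))" "(\<integral>x. g0 (- y + 1 * x) \<partial>lborel) = lap G \<theta>"
       "(\<integral>x. norm (g0 (- y + 1 * x)) \<partial>lborel) = (\<integral>x. norm (g0 x) \<partial>lborel)" for y
      using lborel_integrable_real_affine[OF g0, of 1 "- y"] lborel_integral_real_affine[of 1 g0 "- y"]
        lborel_integral_real_affine[of 1 "\<lambda>x. norm (g0 x)" "- y"]
      by (simp_all add: lap_def g0_def[abs_def])
    have int: "integrable lborel (\<Phi> y)" for y
      unfolding \<Phi>[abs_def] by (intro integrable_mult_right sh)
    have "(\<integral>x. norm (\<Phi> y x) \<partial>lborel) = norm (exp (- \<theta> * complex_of_real y) * complex_of_real (F y)) * (\<integral>x. norm (g0 x) \<partial>lborel)" for y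
      unfolding \<Phi> norm_mult[of _ "g0 _"] by (simp only: integral_mult_right_zero sh(3))
    then have int2: "integrable lborel (\<lambda>y. \<integral>x. norm (\<Phi> y x) \<partial>lborel)"
      by (simp only:) (intro integrable_mult_left integrable_norm lap_integrand_integrable[OF ok(1) \<theta>])
    have meas: "(\<lambda>(y, x). \<Phi> y x) \<in> borel_measurable (borel \<Otimes>\<^sub>M borel)"
      unfolding \<Phi>_def by measurable
    have inner: "(\<integral>y. \<Phi> y x \<partial>lborel) = exp (- \<theta> * complex_of_real x) * complex_of_real (zext (conv f g) x)" for x
      unfolding \<Phi>_def cz by (simp only: integral_mult_right_zero integral_complex_of_real)
    have "(\<integral>x. \<Phi> y x \<partial>lborel) = exp (- \<theta> * complex_of_real y) * complex_of_real (F y) * lap G \<theta>" for y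
      unfolding \<Phi> by (simp only: integral_mult_right_zero sh(2))
    then have "(\<integral>y. (\<integral>x. \<Phi> y x \<partial>lborel) \<partial>lborel) = lap F \<theta> * lap G \<theta>"
      by (simp only: integral_mult_left_zero lap_def[of F])
    with lborel_Fubini[OF meas int int2] show ?thesis
      unfolding inner lap_def[of "zext (conv f g)"] by simp
  qed
  then show "lap (zext (conv f g)) \<theta> = lap (zext f) \<theta> * lap (zext g) \<theta>" if "Re \<theta> > r" for \<theta>
    using that by (simp add: F_def G_def)
  have "0 \<le> conv f g x" for x unfolding conv using nn by (intro Bochner_Integration.integral_nonneg) auto
  moreover have "lap_ok r (zext (conv f g))"
    by (rule lap_okI_of_nonneg[OF ccont]) (use lapl in auto)
  ultimately show "causal r (conv f g)" using ccont by (simp add: causal_def)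
qed

lemma causal_conv_power:
  assumes f: "causal r f" and k: "k \<ge> 1"
  shows "causal r (conv_power f k)" "conv_power_exists f k"
    "Re \<theta> > r \<Longrightarrow> lap (zext (conv_power f k)) \<theta> = lap (zext f) \<theta> ^ k"
proof -
  have step: "conv_power f (Suc (Suc j)) = conv (conv_power f (Suc j)) f" for j
    by (simp add: conv_power_def)
  have ind: "causal r (conv_power f (Suc j)) \<and> (\<forall>\<theta>. Re \<theta> > r \<longrightarrow> lap (zext (conv_power f (Suc j))) \<theta> = lap (zext f) \<theta> ^ Suc j)" for j
  proof (induction j)
    case 0
    show ?case using f by (simp add: conv_power_def)
  next
    case (Suc j)
    then show ?case unfolding step using causal_conv(2,3)[OF _ f] by (auto simp: mult.commute)
  qed
  obtain j where j: "k = Suc j" using k by (cases k) auto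
  show "causal r (conv_power f k)" "Re \<theta> > r \<Longrightarrow> lap (zext (conv_power f k)) \<theta> = lap (zext f) \<theta> ^ k"
    using ind[of j] by (auto simp: j)
  have "causal r (conv_power f i)" if "i \<in> {1..<k}" for i using ind[of "i - 1"] that by simp
  then show "conv_power_exists f k" unfolding conv_power_exists_def
    using causal_conv(1)[OF _ f] by blast
qed

section \<open>The upper tail\<close>

lemma integral_exp_Ioo:
  assumes \<theta>: "\<theta> \<noteq> 0" and y: "y > 0"
  shows "integrable lborel (\<lambda>x. indicator {0<..<y} x *\<^sub>R exp (- \<theta> * complex_of_real x))"
    and "(\<integral>x. indicator {0<..<y} x *\<^sub>R exp (- \<theta> * complex_of_real x) \<partial>lborel) = (1 - exp (- \<theta> * complex_of_real y)) / \<theta>"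
proof -
  have c: "continuous_on {0..y} (\<lambda>x. exp (- \<theta> * complex_of_real x))"
    by (intro continuous_intros)
  have si: "set_integrable lborel {0..y} (\<lambda>x. exp (- \<theta> * complex_of_real x))"
    using c by (rule borel_integrable_atLeastAtMost')
  have "set_integrable lborel {0<..<y} (\<lambda>x. exp (- \<theta> * complex_of_real x))"
    by (rule set_integrable_subset[OF si]) auto
  then show i: "integrable lborel (\<lambda>x. indicator {0<..<y} x *\<^sub>R exp (- \<theta> * complex_of_real x))"
    by (simp add: set_integrable_def)
  have "(\<integral>x. indicator {0<..<y} x *\<^sub>R exp (- \<theta> * complex_of_real x) \<partial>lborel)
      = (\<integral>x. indicator {0..y} x *\<^sub>R exp (- \<theta> * complex_of_real x) \<partial>lborel)"
  proof (rule integral_cong_AE)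
    show "AE x in lborel. indicator {0<..<y} x *\<^sub>R exp (- \<theta> * complex_of_real x) = indicator {0..y} x *\<^sub>R exp (- \<theta> * complex_of_real x)"
      using AE_lborel_singleton[of 0] AE_lborel_singleton[of y]
      by eventually_elim (auto simp: indicator_def)
  qed measurable
  also have "\<dots> = - exp (- \<theta> * complex_of_real y) / \<theta> - - exp (- \<theta> * complex_of_real 0) / \<theta>"
  proof (rule integral_FTC_Icc[OF _ _ c])
    fix x assume "0 \<le> x" "x \<le> y"
    show "((\<lambda>x. - exp (- \<theta> * complex_of_real x) / \<theta>) has_vector_derivative exp (- \<theta> * complex_of_real x)) (at x within {0..y})"
      using \<theta> by (auto intro!: derivative_eq_intros has_vector_derivative_real_field)
  qed (use y in simp)
  also have "\<dots> = (1 - exp (- \<theta> * complex_of_real y)) / \<theta>"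
    by (simp add: diff_divide_distrib)
  finally show "(\<integral>x. indicator {0<..<y} x *\<^sub>R exp (- \<theta> * complex_of_real x) \<partial>lborel) = (1 - exp (- \<theta> * complex_of_real y)) / \<theta>" .
qed

context regular_levy_density
begin

lemma u_tail_integrable:
  assumes x: "x > 0"
  shows "set_integrable lborel {x<..} u"
  unfolding set_integrable_def
proof (rule Bochner_Integration.integrable_bound[OF integrable_mult_right[OF min_u_integrable, of "1 / min 1 x"]])
  note [measurable] = u_measurable
  have "(\<lambda>y. indicator {x<..} y *\<^sub>R u y) = (\<lambda>y. indicator {x<..} y * (indicator {0<..} y * u y))"
    using x by (auto simp: fun_eq_iff indicator_def)
  also have "\<dots> \<in> borel_measurable lborel" by measurable
  finally show "(\<lambda>y. indicator {x<..} y *\<^sub>R u y) \<in> borel_measurable lborel" .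
  show "AE y in lborel. norm (indicator {x<..} y *\<^sub>R u y) \<le> norm (1 / min 1 x * (indicator {0<..} y * (min 1 y * u y)))"
  proof (rule AE_I2)
    fix y :: real
    show "norm (indicator {x<..} y *\<^sub>R u y) \<le> norm (1 / min 1 x * (indicator {0<..} y * (min 1 y * u y)))"
    proof (cases "x < y")
      case True
      have "min 1 x * u y \<le> min 1 y * u y"
        using True x u_nonneg[of y] by (intro mult_right_mono) auto
      then have "u y \<le> 1 / min 1 x * (min 1 y * u y)" using x by (simp add: field_simps min_def split: if_splits)
      also have "\<dots> = norm (1 / min 1 x * (indicator {0<..} y * (min 1 y * u y)))"
        using True x u_nonneg[of y] by (simp add: abs_mult)
      finally show ?thesis using True x u_nonneg[of y] by simp
    qed simp
  qed
qed

lemma upper_tail_nonneg: "x > 0 \<Longrightarrow> 0 \<le> upper_tail u x"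
  unfolding upper_tail_def set_lebesgue_integral_def
  using u_nonneg by (intro Bochner_Integration.integral_nonneg) (auto simp: indicator_def)

lemma continuous_on_upper_tail: "continuous_on {0<..} (upper_tail u)"
proof (intro continuous_at_imp_continuous_on ballI)
  fix x0 :: real assume x0: "x0 \<in> {0<..}"
  define a b where "a = x0 / 2" and "b = 2 * x0"
  have ab: "0 < a" "a < x0" "x0 < b" using x0 by (auto simp: a_def b_def)
  \<comment> \<open>The margin \<open>a / 2\<close> puts the closed interval \<open>{a..b}\<close>
    inside an open tail, on which \<open>u\<close> is integrable.\<close>
  have si: "set_integrable lborel S u" if "S \<in> sets borel" "S \<subseteq> {a / 2<..}" for S
    by (rule set_integrable_subset[OF u_tail_integrable[of "a / 2"]]) (use ab that in auto)
  have "u integrable_on {a..b}"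
    by (rule set_borel_integral_eq_integral(1)[OF si]) (use ab in auto)
  then have "continuous_on {a..b} (\<lambda>x. upper_tail u a - integral {a..x} u)"
    by (intro continuous_on_diff continuous_on_const indefinite_integral_continuous_1)
  moreover have "upper_tail u a - integral {a..x} u = upper_tail u x" if x: "x \<in> {a..b}" for x
  proof -
    have "{a<..} = {a<..x} \<union> {x<..}" using x by auto
    then have "upper_tail u a = (LINT y:{a<..x} \<union> {x<..}|lborel. u y)" by (simp only: upper_tail_def)
    also have "\<dots> = (LINT y:{a<..x}|lborel. u y) + upper_tail u x"
      unfolding upper_tail_def by (rule set_integral_Un) (use x ab in \<open>auto intro!: si\<close>)
    also have "(LINT y:{a<..x}|lborel. u y) = integral {a<..x} u"
      by (rule set_borel_integral_eq_integral(2)[OF si]) (use ab in auto)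
    also have "\<dots> = integral {a..x} u"
      by (rule integral_spike_set) (auto intro: negligible_subset[OF negligible_sing[of a]])
    finally show ?thesis by simp
  qed
  ultimately have "continuous_on {a..b} (upper_tail u)" by (rule continuous_on_eq)
  then have "continuous_on {a<..<b} (upper_tail u)" by (rule continuous_on_subset) auto
  then show "isCont (upper_tail u) x0"
    using ab continuous_on_eq_continuous_at[of "{a<..<b}" "upper_tail u"] by auto
qed

text \<open>Fubini on the triangle \<open>0 < x < y\<close>: integrating over y first gives the
  transform of the tail, over x first the integrand of \<kappa> divided by - \<theta>.\<close>

lemma lap_upper_tail_aux:
  assumes \<theta>: "Re \<theta> > 0"
  shows "integrable lborel (\<lambda>x. exp (- \<theta> * complex_of_real x) * complex_of_real (zext (upper_tail u) x))"
    and "lap (zext (upper_tail u)) \<theta> = - \<kappa> \<theta> / \<theta>"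
proof -
  note [measurable] = u_measurable
  define u0 where "u0 y = indicator {0<..} y * u y" for y
  have [measurable]: "u0 \<in> borel_measurable borel" unfolding u0_def[abs_def] by measurable
  define \<Phi> where "\<Phi> y x = (if 0 < x \<and> x < y then exp (- \<theta> * complex_of_real x) * complex_of_real (u0 y) else 0)" for y x :: real
  have \<Phi>0: "\<Phi> y = (\<lambda>_. 0)" if "y \<le> 0" for y using that by (auto simp: \<Phi>_def fun_eq_iff)
  have \<Phi>: "\<Phi> y = (\<lambda>x. (indicator {0<..<y} x *\<^sub>R exp (- \<theta> * complex_of_real x)) * complex_of_real (u0 y))" for y
    by (auto simp: \<Phi>_def fun_eq_iff indicator_def)
  have \<theta>0: "\<theta> \<noteq> 0" using \<theta> by auto
  have int: "integrable lborel (\<Phi> y)" for y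
  proof (cases "y > 0")
    case True
    show ?thesis unfolding \<Phi> by (intro integrable_mult_left integral_exp_Ioo[OF \<theta>0 True])
  qed (simp add: \<Phi>0)
  \<comment> \<open>Norms replace \<theta> by its real part, so absolute integrability is that of
    the integrand of \<kappa> at the real point \<open>s\<close>.\<close>
  define s where "s = complex_of_real (Re \<theta>)"
  have s: "Re s > 0" "s \<noteq> 0" using \<theta> by (auto simp: s_def)
  have nint: "complex_of_real (\<integral>x. norm (\<Phi> y x) \<partial>lborel)
      = (indicator {0<..} y *\<^sub>R ((exp (- s * complex_of_real y) - 1) * complex_of_real (u y))) * (- 1 / s)" for y
  proof (cases "y > 0")
    case True
    have "complex_of_real (\<integral>x. norm (\<Phi> y x) \<partial>lborel) = (\<integral>x. complex_of_real (norm (\<Phi> y x)) \<partial>lborel)"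
      by simp
    also have "\<dots> = (\<integral>x. (indicator {0<..<y} x *\<^sub>R exp (- s * complex_of_real x)) * complex_of_real (u y) \<partial>lborel)"
    proof (rule Bochner_Integration.integral_cong[OF refl])
      fix x
      have "complex_of_real (norm (exp (- \<theta> * complex_of_real x))) = exp (- s * complex_of_real x)"
        by (simp add: s_def flip: of_real_mult of_real_minus exp_of_real)
      then show "complex_of_real (norm (\<Phi> y x)) = (indicator {0<..<y} x *\<^sub>R exp (- s * complex_of_real x)) * complex_of_real (u y)"
        using True u_nonneg[OF True] by (auto simp: \<Phi>_def indicator_def norm_mult u0_def)
    qed
    also have "\<dots> = (1 - exp (- s * complex_of_real y)) / s * complex_of_real (u y)"
      by (simp only: integral_mult_left_zero integral_exp_Ioo(2)[OF s(2) True])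
    finally show ?thesis using True s by (simp add: field_simps)
  qed (simp add: \<Phi>0)
  have "integrable lborel (\<lambda>y. complex_of_real (\<integral>x. norm (\<Phi> y x) \<partial>lborel))"
    unfolding nint by (intro integrable_mult_left laplace_exponent_integrable) (use s in simp)
  from integrable_Re[OF this] have int2: "integrable lborel (\<lambda>y. \<integral>x. norm (\<Phi> y x) \<partial>lborel)" by simp
  have meas: "(\<lambda>(y, x). \<Phi> y x) \<in> borel_measurable (borel \<Otimes>\<^sub>M borel)"
    unfolding \<Phi>_def by measurable
  have inner: "(\<integral>y. \<Phi> y x \<partial>lborel) = exp (- \<theta> * complex_of_real x) * complex_of_real (zext (upper_tail u) x)" for x
  proof (cases "x > 0")
    case True
    have "(\<integral>y. \<Phi> y x \<partial>lborel) = (\<integral>y. exp (- \<theta> * complex_of_real x) * complex_of_real (indicator {x<..} y *\<^sub>R u y) \<partial>lborel)"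
      using True by (intro Bochner_Integration.integral_cong) (auto simp: \<Phi>_def u0_def indicator_def)
    also have "\<dots> = exp (- \<theta> * complex_of_real x) * complex_of_real (upper_tail u x)"
      unfolding upper_tail_def set_lebesgue_integral_def
      by (simp only: integral_mult_right_zero integral_complex_of_real)
    finally show ?thesis using True by (simp add: zext_def)
  qed (simp add: \<Phi>_def zext_def)
  have outer: "(\<integral>x. \<Phi> y x \<partial>lborel) = (indicator {0<..} y *\<^sub>R ((exp (- \<theta> * complex_of_real y) - 1) * complex_of_real (u y))) * (- 1 / \<theta>)" for y
  proof (cases "y > 0")
    case True
    have "(\<integral>x. \<Phi> y x \<partial>lborel) = (1 - exp (- \<theta> * complex_of_real y)) / \<theta> * complex_of_real (u0 y)"
      unfolding \<Phi> by (simp only: integral_mult_left_zero integral_exp_Ioo(2)[OF \<theta>0 True])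
    then show ?thesis using True \<theta>0 by (simp add: u0_def field_simps)
  qed (simp add: \<Phi>0)
  from lborel_Fubini[OF meas int int2]
  show "integrable lborel (\<lambda>x. exp (- \<theta> * complex_of_real x) * complex_of_real (zext (upper_tail u) x))"
    and "lap (zext (upper_tail u)) \<theta> = - \<kappa> \<theta> / \<theta>"
    unfolding inner outer
    by (simp_all add: lap_def laplace_exponent_def set_lebesgue_integral_def)
qed

lemma causal_upper_tail: "causal r (upper_tail u)"
  unfolding causal_def
proof (intro conjI allI impI continuous_on_upper_tail upper_tail_nonneg)
  show "lap_ok r (zext (upper_tail u))"
    by (rule lap_okI_of_nonneg[OF continuous_on_upper_tail], rule lap_upper_tail_aux) (use r in auto)
qed

lemma lap_upper_tail: "Re \<theta> > r \<Longrightarrow> lap (zext (upper_tail u)) \<theta> = - \<kappa> \<theta> / \<theta>"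
  using lap_upper_tail_aux(2)[of \<theta>] r by simp

end

section \<open>Inversion integrals\<close>

text \<open>Inversion integrals are complex-valued, \<open>nth_deriv_on\<close> is real. That
  \<open>Z j\<close> is real for \<open>j > 0\<close> comes out of the induction: a derivative of a
  real function is real, by uniqueness of derivatives at points that are not isolated.\<close>

lemma nth_deriv_on_eqI:
  fixes Z :: "nat \<Rightarrow> real \<Rightarrow> complex"
  assumes nt: "\<And>t. t \<in> S \<Longrightarrow> at t within S \<noteq> bot"
    and Z0: "\<And>t. t \<in> S \<Longrightarrow> complex_of_real (f t) = Z 0 t"
    and der: "\<And>j t. j < k \<Longrightarrow> t \<in> S \<Longrightarrow> (Z j has_vector_derivative Z (Suc j) t) (at t within S)"
  shows "times_differentiable_on S k f"
    and "j \<le> k \<Longrightarrow> t \<in> S \<Longrightarrow> complex_of_real (nth_deriv_on S j f t) = Z j t"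
proof -
  have step: "(nth_deriv_on S j f has_vector_derivative Re (Z (Suc j) t)) (at t within S)"
      "complex_of_real (Re (Z (Suc j) t)) = Z (Suc j) t"
    if IH: "\<And>t. t \<in> S \<Longrightarrow> complex_of_real (nth_deriv_on S j f t) = Z j t" and j: "j < k" and t: "t \<in> S" for j t
  proof -
    have 1: "((\<lambda>t. complex_of_real (nth_deriv_on S j f t)) has_vector_derivative Z (Suc j) t) (at t within S)"
      by (rule has_vector_derivative_transform[OF t _ der[OF j t]]) (simp add: IH)
    from bounded_linear.has_vector_derivative[OF bounded_linear_Re this]
    show 2: "(nth_deriv_on S j f has_vector_derivative Re (Z (Suc j) t)) (at t within S)" by simp
    from bounded_linear.has_vector_derivative[OF bounded_linear_of_real this]
    have "((\<lambda>t. complex_of_real (nth_deriv_on S j f t)) has_vector_derivative complex_of_real (Re (Z (Suc j) t))) (at t within S)" .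
    then show "complex_of_real (Re (Z (Suc j) t)) = Z (Suc j) t"
      using 1 vector_derivative_unique_within[OF nt[OF t]] by blast
  qed
  have main: "complex_of_real (nth_deriv_on S j f t) = Z j t" if "j \<le> k" "t \<in> S" for j t
    using that
  proof (induction j arbitrary: t)
    case (Suc j)
    have "vector_derivative (nth_deriv_on S j f) (at t within S) = Re (Z (Suc j) t)"
      by (rule vector_derivative_within[OF nt[OF Suc.prems(2)]], rule step(1)) (use Suc in auto)
    moreover have "complex_of_real (Re (Z (Suc j) t)) = Z (Suc j) t"
      by (rule step(2)) (use Suc in auto)
    ultimately show ?case by simp
  qed (use Z0 in simp)
  then show "j \<le> k \<Longrightarrow> t \<in> S \<Longrightarrow> complex_of_real (nth_deriv_on S j f t) = Z j t" .
  show "times_differentiable_on S k f"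
    unfolding times_differentiable_on_def differentiable_on_def
  proof (intro allI impI ballI)
    fix j t assume "j < k" "t \<in> S"
    then have "(nth_deriv_on S j f has_vector_derivative Re (Z (Suc j) t)) (at t within S)"
      using main[of j] by (intro step(1)) auto
    then show "nth_deriv_on S j f differentiable at t within S"
      by (rule differentiableI_vector)
  qed
qed

text \<open>The Bromwich integral along \<open>Re z = c\<close>; the factor \<i> from the
  parametrisation cancels the one in \<open>2 * pi * \<i>\<close>.\<close>

definition linv :: "real \<Rightarrow> (complex \<Rightarrow> complex) \<Rightarrow> real \<Rightarrow> complex" where
  "linv c h x = 1 / (2 * pi) * (LINT y|lborel. exp (Complex c y * complex_of_real x) * h (Complex c y))"

lemma measurable_higher_deriv_line:
  assumes "f holomorphic_on halfplane r"
  shows "(\<lambda>y. (deriv ^^ i) f (Complex (r + 1) y)) \<in> borel_measurable borel"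
proof -
  have "continuous_on (halfplane r) ((deriv ^^ i) f)"
    by (intro holomorphic_on_imp_continuous_on holomorphic_higher_deriv assms open_halfspace_Re_gt)
  then have "continuous_on UNIV (\<lambda>y. (deriv ^^ i) f (Complex (r + 1) y))"
    by (rule continuous_on_compose2) (auto simp: Complex_eq intro!: continuous_intros)
  then show ?thesis by (rule borel_measurable_continuous_onI)
qed

lemma norm_exp_line: "norm (exp (Complex c y * complex_of_real x)) = exp (c * x)"
  by simp

lemma measurable_Complex_line [measurable]: "Complex c \<in> borel_measurable borel"
proof -
  have "continuous_on UNIV (Complex c)"
    using continuous_on_Complex[of UNIV "\<lambda>_. c" "\<lambda>y. y"] by (simp add: continuous_on_const continuous_on_id)
  then show ?thesis by (rule borel_measurable_continuous_onI)
qed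

lemma line_integrable:
  assumes [measurable]: "(\<lambda>y. h (Complex c y)) \<in> borel_measurable borel"
    and bd: "\<And>y. cmod (h (Complex c y)) \<le> C * (1 + \<bar>y\<bar>) powr b" and b: "b < -1"
  shows "integrable lborel (\<lambda>y. exp (Complex c y * complex_of_real x) * h (Complex c y))"
    and "integrable lborel (\<lambda>y. h (Complex c y))"
proof -
  show 2: "integrable lborel (\<lambda>y. h (Complex c y))"
    by (rule Bochner_Integration.integrable_bound[OF integrable_mult_right[OF integrable_one_plus_abs_powr[OF b], of C]])
       (use bd order_trans[OF _ abs_ge_self] in auto)
  show "integrable lborel (\<lambda>y. exp (Complex c y * complex_of_real x) * h (Complex c y))"
    by (rule Bochner_Integration.integrable_bound[OF integrable_mult_right[OF 2, of "complex_of_real (exp (c * x))"]])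
       (auto simp: norm_mult)
qed

text \<open>Differentiation in x costs a factor z, hence the decay of \<open>z * h z\<close> in
  \<open>bd'\<close>. Within distance 1 of x the exponential is at most
  \<open>exp (c * (x + 1))\<close>.\<close>

lemma has_vector_derivative_linv:
  assumes hm[measurable]: "(\<lambda>y. h (Complex c y)) \<in> borel_measurable borel"
    and bd: "\<And>y. cmod (h (Complex c y)) \<le> C * (1 + \<bar>y\<bar>) powr b"
    and bd': "\<And>y. cmod (Complex c y * h (Complex c y)) \<le> C' * (1 + \<bar>y\<bar>) powr b" and b: "b < -1" and c: "c \<ge> 0"
  shows "(linv c h has_vector_derivative linv c (\<lambda>z. z * h z) x) (at x)"
proof -
  define S where "S = {x - 1<..<x + 1}"
  have "((\<lambda>x. LINT y|lborel. exp (Complex c y * complex_of_real x) * h (Complex c y)) has_vector_derivative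
      (LINT y|lborel. exp (Complex c y * complex_of_real x) * (Complex c y * h (Complex c y)))) (at x within S)"
  proof (rule has_vector_derivative_lebesgue_integral[where g = "\<lambda>y. exp (c * (x + 1)) * (C' * (1 + \<bar>y\<bar>) powr b)"])
    show "convex S" "x \<in> S" by (auto simp: S_def)
    show "integrable lborel (\<lambda>y. exp (Complex c y * complex_of_real z) * h (Complex c y))" for z
      by (rule line_integrable(1)[OF hm bd b])
    show "(\<lambda>y. exp (Complex c y * complex_of_real x) * (Complex c y * h (Complex c y))) \<in> borel_measurable lborel" by measurable
    show "integrable lborel (\<lambda>y. exp (c * (x + 1)) * (C' * (1 + \<bar>y\<bar>) powr b))"
      by (intro integrable_mult_right integrable_one_plus_abs_powr b)
    fix z y assume z: "z \<in> S"
    show "((\<lambda>z. exp (Complex c y * complex_of_real z) * h (Complex c y)) has_vector_derivative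
        exp (Complex c y * complex_of_real z) * (Complex c y * h (Complex c y))) (at z within S)"
      by (auto intro!: derivative_eq_intros has_vector_derivative_real_field)
    have "norm (exp (Complex c y * complex_of_real z) * (Complex c y * h (Complex c y)))
        = exp (c * z) * cmod (Complex c y * h (Complex c y))"
      by (simp only: norm_mult[of "exp _"] norm_exp_line)
    also have "\<dots> \<le> exp (c * (x + 1)) * (C' * (1 + \<bar>y\<bar>) powr b)"
      using z c by (intro mult_mono bd') (auto simp: S_def intro!: mult_left_mono)
    finally show "norm (exp (Complex c y * complex_of_real z) * (Complex c y * h (Complex c y))) \<le> exp (c * (x + 1)) * (C' * (1 + \<bar>y\<bar>) powr b)" .
  qed
  moreover have "at x within S = at x" unfolding S_def by (intro at_within_open) auto
  ultimately have "((\<lambda>x. LINT y|lborel. exp (Complex c y * complex_of_real x) * h (Complex c y)) has_vector_derivative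
      (LINT y|lborel. exp (Complex c y * complex_of_real x) * (Complex c y * h (Complex c y)))) (at x)" by simp
  from has_vector_derivative_mult_right[OF this, of "1 / (2 * pi)"] show ?thesis
    by (simp only: linv_def[abs_def])
qed

text \<open>Multiplication by x turns into differentiation of the transform: the y-derivative of
  exponential times transform integrates to 0 over the line, because its boundary values
  decay.\<close>

lemma linv_by_parts:
  assumes f: "f holomorphic_on halfplane r"
    and bd: "\<And>y. cmod ((deriv ^^ i) f (Complex (r + 1) y)) \<le> C * (1 + \<bar>y\<bar>) powr b"
    and bd': "\<And>y. cmod ((deriv ^^ Suc i) f (Complex (r + 1) y)) \<le> C' * (1 + \<bar>y\<bar>) powr b" and b: "b < -1"
  shows "complex_of_real x * linv (r + 1) ((deriv ^^ i) f) x = - linv (r + 1) ((deriv ^^ Suc i) f) x"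
proof -
  define z where "z y = Complex (r + 1) y" for y
  define e where "e y = exp (z y * complex_of_real x)" for y
  define h where "h = (deriv ^^ i) f"
  define h' where "h' = (deriv ^^ Suc i) f"
  have i1: "integrable lborel (\<lambda>y. e y * h (z y))"
    unfolding e_def z_def h_def by (rule line_integrable(1)[OF measurable_higher_deriv_line[OF f] bd b])
  have i2: "integrable lborel (\<lambda>y. e y * h' (z y))"
    unfolding e_def z_def h'_def by (rule line_integrable(1)[OF measurable_higher_deriv_line[OF f] bd' b])
  have i3: "integrable lborel (\<lambda>y. \<i> * (complex_of_real x * (e y * h (z y)) + e y * h' (z y)))"
    by (intro integrable_mult_right Bochner_Integration.integrable_add i1 i2)
  \<comment> \<open>One statement for both ends of the line, \<open>s n = n\<close> and
    \<open>s n = - n\<close>.\<close>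
  have small: "(\<lambda>n. e (s n) * h (z (s n))) \<longlonglongrightarrow> 0" if s: "\<And>n::nat. \<bar>s n\<bar> = real n" for s
  proof (rule Lim_null_comparison[OF always_eventually])
    show "\<forall>n. norm (e (s n) * h (z (s n))) \<le> exp ((r + 1) * x) * (C * (1 + real n) powr b)"
    proof
      fix n
      show "norm (e (s n) * h (z (s n))) \<le> exp ((r + 1) * x) * (C * (1 + real n) powr b)"
        unfolding norm_mult e_def z_def norm_exp_line using bd[of "s n"] s[of n]
        by (intro mult_left_mono) (auto simp: h_def)
    qed
    have "filterlim (\<lambda>n. 1 + real n) at_top sequentially"
      by (intro filterlim_tendsto_add_at_top[OF tendsto_const] filterlim_real_sequentially)
    from tendsto_neg_powr[OF _ this, of b] have "(\<lambda>n. (1 + real n) powr b) \<longlonglongrightarrow> 0" using b by simp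
    then show "(\<lambda>n. exp ((r + 1) * x) * (C * (1 + real n) powr b)) \<longlonglongrightarrow> 0"
      by (intro tendsto_mult_right_zero)
  qed
  have "(LINT y:UNIV|lborel. \<i> * (complex_of_real x * (e y * h (z y)) + e y * h' (z y))) = 0 - 0"
  proof (rule set_integral_FTC_seq[where a = "\<lambda>n. - real n" and b = real and F = "\<lambda>y. e y * h (z y)"])
    show "set_integrable lborel UNIV (\<lambda>y. \<i> * (complex_of_real x * (e y * h (z y)) + e y * h' (z y)))"
      using i3 by (simp add: set_integrable_def)
    show "\<forall>\<^sub>F n in sequentially. y \<in> {- real n..real n}" for y :: real
    proof -
      obtain N :: nat where "\<bar>y\<bar> \<le> real N" using real_arch_simple by blast
      then show ?thesis by (intro eventually_sequentiallyI[of N]) auto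
    qed
    show "((\<lambda>y. e y * h (z y)) has_vector_derivative \<i> * (complex_of_real x * (e y * h (z y)) + e y * h' (z y))) (at y)" for y
    proof -
      have dz: "(z has_vector_derivative \<i>) (at y)"
        unfolding z_def Complex_eq by (auto intro!: derivative_eq_intros has_vector_derivative_of_real)
      have "h holomorphic_on halfplane r"
        unfolding h_def by (intro holomorphic_higher_deriv f open_halfspace_Re_gt)
      then have dh: "(h has_field_derivative h' (z y)) (at (z y))"
        using holomorphic_derivI[OF _ open_halfspace_Re_gt, of h r "z y"] by (simp add: h_def h'_def z_def)
      have "((\<lambda>w. exp (w * complex_of_real x) * h w) has_field_derivative
          complex_of_real x * (e y * h (z y)) + e y * h' (z y)) (at (z y))"
        unfolding e_def using dh by (auto intro!: derivative_eq_intros)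
      from field_vector_diff_chain_at[OF dz this] show ?thesis by (simp add: o_def e_def)
    qed
  qed (use small[of real] small[of "\<lambda>n. - real n"] in auto)
  then have "\<i> * (complex_of_real x * (LINT y|lborel. e y * h (z y)) + (LINT y|lborel. e y * h' (z y))) = 0"
    using i1 i2 by (simp add: set_lebesgue_integral_def)
  then have "complex_of_real x * (LINT y|lborel. e y * h (z y)) = - (LINT y|lborel. e y * h' (z y))"
    by (simp add: eq_neg_iff_add_eq_0)
  then have "1 / (2 * pi) * (complex_of_real x * (LINT y|lborel. e y * h (z y))) = 1 / (2 * pi) * - (LINT y|lborel. e y * h' (z y))"
    by (rule arg_cong)
  then show ?thesis unfolding linv_def e_def z_def h_def h'_def by (simp add: mult_ac)
qed

text \<open>Only two terms of the Leibniz rule survive; the second one later compensates the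
  derivative of \<open>inverse (x ^ m)\<close>.\<close>

lemma higher_deriv_ident_mult:
  assumes f: "f holomorphic_on S" and S: "open S" "z \<in> S"
  shows "(deriv ^^ Suc i) (\<lambda>w. w * f w) z = z * (deriv ^^ Suc i) f z + of_nat (Suc i) * (deriv ^^ i) f z"
  using S(2)
proof (induction i arbitrary: z)
  have der: "((deriv ^^ j) f has_field_derivative (deriv ^^ Suc j) f w) (at w)" if "w \<in> S" for j w
    using holomorphic_derivI[OF holomorphic_higher_deriv[OF f S(1)] S(1) that] by simp
  { case 0
    have "((\<lambda>w. w * f w) has_field_derivative z * deriv f z + f z) (at z)"
      using der[OF 0, of 0] by (auto intro!: derivative_eq_intros)
    then show ?case by (simp add: DERIV_imp_deriv) }
  { case (Suc i)
    have "((\<lambda>w. w * (deriv ^^ Suc i) f w + of_nat (Suc i) * (deriv ^^ i) f w) has_field_derivative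
       z * (deriv ^^ Suc (Suc i)) f z + of_nat (Suc (Suc i)) * (deriv ^^ Suc i) f z) (at z)"
      using der[OF Suc.prems, of "Suc i"] der[OF Suc.prems, of i]
      by (auto intro!: derivative_eq_intros simp: algebra_simps simp del: funpow.simps)
    then have "((deriv ^^ Suc i) (\<lambda>w. w * f w) has_field_derivative
       z * (deriv ^^ Suc (Suc i)) f z + of_nat (Suc (Suc i)) * (deriv ^^ Suc i) f z) (at z)"
      by (rule has_field_derivative_transform_within_open[OF _ S(1) Suc.prems]) (simp only: Suc.IH)
    then show ?case by (simp only: funpow.simps(2) [of "Suc i"] o_apply DERIV_imp_deriv) }
qed

section \<open>Derivatives of the densities\<close>

lemma linv_cong: "(\<And>y. h (Complex c y) = h' (Complex c y)) \<Longrightarrow> linv c h x = linv c h' x"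
  by (simp add: linv_def)

lemma linv_cmult: "linv c (\<lambda>z. a * h z) x = a * linv c h x"
proof -
  have "(LINT y|lborel. exp (Complex c y * complex_of_real x) * (a * h (Complex c y)))
      = (LINT y|lborel. a * (exp (Complex c y * complex_of_real x) * h (Complex c y)))"
    by (simp only: mult.left_commute)
  then show ?thesis unfolding linv_def by (simp only: integral_mult_right_zero mult.left_commute)
qed

lemma linv_add:
  assumes "integrable lborel (\<lambda>y. exp (Complex c y * complex_of_real x) * h (Complex c y))"
    and "integrable lborel (\<lambda>y. exp (Complex c y * complex_of_real x) * h' (Complex c y))"
  shows "linv c (\<lambda>z. h z + h' z) x = linv c h x + linv c h' x"
  unfolding linv_def distrib_left Bochner_Integration.integral_add[OF assms] by (rule refl)

text \<open>The transform of \<open>w\<close> may fail to be integrable along the line. Its m-th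
  derivative, up to sign the transform of \<open>x ^ m * w x\<close>, decays fast enough for
  \<open>lap_inversion\<close>. \<open>F\<close> is an explicit form of the transform.\<close>

lemma lap_inversion_times_power:
  assumes w: "lap_ok r w" and pos: "\<And>x. 0 \<le> w x" and cont: "continuous_on {0<..} w"
    and F: "F holomorphic_on halfplane r" "\<And>z. r < Re z \<Longrightarrow> lap w z = F z"
    and bd: "\<And>y. cmod ((deriv ^^ m) F (Complex (r + 1) y)) \<le> C * (1 + \<bar>y\<bar>) powr b" and b: "b < -1"
    and x: "x > 0"
  shows "complex_of_real (x ^ m * w x) = (-1) ^ m * linv (r + 1) ((deriv ^^ m) F) x"
proof -
  define v where "v x = x ^ m * w x" for x
  have v: "lap_ok r v" unfolding v_def by (rule lap_ok_power_times[OF w])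
  have lap_v: "lap v (Complex (r + 1) y) = (-1) ^ m * (deriv ^^ m) F (Complex (r + 1) y)" for y
  proof -
    have "(deriv ^^ m) F (Complex (r + 1) y) = (deriv ^^ m) (lap w) (Complex (r + 1) y)"
      by (rule higher_deriv_transform_within_open[OF F(1) holomorphic_on_lap[OF w] open_halfspace_Re_gt])
         (use F(2) in auto)
    also have "\<dots> = (-1) ^ m * lap v (Complex (r + 1) y)"
      unfolding v_def by (rule higher_deriv_lap[OF w]) simp
    finally have "(-1) ^ m * (deriv ^^ m) F (Complex (r + 1) y) = (-1) ^ m * (-1) ^ m * lap v (Complex (r + 1) y)"
      by (simp only: mult.assoc)
    then show ?thesis by (simp flip: power_mult_distrib)
  qed
  have "complex_of_real (v x) = linv (r + 1) (lap v) x"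
    unfolding linv_def
  proof (rule lap_inversion[OF v _ _ _ _ x])
    show "0 \<le> v x" for x
      using pos[of x] lap_okD(1)[OF w, of x] by (cases "x > 0") (auto simp: v_def)
    show "continuous_on {0<..} v" unfolding v_def by (intro continuous_intros cont)
    show "integrable lborel (\<lambda>y. lap v (Complex (r + 1) y))"
      unfolding lap_v
      by (intro integrable_mult_right line_integrable(2)[OF measurable_higher_deriv_line[OF F(1)] bd b])
  qed simp
  also have "\<dots> = linv (r + 1) (\<lambda>z. (-1) ^ m * (deriv ^^ m) F z) x"
    by (rule linv_cong) (rule lap_v)
  also have "\<dots> = (-1) ^ m * linv (r + 1) ((deriv ^^ m) F) x" by (rule linv_cmult)
  finally show ?thesis by (simp add: v_def)
qed

context regular_levy_density
begin

text \<open>\<open>H j\<close> is the transform expected of the j-th derivative of the convolution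
  power; \<open>Z j\<close> inverts its m-th derivative and divides by \<open>x ^ m\<close>. Only
  \<open>Z 0\<close> is identified by inversion, the others because \<open>Z (Suc j)\<close> is the
  derivative of \<open>Z j\<close>.\<close>

lemma upper_tail_power_derivatives:
  assumes k: "k \<ge> 1" and m: "m \<ge> 1" and b: "real k * \<alpha> - real m < -1"
  shows "u_fun_well_defined u k"
    and "x > 0 \<Longrightarrow> complex_of_real (x ^ m * u_fun u k x) = (-1) ^ m * linv (r + 1) ((deriv ^^ m) (\<lambda>z. \<kappa> z ^ k)) x"
proof -
  \<comment> \<open>The order of the m-th derivative of \<open>H k\<close>; it bounds the orders for
    all \<open>j \<le> k\<close>.\<close>
  define b where "b = real k * \<alpha> - real m"
  have b1: "b < -1" using b by (simp add: b_def)
  define g where "g = conv_power (upper_tail u) k"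
  define H where "H j z = z ^ j * (- \<kappa> z * inverse z) ^ k" for j z
  have sH: "symb r 1 m (real j * 1 + real k * (\<alpha> + -1)) (H j)" for j
  proof -
    have "symb r 1 m \<alpha> \<kappa>" by (rule symb_mono[OF symb_laplace_exponent]) auto
    from symb_mult[OF symb_cmult[OF this, of "-1"] symb_inverse[OF r]]
    have "symb r 1 m (\<alpha> + -1) (\<lambda>z. - \<kappa> z * inverse z)" by simp
    from symb_mult[OF symb_power[OF symb_ident[OF r]] symb_power[OF this]]
    show ?thesis by (simp add: H_def[abs_def])
  qed
  have hol: "H j holomorphic_on halfplane r" for j by (rule symb_holomorphic[OF sH])
  have bdH: "\<exists>C\<ge>0. \<forall>y. cmod ((deriv ^^ i) (H j) (Complex (r + 1) y)) \<le> C * (1 + \<bar>y\<bar>) powr e"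
    if i: "i \<le> m" and e: "real j + real k * (\<alpha> - 1) - real i \<le> e" for i j e
  proof -
    obtain C where C: "C \<ge> 0" "\<And>y. cmod ((deriv ^^ i) (H j) (Complex (r + 1) y)) \<le> C * (1 + \<bar>y\<bar>) powr (real j * 1 + real k * (\<alpha> + -1) - real i * 1)"
      using symb_bound[OF sH i] by metis
    have "C * (1 + \<bar>y\<bar>) powr (real j * 1 + real k * (\<alpha> + -1) - real i * 1) \<le> C * (1 + \<bar>y\<bar>) powr e" for y
      using e C by (intro mult_left_mono powr_mono) auto
    then show ?thesis using C order_trans by meson
  qed
  define Z where "Z j x = (-1) ^ m * linv (r + 1) ((deriv ^^ m) (H j)) x * complex_of_real (inverse (x ^ m))" for j x
  have der: "(Z j has_vector_derivative Z (Suc j) x) (at x within {0<..})" if j: "j < k" and x: "x \<in> {0<..}" for j x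
  proof -
    define h where "h = (deriv ^^ m) (H j)"
    obtain m' where m': "m = Suc m'" using m by (cases m) auto
    have jk: "real j + 1 \<le> real k" using j by linarith
    \<comment> \<open>For \<open>j < k\<close> one order is in reserve. It pays for a factor z in
      one bound and for one derivative fewer in the other.\<close>
    have e1: "real j + real k * (\<alpha> - 1) - real m \<le> b - 1" "real j + real k * (\<alpha> - 1) - real m' \<le> b"
      using jk by (simp_all add: b_def m' algebra_simps)
    obtain C where C: "C \<ge> 0" "\<And>y. cmod (h (Complex (r + 1) y)) \<le> C * (1 + \<bar>y\<bar>) powr (b - 1)"
      using bdH[OF order_refl e1(1)] unfolding h_def by metis
    obtain C' where C': "C' \<ge> 0" "\<And>y. cmod ((deriv ^^ m') (H j) (Complex (r + 1) y)) \<le> C' * (1 + \<bar>y\<bar>) powr b"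
      using bdH[OF _ e1(2)] m' by (metis le_SucI order_refl)
    have Cb: "cmod (h (Complex (r + 1) y)) \<le> C * (1 + \<bar>y\<bar>) powr b" for y
    proof -
      have "C * (1 + \<bar>y\<bar>) powr (b - 1) \<le> C * (1 + \<bar>y\<bar>) powr b"
        using C by (intro mult_left_mono powr_mono) auto
      then show ?thesis using C(2)[of y] by linarith
    qed
    have zh: "cmod (Complex (r + 1) y * h (Complex (r + 1) y)) \<le> (r + 1) * C * (1 + \<bar>y\<bar>) powr b" for y
    proof -
      have "cmod (Complex (r + 1) y) \<le> (r + 1) + \<bar>y\<bar>"
        using cmod_le[of "Complex (r + 1) y"] r by simp
      also have "\<dots> \<le> (r + 1) * (1 + \<bar>y\<bar>)"
        using r by (simp add: distrib_left distrib_right)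
      finally have "cmod (Complex (r + 1) y * h (Complex (r + 1) y)) \<le> ((r + 1) * (1 + \<bar>y\<bar>)) * (C * (1 + \<bar>y\<bar>) powr (b - 1))"
        unfolding norm_mult using C r by (intro mult_mono) auto
      also have "\<dots> = (r + 1) * C * ((1 + \<bar>y\<bar>) * (1 + \<bar>y\<bar>) powr (b - 1))" by (simp only: mult_ac)
      also have "(1 + \<bar>y\<bar>) * (1 + \<bar>y\<bar>) powr (b - 1) = (1 + \<bar>y\<bar>) powr b"
        using powr_mult_base[of "1 + \<bar>y\<bar>" "b - 1"] by simp
      finally show ?thesis .
    qed
    have hm: "(\<lambda>y. h (Complex (r + 1) y)) \<in> borel_measurable borel"
      unfolding h_def by (rule measurable_higher_deriv_line[OF hol])
    define L L' where "L = linv (r + 1) h x" and "L' = linv (r + 1) (\<lambda>z. z * h z) x"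
    have dL: "(linv (r + 1) h has_vector_derivative L') (at x)"
      unfolding L'_def by (rule has_vector_derivative_linv[OF hm Cb zh b1]) (use r in simp)
    have "((\<lambda>x. inverse (x ^ m)) has_real_derivative - (real m * inverse x * inverse (x ^ m))) (at x)"
    proof (rule DERIV_cong)
      show "((\<lambda>x. inverse (x ^ m)) has_real_derivative
          - (inverse (x ^ m) * (real m * x ^ (m - Suc 0)) * inverse (x ^ m))) (at x)"
        using x by (intro DERIV_inverse' DERIV_pow) simp
    qed (use x in \<open>simp add: m' field_simps\<close>)
    then have dx: "((\<lambda>x. complex_of_real (inverse (x ^ m))) has_vector_derivative
        complex_of_real (- (real m * inverse x * inverse (x ^ m)))) (at x)"
      unfolding has_real_derivative_iff_has_vector_derivative
      by (rule bounded_linear.has_vector_derivative[OF bounded_linear_of_real])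
    have dZ: "(Z j has_vector_derivative
        (-1) ^ m * L * complex_of_real (- (real m * inverse x * inverse (x ^ m))) + (-1) ^ m * L' * complex_of_real (inverse (x ^ m))) (at x)"
      using has_vector_derivative_mult[OF has_vector_derivative_mult_right[OF dL, of "(-1) ^ m"] dx]
      by (simp only: Z_def[abs_def] h_def L_def)
    \<comment> \<open>Differentiating \<open>inverse (x ^ m)\<close> contributes
      \<open>- m / x\<close> times \<open>L\<close>. By parts, \<open>- L / x\<close> is the
      inversion of the derivative of order \<open>m - 1\<close>, which is the extra term of the
      Leibniz rule for \<open>z * H j z\<close>.\<close>
    have bp: "complex_of_real x * linv (r + 1) ((deriv ^^ m') (H j)) x = - L"
      unfolding L_def h_def m'
      by (rule linv_by_parts[OF hol C'(2) _ b1]) (use Cb in \<open>simp only: h_def m'\<close>)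
    have "linv (r + 1) ((deriv ^^ m) (H (Suc j))) x
        = linv (r + 1) (\<lambda>z. z * h z + of_nat m * (deriv ^^ m') (H j) z) x"
    proof (rule linv_cong)
      fix y
      have "H (Suc j) = (\<lambda>z. z * H j z)" by (simp add: H_def fun_eq_iff)
      then show "(deriv ^^ m) (H (Suc j)) (Complex (r + 1) y)
          = Complex (r + 1) y * h (Complex (r + 1) y) + of_nat m * (deriv ^^ m') (H j) (Complex (r + 1) y)"
        unfolding h_def m'
        by (simp only: ) (rule higher_deriv_ident_mult[OF hol open_halfspace_Re_gt], simp)
    qed
    also have "\<dots> = L' + of_nat m * linv (r + 1) ((deriv ^^ m') (H j)) x"
    proof (subst linv_add)
      note [measurable] = hm
      show "integrable lborel (\<lambda>y. exp (Complex (r + 1) y * complex_of_real x) * (Complex (r + 1) y * h (Complex (r + 1) y)))"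
        by (rule line_integrable(1)[where h = "\<lambda>z. z * h z", OF _ zh b1]) measurable
      have "integrable lborel (\<lambda>y. of_nat m * (exp (Complex (r + 1) y * complex_of_real x) * (deriv ^^ m') (H j) (Complex (r + 1) y)))"
        by (intro integrable_mult_right line_integrable(1)[OF measurable_higher_deriv_line[OF hol] C'(2) b1])
      then show "integrable lborel (\<lambda>y. exp (Complex (r + 1) y * complex_of_real x) * (of_nat m * (deriv ^^ m') (H j) (Complex (r + 1) y)))"
        by (simp only: mult.left_commute)
    qed (simp only: L'_def linv_cmult)
    also have "linv (r + 1) ((deriv ^^ m') (H j)) x = - L * inverse (complex_of_real x)"
      using bp x by (simp add: field_simps)
    finally have "Z (Suc j) x = (-1) ^ m * (L' + of_nat m * (- L * inverse (complex_of_real x))) * complex_of_real (inverse (x ^ m))"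
      by (simp only: Z_def)
    also have "\<dots> = (-1) ^ m * L * complex_of_real (- (real m * inverse x * inverse (x ^ m))) + (-1) ^ m * L' * complex_of_real (inverse (x ^ m))"
      by (simp add: algebra_simps)
    finally have "(Z j has_vector_derivative Z (Suc j) x) (at x)" using dZ by simp
    then show ?thesis by (rule has_vector_derivative_at_within)
  qed
  have Z0: "complex_of_real (g x) = Z 0 x" if x: "x \<in> {0<..}" for x
  proof -
    have cg: "causal r g" unfolding g_def by (rule causal_conv_power(1)[OF causal_upper_tail k])
    have "real 0 + real k * (\<alpha> - 1) - real m \<le> b" by (simp add: b_def algebra_simps)
    from bdH[OF order_refl this] obtain C where
      C: "\<And>y. cmod ((deriv ^^ m) (H 0) (Complex (r + 1) y)) \<le> C * (1 + \<bar>y\<bar>) powr b" by blast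
    have "complex_of_real (x ^ m * zext g x) = (-1) ^ m * linv (r + 1) ((deriv ^^ m) (H 0)) x"
    proof (rule lap_inversion_times_power[OF _ _ _ hol _ C b1])
      show "lap_ok r (zext g)" "0 \<le> zext g x" for x using cg by (auto simp: causal_def zext_def)
      show "continuous_on {0<..} (zext g)"
        using cg unfolding causal_def zext_def by (simp cong: continuous_on_cong_simp)
      show "lap (zext g) z = H 0 z" if "r < Re z" for z
        using causal_conv_power(3)[OF causal_upper_tail k that] lap_upper_tail[OF that]
        by (simp add: g_def H_def divide_inverse)
    qed (use x in simp)
    then show ?thesis using x by (simp add: Z_def zext_def field_simps)
  qed
  have nt: "at x within {0<..} \<noteq> bot" if "x \<in> {0<..}" for x :: real
  proof -
    have "at x within {0<..} = at x" using that by (intro at_within_open) auto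
    then show ?thesis by simp
  qed
  note main = nth_deriv_on_eqI[where Z = Z and k = k and S = "{0<..}" and f = g, OF nt Z0 der]
  show "u_fun_well_defined u k"
    unfolding u_fun_well_defined_def
    using u_tail_integrable causal_conv_power(2)[OF causal_upper_tail k] main(1) by (auto simp: g_def)
  show "complex_of_real (x ^ m * u_fun u k x) = (-1) ^ m * linv (r + 1) ((deriv ^^ m) (\<lambda>z. \<kappa> z ^ k)) x" if x: "x > 0"
  proof -
    have "complex_of_real (nth_deriv_on {0<..} k g x) = Z k x" by (rule main(2)) (use x in auto)
    then have "complex_of_real (x ^ m * u_fun u k x) = (-1) ^ k * ((-1) ^ m * linv (r + 1) ((deriv ^^ m) (H k)) x)"
      using x by (simp add: u_fun_def g_def Z_def field_simps)
    \<comment> \<open>At \<open>j = k\<close> the powers of z cancel those in the tail transform;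
      the remaining sign \<open>(-1) ^ k\<close> meets the one in \<open>u_fun\<close>.\<close>
    also have "linv (r + 1) ((deriv ^^ m) (H k)) x = linv (r + 1) (\<lambda>z. (-1) ^ k * (deriv ^^ m) (\<lambda>z. \<kappa> z ^ k) z) x"
    proof (rule linv_cong)
      fix y
      have hk: "(\<lambda>z. \<kappa> z ^ k) holomorphic_on halfplane r"
        by (intro holomorphic_intros holomorphic_on_laplace_exponent)
      have "(deriv ^^ m) (H k) (Complex (r + 1) y) = (deriv ^^ m) (\<lambda>z. (-1) ^ k * \<kappa> z ^ k) (Complex (r + 1) y)"
      proof (rule higher_deriv_transform_within_open[OF hol _ open_halfspace_Re_gt])
        show "(\<lambda>z. (-1) ^ k * \<kappa> z ^ k) holomorphic_on halfplane r" by (intro holomorphic_intros hk holomorphic_on_laplace_exponent)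
        fix z assume "z \<in> halfplane r"
        then have "z \<noteq> 0" using r by auto
        then show "H k z = (-1) ^ k * \<kappa> z ^ k"
        proof -
          have "z * (- \<kappa> z * inverse z) = -1 * \<kappa> z" using \<open>z \<noteq> 0\<close> by simp
          then show ?thesis by (simp only: H_def power_mult_distrib[symmetric])
        qed
      qed simp
      also have "\<dots> = (-1) ^ k * (deriv ^^ m) (\<lambda>z. \<kappa> z ^ k) (Complex (r + 1) y)"
        by (rule higher_deriv_cmult[OF hk _ open_halfspace_Re_gt]) simp
      finally show "(deriv ^^ m) (H k) (Complex (r + 1) y) = (-1) ^ k * (deriv ^^ m) (\<lambda>z. \<kappa> z ^ k) (Complex (r + 1) y)" .
    qed
    also have "\<dots> = (-1) ^ k * linv (r + 1) ((deriv ^^ m) (\<lambda>z. \<kappa> z ^ k)) x" by (rule linv_cmult)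
    also have "(-1) ^ k * ((-1) ^ m * ((-1) ^ k * linv (r + 1) ((deriv ^^ m) (\<lambda>z. \<kappa> z ^ k)) x))
        = ((-1) ^ k * (-1) ^ k) * ((-1) ^ m * linv (r + 1) ((deriv ^^ m) (\<lambda>z. \<kappa> z ^ k)) x)" by (simp only: mult_ac)
    also have "(-1) ^ k * (-1) ^ k = (1::complex)" by (simp flip: power_mult_distrib)
    finally show ?thesis by simp
  qed
qed

section \<open>Time derivatives under the inversion integral\<close>

text \<open>\<kappa> has nonpositive real part, since \<open>u \<ge> 0\<close> and the exponential
  in its integrand has modulus at most 1. This is the bound uniform in \<open>t\<close> from which
  \<open>symb_exp_bound\<close> starts.\<close>

lemma norm_exp_laplace_exponent_le:
  assumes "t \<ge> 0"
  shows "cmod (exp (complex_of_real t * \<kappa> (Complex (r + 1) y))) \<le> 1"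
proof -
  define z where "z = Complex (r + 1) y"
  have z: "Re z > 0" using r by (simp add: z_def)
  have eq: "Re (\<kappa> z) = (LINT x|lborel. Re (indicator {0<..} x *\<^sub>R ((exp (- z * complex_of_real x) - 1) * complex_of_real (u x))))"
    unfolding laplace_exponent_def set_lebesgue_integral_def
    by (rule integral_Re[symmetric]) (rule laplace_exponent_integrable, use z in simp)
  have nonpos: "Re (indicator {0<..} x *\<^sub>R ((exp (- z * complex_of_real x) - 1) * complex_of_real (u x))) \<le> 0" for x
  proof -
    show "Re (indicator {0<..} x *\<^sub>R ((exp (- z * complex_of_real x) - 1) * complex_of_real (u x))) \<le> 0"
    proof (cases "x > 0")
      case True
      have "Re (exp (- z * complex_of_real x)) \<le> cmod (exp (- z * complex_of_real x))" by (rule complex_Re_le_cmod)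
      also have "\<dots> \<le> 1" using True z by simp
      finally show ?thesis using True u_nonneg[OF True] by (simp add: mult_nonpos_nonneg)
    qed simp
  qed
  have "0 \<le> (LINT x|lborel. - Re (indicator {0<..} x *\<^sub>R ((exp (- z * complex_of_real x) - 1) * complex_of_real (u x))))"
    using nonpos by (intro Bochner_Integration.integral_nonneg) simp
  then have "Re (\<kappa> z) \<le> 0" unfolding eq by simp
  then show ?thesis using assms by (simp add: z_def mult_nonneg_nonpos)
qed

text \<open>Up to the sign \<open>(-1) ^ m\<close>, the transform expected of \<open>x ^ m\<close>
  times the k-th time derivative of the density.\<close>

definition time_deriv :: "nat \<Rightarrow> real \<Rightarrow> complex \<Rightarrow> complex" where
  "time_deriv k t = (deriv ^^ m) (\<lambda>z. \<kappa> z ^ k * exp (complex_of_real t * \<kappa> z))"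

lemma time_deriv_bound:
  shows "\<exists>C. \<forall>t\<in>{0..T}. \<forall>y. cmod (time_deriv k t (Complex (r + 1) y)) \<le> C * (1 + \<bar>y\<bar>) powr (real k * \<alpha> - real m * (1 - \<alpha>))"
  unfolding time_deriv_def
proof (rule symb_exp_bound)
  \<comment> \<open>The step \<open>1 - \<alpha>\<close> is dictated by the order
    \<open>\<alpha> - 1\<close> of \<open>deriv \<kappa>\<close>, which has to be
    \<open>- g\<close>; the faster decay of the higher derivatives is given up.\<close>
  show "symb r (1 - \<alpha>) m (- (1 - \<alpha>)) (deriv \<kappa>)"
    by (rule symb_mono[OF symb_deriv_laplace_exponent]) (use \<alpha> in auto)
  show "symb r (1 - \<alpha>) m (real k * \<alpha>) (\<lambda>z. \<kappa> z ^ k)"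
    by (rule symb_power, rule symb_mono[OF symb_laplace_exponent]) (use \<alpha> in auto)
qed (use holomorphic_on_laplace_exponent norm_exp_laplace_exponent_le in auto)

lemma measurable_time_deriv: "(\<lambda>y. time_deriv k t (Complex (r + 1) y)) \<in> borel_measurable borel"
  unfolding time_deriv_def
  by (rule measurable_higher_deriv_line) (intro holomorphic_intros holomorphic_on_laplace_exponent)

text \<open>The majorant is uniform on bounded time intervals, here \<open>{0..T}\<close> with
  \<open>T = t + 1\<close>. As \<open>t < T\<close>, derivatives within this interval and within
  \<open>{0..}\<close> agree; at \<open>t = 0\<close> they are one-sided.\<close>

lemma has_vector_derivative_linv_time_deriv:
  assumes b: "real (Suc k) * \<alpha> - real m * (1 - \<alpha>) < -1" and t: "t \<ge> 0"
  shows "((\<lambda>t. linv (r + 1) (time_deriv k t) x) has_vector_derivative linv (r + 1) (time_deriv (Suc k) t) x) (at t within {0..})"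
proof -
  define T where "T = t + 1"
  define e where "e y = exp (Complex (r + 1) y * complex_of_real x)" for y
  define E where "E = exp ((r + 1) * x)"
  have ne: "norm (e y) = E" for y unfolding e_def E_def by (rule norm_exp_line)
  define b1 where "b1 = real (Suc k) * \<alpha> - real m * (1 - \<alpha>)"
  obtain C0 where C0: "\<And>t y. t \<in> {0..T} \<Longrightarrow> cmod (time_deriv k t (Complex (r + 1) y)) \<le> C0 * (1 + \<bar>y\<bar>) powr (real k * \<alpha> - real m * (1 - \<alpha>))"
    using time_deriv_bound[of T k] by blast
  obtain C where C: "\<And>t y. t \<in> {0..T} \<Longrightarrow> cmod (time_deriv (Suc k) t (Complex (r + 1) y)) \<le> C * (1 + \<bar>y\<bar>) powr b1"
    using time_deriv_bound[of T "Suc k"] unfolding b1_def by blast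
  have b0: "real k * \<alpha> - real m * (1 - \<alpha>) < -1" using b \<alpha> by (simp add: distrib_right)
  note [measurable] = measurable_time_deriv
  have "((\<lambda>t. LINT y|lborel. e y * time_deriv k t (Complex (r + 1) y)) has_vector_derivative
      (LINT y|lborel. e y * time_deriv (Suc k) t (Complex (r + 1) y))) (at t within {0..T})"
  proof (rule has_vector_derivative_lebesgue_integral[where g = "\<lambda>y. E * (C * (1 + \<bar>y\<bar>) powr b1)"])
    show "convex {0..T}" "t \<in> {0..T}" using t by (auto simp: T_def)
    show "integrable lborel (\<lambda>y. e y * time_deriv k s (Complex (r + 1) y))" if "s \<in> {0..T}" for s
      unfolding e_def by (rule line_integrable(1)[OF measurable_time_deriv C0[OF that] b0])
    show "(\<lambda>y. e y * time_deriv (Suc k) t (Complex (r + 1) y)) \<in> borel_measurable lborel"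
      unfolding e_def by measurable
    show "integrable lborel (\<lambda>y. E * (C * (1 + \<bar>y\<bar>) powr b1))"
      using b by (intro integrable_mult_right integrable_one_plus_abs_powr) (simp add: b1_def)
    fix s y assume s: "s \<in> {0..T}"
    have kh: "(\<lambda>z. \<kappa> z ^ k) holomorphic_on halfplane r"
      by (intro holomorphic_intros holomorphic_on_laplace_exponent)
    have "((\<lambda>s. time_deriv k s (Complex (r + 1) y)) has_vector_derivative
        (deriv ^^ m) (\<lambda>z. \<kappa> z ^ k * \<kappa> z * exp (complex_of_real s * \<kappa> z)) (Complex (r + 1) y)) (at s)"
      unfolding time_deriv_def
      by (rule has_vector_derivative_higher_deriv_exp[OF holomorphic_on_laplace_exponent kh open_halfspace_Re_gt]) simp
    then have "((\<lambda>s. time_deriv k s (Complex (r + 1) y)) has_vector_derivative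
        time_deriv (Suc k) s (Complex (r + 1) y)) (at s)"
      by (simp add: time_deriv_def mult.commute)
    from has_vector_derivative_mult_right[OF this]
    show "((\<lambda>s. e y * time_deriv k s (Complex (r + 1) y)) has_vector_derivative e y * time_deriv (Suc k) s (Complex (r + 1) y)) (at s within {0..T})"
      by (rule has_vector_derivative_at_within)
    show "norm (e y * time_deriv (Suc k) s (Complex (r + 1) y)) \<le> E * (C * (1 + \<bar>y\<bar>) powr b1)"
      unfolding norm_mult ne using C[OF s] by (intro mult_left_mono) (auto simp: E_def)
  qed
  from has_vector_derivative_mult_right[OF this, of "1 / (2 * pi)"]
  have "((\<lambda>t. linv (r + 1) (time_deriv k t) x) has_vector_derivative linv (r + 1) (time_deriv (Suc k) t) x) (at t within {0..T})"
    by (simp only: linv_def e_def)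
  moreover have "at t within {0..T} = at t within {0..}"
    by (rule at_within_nhd[of _ "{..<T}"]) (use t in \<open>auto simp: T_def\<close>)
  ultimately show ?thesis by simp
qed

lemma density_representation:
  assumes q: "lap_ok r q" "\<And>x. 0 \<le> q x" "continuous_on {0<..} q"
    and lap: "\<And>z. r < Re z \<Longrightarrow> lap q z = exp (complex_of_real t * \<kappa> z)"
    and t: "t \<ge> 0" and b: "- real m * (1 - \<alpha>) < -1" and x: "x > 0"
  shows "complex_of_real (x ^ m * q x) = (-1) ^ m * linv (r + 1) (time_deriv 0 t) x"
proof -
  obtain C where C: "\<And>y. cmod (time_deriv 0 t (Complex (r + 1) y)) \<le> C * (1 + \<bar>y\<bar>) powr (- real m * (1 - \<alpha>))"
    using time_deriv_bound[of t 0] t by (simp, meson atLeastAtMost_iff order_refl)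
  have e: "time_deriv 0 t = (deriv ^^ m) (\<lambda>z. exp (complex_of_real t * \<kappa> z))"
    by (simp add: time_deriv_def)
  show ?thesis unfolding e
    by (rule lap_inversion_times_power[OF q _ lap C[unfolded e] b x])
       (intro holomorphic_intros holomorphic_on_laplace_exponent)
qed

text \<open>At time 0 the transform is the constant 1, which one differentiation removes; this
  accounts for \<open>p x 0 = 0\<close>.\<close>

lemma time_deriv_zero: "m \<ge> 1 \<Longrightarrow> time_deriv 0 0 z = 0"
proof -
  have "(deriv ^^ i) (\<lambda>_::complex. 1::complex) = (\<lambda>_. if i = 0 then 1 else 0)" for i
    by (induction i) (auto simp: fun_eq_iff)
  then show "m \<ge> 1 \<Longrightarrow> time_deriv 0 0 z = 0" by (simp add: time_deriv_def)
qed

text \<open>Total mass 1 makes the density integrable, and \<open>exp (- s * x) \<le> 1\<close> for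
  \<open>s > r \<ge> 0\<close> and positive x. The transform is the Laplace transform of
  \<open>X t\<close>, written over its density.\<close>

lemma marginal_density:
  assumes X: "pure_jump_subordinator_with_levy_density M X u" and p: "continuous_densities M X p" and t: "t > 0"
  defines "q \<equiv> zext (\<lambda>x. p x t)"
  shows "lap_ok r q" "\<And>x. 0 \<le> q x" "continuous_on {0<..} q"
    and "r < Re z \<Longrightarrow> lap q z = exp (complex_of_real t * \<kappa> z)"
proof -
  have qp: "(\<lambda>x. ennreal (if x > 0 then p x t else 0)) = (\<lambda>x. ennreal (q x))"
    by (simp add: q_def zext_def)
  have "distributed M lborel (X t) (\<lambda>x. ennreal (if x > 0 then p x t else 0))"
    using p t by (simp add: continuous_densities_def)
  then have dist: "distributed M lborel (X t) (\<lambda>x. ennreal (q x))" by (simp only: qp)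
  show q0: "0 \<le> q x" for x using p t by (auto simp: continuous_densities_def q_def zext_def)
  have pc: "continuous_on {0<..} (\<lambda>x. p x t)" using p t by (auto simp: continuous_densities_def)
  then show "continuous_on {0<..} q" unfolding q_def zext_def by (simp cong: continuous_on_cong_simp)
  have qm[measurable]: "q \<in> borel_measurable borel" unfolding q_def by (rule zext_measurable[OF pc])
  interpret prob_space M
    using X by (simp add: pure_jump_subordinator_with_levy_density_def subordinator_def)
  have Xm[measurable]: "X t \<in> borel_measurable M"
    using X t by (simp add: pure_jump_subordinator_with_levy_density_def subordinator_def)
  have D: "distr M lborel (X t) = density lborel (\<lambda>x. ennreal (q x))"
    using dist by (simp add: distributed_def)
  have "(\<integral>\<^sup>+x. ennreal (q x) \<partial>lborel) = emeasure (density lborel (\<lambda>x. ennreal (q x))) UNIV"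
    by (simp add: emeasure_density)
  also have "\<dots> = emeasure M (space M)"
    unfolding D[symmetric] by (subst emeasure_distr) auto
  finally have "(\<integral>\<^sup>+x. ennreal (q x) \<partial>lborel) < \<infinity>" by (simp add: emeasure_space_1)
  then have qi: "integrable lborel q"
    using q0 by (intro integrableI_bounded) auto
  show "lap_ok r q"
    unfolding lap_ok_def
  proof (intro conjI allI impI qm)
    show "q x = 0" if "x \<le> 0" for x using that by (simp add: q_def zext_def)
    fix s assume s: "s > r"
    show "integrable lborel (\<lambda>x. exp (- s * x) * q x)"
    proof (rule Bochner_Integration.integrable_bound[OF qi])
      show "AE x in lborel. norm (exp (- s * x) * q x) \<le> norm (q x)"
      proof (rule AE_I2)
        fix x
        show "norm (exp (- s * x) * q x) \<le> norm (q x)"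
        proof (cases "x > 0")
          case True
          have "exp (- s * x) * \<bar>q x\<bar> \<le> 1 * \<bar>q x\<bar>"
            using True s r by (intro mult_right_mono) auto
          then show ?thesis by (simp add: abs_mult)
        qed (simp add: q_def zext_def)
      qed
    qed measurable
  qed
  show "lap q z = exp (complex_of_real t * \<kappa> z)" if z: "r < Re z" for z
  proof -
    have "lap q z = (LINT x|lborel. q x *\<^sub>R exp (- z * complex_of_real x))"
      unfolding lap_def by (simp only: scaleR_conv_of_real mult.commute)
    also have "\<dots> = (LINT x|density lborel (\<lambda>x. ennreal (q x)). exp (- z * complex_of_real x))"
      by (rule integral_density[symmetric]) (use q0 in auto)
    also have "\<dots> = (LINT \<omega>|M. exp (- z * complex_of_real (X t \<omega>)))"
      unfolding D[symmetric] by (rule integral_distr) auto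
    also have "\<dots> = exp (complex_of_real t * \<kappa> z)"
      using X t z r by (simp add: pure_jump_subordinator_with_levy_density_def)
    finally show ?thesis .
  qed
qed

end

theorem theorem6:
  fixes m n :: nat and \<alpha> r :: real and u :: "real \<Rightarrow> real"
    and M :: "'a measure" and X :: "real \<Rightarrow> 'a \<Rightarrow> real" and p :: "real \<Rightarrow> real \<Rightarrow> real"
  assumes "0 < \<alpha>" "\<alpha> < 1" "0 \<le> r"
    and "infinite_activity_levy_density u"
    and "pure_jump_subordinator_with_levy_density M X u"
    and "real m > (1 + real n * \<alpha>) / (1 - \<alpha>)"
    and "times_differentiable_on {0<..} m u"
    and "\<And>l. l \<le> m \<Longrightarrow> integrable lborel (v_fun r u l)"
    and "\<And>l. l \<le> m \<Longrightarrow>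
           (\<lambda>\<delta>. integral_modulus \<delta> (v_fun r u l)) \<in> O[at_right 0](\<lambda>\<delta>. \<delta> powr (1 - \<alpha>))"
    and "continuous_densities M X p"
  shows "(\<forall>x>0. times_differentiable_on {0..} n (\<lambda>t. p x t)) \<and>
         (\<forall>k\<in>{1..n}. u_fun_well_defined u k) \<and>
         (\<forall>k\<in>{1..n}. \<forall>x>0. nth_deriv_on {0..} k (\<lambda>t. p x t) 0 = u_fun u k x)"
proof -
  interpret regular_levy_density m \<alpha> r u
    using assms by unfold_locales auto
  \<comment> \<open>The bound on \<open>m\<close> cleared of its denominator. As \<alpha> > 0, the
    exponent condition for \<open>n\<close> implies that for every smaller \<open>k\<close>.\<close>
  have "1 + real n * \<alpha> < real m * (1 - \<alpha>)"
    using assms(1,2,6) by (simp add: pos_divide_less_eq)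
  moreover have "real k * \<alpha> \<le> real n * \<alpha>" if "k \<le> n" for k
    using that assms(1) by (intro mult_right_mono) auto
  ultimately have b: "real k * \<alpha> - real m * (1 - \<alpha>) < -1" if "k \<le> n" for k
    using that by fastforce
  have m1: "m \<ge> 1" using b[of 0] by (cases m) auto
  have b': "real k * \<alpha> - real m < -1" if "k \<le> n" for k
  proof -
    have "0 \<le> real m * \<alpha>" using assms(1) by simp
    then show ?thesis using b[OF that] unfolding right_diff_distrib by linarith
  qed
  \<comment> \<open>The candidate for the k-th time derivative at \<open>t\<close>, with the factor
    \<open>x ^ m\<close> divided out.\<close>
  define Z where "Z x k t = (-1) ^ m * linv (r + 1) (time_deriv k t) x * complex_of_real (inverse (x ^ m))" for x k t
  have Z0: "complex_of_real (p x t) = Z x 0 t" if x: "x > 0" and t: "t \<ge> 0" for x t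
  proof (cases "t = 0")
    \<comment> \<open>There is no density to invert at time 0; both sides are 0.\<close>
    case True
    have "linv (r + 1) (time_deriv 0 0) x = 0"
      by (simp add: linv_def time_deriv_zero[OF m1])
    then show ?thesis using True x assms(10) by (simp add: Z_def continuous_densities_def)
  next
    case False
    then have "t > 0" using t by simp
    note q = marginal_density[OF assms(5,10) this]
    have "- real m * (1 - \<alpha>) < -1" using b[of 0] by simp
    from density_representation[OF q t this x] show ?thesis
      using x by (simp add: Z_def zext_def field_simps)
  qed
  have der: "(Z x j has_vector_derivative Z x (Suc j) t) (at t within {0..})" if "j < n" "t \<ge> 0" for x j t
    unfolding Z_def[abs_def] using that b[of "Suc j"]
    by (intro has_vector_derivative_mult_left has_vector_derivative_mult_right has_vector_derivative_linv_time_deriv) auto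
  \<comment> \<open>Every point of \<open>{0..}\<close> is a limit from the right, so derivatives
    within \<open>{0..}\<close>, also at 0, are unique.\<close>
  have nt: "at t within {0..} \<noteq> bot" if "t \<ge> 0" for t :: real
  proof -
    have "{t<..<t + 1} \<subseteq> {0..}" using that by auto
    then show ?thesis
      by (metis at_within_eq_bot_iff islimpt_greaterThanLessThan1 islimpt_subset less_add_one trivial_limit_within)
  qed
  have main: "times_differentiable_on {0..} n (p x)"
      "\<And>k. k \<le> n \<Longrightarrow> complex_of_real (nth_deriv_on {0..} k (p x) 0) = Z x k 0" if x: "x > 0" for x
    by (rule nth_deriv_on_eqI[where Z = "Z x" and k = n]; use nt Z0[OF x] der in auto)+
  have "nth_deriv_on {0..} k (p x) 0 = u_fun u k x" if k: "k \<in> {1..n}" and x: "x > 0" for k x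
  proof -
    \<comment> \<open>At \<open>t = 0\<close> the exponential is 1, so \<open>time_deriv k 0\<close>
      is the m-th derivative of \<open>\<kappa> z ^ k\<close>, as for the convolution power.\<close>
    have "complex_of_real (x ^ m * u_fun u k x) = (-1) ^ m * linv (r + 1) (time_deriv k 0) x"
      using upper_tail_power_derivatives(2)[OF _ m1 b' x, of k] k by (simp add: time_deriv_def)
    then have "Z x k 0 = complex_of_real (u_fun u k x)"
      using x by (simp add: Z_def field_simps)
    then show ?thesis using main(2)[OF x, of k] k by simp
  qed
  moreover have "u_fun_well_defined u k" if "k \<in> {1..n}" for k
    using upper_tail_power_derivatives(1)[OF _ m1 b', of k] that by simp
  ultimately show ?thesis using main(1) by blast
qed

end
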